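(* Let $T$ be a continuous linear operator on a Polish topological vector space $X$, and let $\mathcal M\subset\mathcal P_T(X)$ be an adequate family of $T$-invariant measures. Consider: (1) $T$ admits an ergodic measure $m$ with full support such that $m\in\overline{\mathcal M}$; (2) $T$ admits an invariant measure $m\in\overline{\mathcal M}$ with $m(HC(T))=1$; (3) for every $\Omega\in\mathcal O_T$, the Dirac measure $\delta_0$ belongs to the closure of $\overline{\mathcal M}(\Omega)$ in $\mathcal P(X)$; (4) for every $O\in\mathcal O_T$, $\overline{\mathcal M}(O)$ is a dense $G_\delta$ subset of $\overline{\mathcal M}$; (5) $\overline{\mathcal M}(HC(T))$ is a dense $G_\delta$ subset of $\overline{\mathcal M}$. Then (2), (3), (4), (5) are equivalent and are implied by (1). Moreover, if (2)–(5) hold, then $T$ admits an ergodic measure with full support.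
   Context: $\mathcal P(X)$: Borel probability measures on $X$ with the Prokhorov topology; $\mathcal P_T(X)$: the $T$-invariant ones. For $\mathcal M\subset\mathcal P(X)$, $\overline{\mathcal M}$ is its closure in $\mathcal P(X)$ and, for Borel $A$, $\overline{\mathcal M}(A)=\{m\in\overline{\mathcal M}: m(A)=1\}$. A nonempty $\mathcal M\subset\mathcal P_T(X)$ is adequate if: (i) for $\mu\in\mathcal M$ and $r>0$, the measure $\mu^r(A)=\mu(r\cdot A)$ lies in $\mathcal M$; (ii) $\mu_1*\mu_2\in\mathcal M$ whenever $\mu_1,\mu_2\in\mathcal M$ (convolution w.r.t. addition on $X$); (iii) each $\mu\in\mathcal M$ has compact support. $\mathcal O_T$ is the family of nonempty open sets $O\subset X$ with $T^{-1}(O)\subset O$. $HC(T)$ is the set of vectors with dense $T$-orbit. Full support means positive measure on every nonempty open set. *)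

theory Defs
  imports "HOL-Analysis.Analysis" "HOL-Probability.Probability"
begin

definition prob_measures :: "('a::topological_space) measure set" where
  "prob_measures = {\<mu>. sets \<mu> = sets borel \<and> prob_space \<mu>}"

definition weak_topology :: "('a::topological_space) measure topology" where
  "weak_topology = topology_generated_by
     {{\<mu> \<in> prob_measures. (\<integral>x. f x \<partial>\<mu>) \<in> U} | f U.
        continuous_on UNIV f \<and> bounded (range f) \<and> open (U :: real set)}"

definition invariant_measure :: "('a::topological_space \<Rightarrow> 'a) \<Rightarrow> 'a measure \<Rightarrow> bool" where
  "invariant_measure T \<mu> \<longleftrightarrow> \<mu> \<in> prob_measures \<and> distr \<mu> borel T = \<mu>"

definition invariant_measures :: "('a::topological_space \<Rightarrow> 'a) \<Rightarrow> 'a measure set" where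
  "invariant_measures T = {\<mu>. invariant_measure T \<mu>}"

definition ergodic_measure :: "('a::topological_space \<Rightarrow> 'a) \<Rightarrow> 'a measure \<Rightarrow> bool" where
  "ergodic_measure T \<mu> \<longleftrightarrow> invariant_measure T \<mu> \<and>
     (\<forall>A \<in> sets borel. T -` A = A \<longrightarrow> emeasure \<mu> A = 0 \<or> emeasure \<mu> A = 1)"

definition full_support :: "('a::topological_space) measure \<Rightarrow> bool" where
  "full_support \<mu> \<longleftrightarrow> (\<forall>V. open V \<and> V \<noteq> {} \<longrightarrow> emeasure \<mu> V > 0)"

definition measure_support :: "('a::topological_space) measure \<Rightarrow> 'a set" where
  "measure_support \<mu> = {x. \<forall>U. open U \<and> x \<in> U \<longrightarrow> emeasure \<mu> U > 0}"

text \<open>mu^r (A) = mu (r . A), i.e. the image of mu under x |-> r^-1 x.\<close>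
definition rescale_measure :: "real \<Rightarrow> ('a::{real_vector,topological_space}) measure \<Rightarrow> 'a measure" where
  "rescale_measure r \<mu> = distr \<mu> borel (\<lambda>x. inverse r *\<^sub>R x)"

definition convolution :: "('a::{real_vector,topological_space}) measure \<Rightarrow> 'a measure \<Rightarrow> 'a measure" where
  "convolution \<mu>1 \<mu>2 = distr (\<mu>1 \<Otimes>\<^sub>M \<mu>2) borel (\<lambda>(x, y). x + y)"

definition adequate :: "('a::{real_vector,topological_space} \<Rightarrow> 'a) \<Rightarrow> 'a measure set \<Rightarrow> bool" where
  "adequate T \<M> \<longleftrightarrow> \<M> \<noteq> {} \<and> \<M> \<subseteq> invariant_measures T \<and>
     (\<forall>\<mu>\<in>\<M>. \<forall>r>0. rescale_measure r \<mu> \<in> \<M>) \<and>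
     (\<forall>\<mu>1\<in>\<M>. \<forall>\<mu>2\<in>\<M>. convolution \<mu>1 \<mu>2 \<in> \<M>) \<and>
     (\<forall>\<mu>\<in>\<M>. compact (measure_support \<mu>))"

definition mclosure :: "('a::topological_space) measure set \<Rightarrow> 'a measure set" where
  "mclosure \<M> = weak_topology closure_of \<M>"

definition mclosure_on :: "('a::topological_space) measure set \<Rightarrow> 'a set \<Rightarrow> 'a measure set" where
  "mclosure_on \<M> A = {m \<in> mclosure \<M>. emeasure m A = 1}"

definition O_T :: "('a::topological_space \<Rightarrow> 'a) \<Rightarrow> 'a set set" where
  "O_T T = {V. open V \<and> V \<noteq> {} \<and> T -` V \<subseteq> V}"

definition HC :: "('a::topological_space \<Rightarrow> 'a) \<Rightarrow> 'a set" where
  "HC T = {x. closure (range (\<lambda>n. (T ^^ n) x)) = UNIV}"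

definition dense_gdelta_in :: "('a::topological_space) measure set \<Rightarrow> 'a measure set \<Rightarrow> bool" where
  "dense_gdelta_in S B \<longleftrightarrow> S \<subseteq> B \<and> gdelta_in (subtopology weak_topology B) S \<and>
     (subtopology weak_topology B) closure_of S = B"

end

theory Submission
  imports Defs
begin

text \<open>
  If \<open>m(HC(T)) = 1\<close>, the rescaled measures \<open>m\<^sup>r\<close> are carried by every \<open>\<Omega> \<in> \<O>\<^sub>T\<close> and tend to \<open>\<delta>\<^sub>0\<close>.
  Conversely, to approximate \<open>\<mu> \<in> \<M>\<close> by measures almost carried by \<open>O \<in> \<O>\<^sub>T\<close>, convolve \<open>\<mu>\<close> with a
  measure \<open>\<nu>\<close> close to \<open>\<delta>\<^sub>0\<close> and carried by \<open>\<Omega> = {x. \<mu>(O - x) > 1 - \<epsilon>}\<close>. This set belongs to \<open>\<O>\<^sub>T\<close> as soon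
  as it is nonempty, and that is the crux: condition (3) makes \<open>T\<close> transitive enough to send small
  vectors to finitely many prescribed open sets at the same time, whence \<open>sup\<^sub>x \<mu>(O - x) = 1\<close>.
  Density of the open sets \<open>{m. m(O) > 1 - \<epsilon>}\<close> gives (4) and (5) by Baire category, for which the
  completeness of \<open>\<P>(X)\<close> is replaced by Prokhorov's theorem. Finally, an ergodic measure with full support
  is an ergodic component of a measure carried by \<open>HC(T)\<close>.
\<close>

section \<open>Weak convergence of probability measures\<close>

text \<open>The obstacle is that nothing controls the time \<open>k\<close> at which a small vector
  \<open>d\<close> reaches a prescribed open set. Invariant measures remove it: the preimage of a
  set under \<open>T ^^ k\<close> has the same mass for every \<open>k\<close>, so a set of mass
  near 1 contains a point \<open>x\<close> whose iterate at that very time lies where it is wanted,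
  and by linearity \<open>x + d\<close> combines both. This is used twice: two members of
  \<open>O_T T\<close> meet, whence finitely many targets can be reached at one common time; and a
  translate of \<open>O\<close> that is nearly optimal for \<mu> can be improved.

  The metric of the space need not be translation invariant, so room for \<open>d\<close> is not
  measured by distances: an open set is exhausted by open sets that stay inside it after addition of
  a neighbourhood of 0, and separability supplies countably many translates of a neighbourhood that
  cover the space.

  Closure under convolution is known for \<open>\<M>\<close> alone, so the measures given by (3)
  must first be replaced by nearby members of \<open>\<M>\<close>. Hence the open conditions carry a
  loss \<epsilon>, and Baire category is called upon to reach mass 1.\<close>

definition bcont :: "('a::topological_space \<Rightarrow> real) \<Rightarrow> bool" where
  "bcont f \<longleftrightarrow> continuous_on UNIV f \<and> bounded (range f)"

text \<open>Sequential convergence is expressed by integrals rather than as a limit in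
  \<open>weak_topology\<close>. The link between the two is made by \<open>weak_nbhd_shrink\<close>
  and \<open>weak_lim_eventually_openin\<close>.\<close>

definition weak_lim :: "(nat \<Rightarrow> 'a::topological_space measure) \<Rightarrow> 'a measure \<Rightarrow> bool" where
  "weak_lim s m \<longleftrightarrow> (\<forall>f. bcont f \<longrightarrow> (\<lambda>n. \<integral>x. f x \<partial>s n) \<longlonglongrightarrow> (\<integral>x. f x \<partial>m))"

lemma bcontI:
  assumes "continuous_on UNIV f" "\<And>x. \<bar>f x\<bar> \<le> c"
  shows "bcont f"
  using assms unfolding bcont_def bounded_iff by auto

lemma bcont_bound:
  assumes "bcont f"
  obtains c where "c > 0" "\<And>x. \<bar>f x\<bar> \<le> c"
proof -
  obtain c where c: "\<And>x. \<bar>f x\<bar> \<le> c"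
    using assms unfolding bcont_def bounded_iff by auto
  have "\<bar>f x\<bar> \<le> \<bar>c\<bar> + 1" for x
    using c[of x] by linarith
  then show thesis using that[of "\<bar>c\<bar> + 1"] by auto
qed

lemma bcont_measurable [measurable_dest]: "bcont f \<Longrightarrow> f \<in> borel_measurable borel"
  by (simp add: bcont_def borel_measurable_continuous_onI)

lemma bcont_compose:
  assumes "bcont f" "continuous_on UNIV g"
  shows "bcont (\<lambda>x. f (g x))"
proof -
  obtain c where "\<And>x. \<bar>f x\<bar> \<le> c" using bcont_bound[OF assms(1)] by blast
  moreover have "continuous_on UNIV (\<lambda>x. f (g x))"
    using assms by (auto simp: bcont_def intro: continuous_on_compose2[of UNIV f])
  ultimately show ?thesis by (intro bcontI)
qed

lemma prob_measures_simps:
  assumes "m \<in> prob_measures"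
  shows "prob_space m" "sets m = sets borel" "space m = UNIV"
  using assms sets_eq_imp_space_eq[of m borel] by (auto simp: prob_measures_def)

lemma measurable_prob_measures:
  assumes "m \<in> prob_measures"
  shows "measurable m N = measurable borel N"
  by (rule measurable_cong_sets) (use prob_measures_simps[OF assms] in auto)

lemma integrable_bounded_borel:
  fixes f :: "'a::topological_space \<Rightarrow> real"
  assumes "m \<in> prob_measures" "f \<in> borel_measurable borel" "\<And>x. \<bar>f x\<bar> \<le> c"
  shows "integrable m f"
proof -
  interpret prob_space m using prob_measures_simps[OF assms(1)] by simp
  have "f \<in> borel_measurable m"
    using assms(2) by (simp add: measurable_prob_measures[OF assms(1)])
  then show ?thesis using assms(3)
    by (intro integrable_const_bound[where B=c]) auto
qed

lemma integrable_bcont: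
  assumes "m \<in> prob_measures" "bcont f"
  shows "integrable m f"
proof -
  obtain c where "\<And>x. \<bar>f x\<bar> \<le> c" using bcont_bound[OF assms(2)] by blast
  then show ?thesis
    using assms by (intro integrable_bounded_borel) (auto dest: bcont_measurable)
qed

lemma distr_prob_measures:
  assumes "m \<in> prob_measures" "g \<in> borel_measurable borel"
  shows "distr m borel g \<in> prob_measures"
proof -
  have "g \<in> measurable m borel"
    using assms(2) by (simp add: measurable_prob_measures[OF assms(1)])
  then show ?thesis
    using prob_space.prob_space_distr[of m g borel] prob_measures_simps[OF assms(1)]
    by (simp add: prob_measures_def)
qed

lemma open_indicator_approx:
  fixes U :: "'a::metric_space set"
  assumes "open U"
  obtains f :: "nat \<Rightarrow> 'a \<Rightarrow> real"
  where "\<And>i. bcont (f i)" "\<And>i x. 0 \<le> f i x" "\<And>i x. f i x \<le> 1"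
    "\<And>i x. f i x \<le> f (Suc i) x" "\<And>x. (\<lambda>i. f i x) \<longlonglongrightarrow> indicator U x"
proof (cases "U = UNIV")
  \<comment> \<open>\<open>infdist\<close> to the empty set is 0 by convention, so the formula of
    the other case would give 0 instead of 1 here.\<close>
  case True
  then show thesis
    by (intro that[of "\<lambda>_ _. 1"]) (auto intro: bcontI[where c=1])
next
  case False
  define f where "f i x = min 1 (real i * infdist x (- U))" for i x
  have cont: "continuous_on UNIV (f i)" for i
    unfolding f_def by (intro continuous_intros)
  have lim: "(\<lambda>i. f i x) \<longlonglongrightarrow> indicator U x" for x
  proof (cases "x \<in> U")
    case True
    have "infdist x (- U) \<noteq> 0"
      using in_closed_iff_infdist_zero[of "- U" x] True False assms by auto
    then have pos: "infdist x (- U) > 0" using infdist_nonneg[of x "- U"] by linarith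
    obtain n :: nat where n: "1 / infdist x (- U) < real n" using reals_Archimedean2 by blast
    have "eventually (\<lambda>i. f i x = 1) sequentially"
      using eventually_ge_at_top[of n]
    proof eventually_elim
      case (elim i)
      have "1 < real n * infdist x (- U)" using n pos by (simp add: field_simps)
      also have "\<dots> \<le> real i * infdist x (- U)" using elim pos by simp
      finally show ?case by (simp add: f_def)
    qed
    then show ?thesis using True by (simp add: tendsto_eventually)
  next
    case False
    then have "f i x = 0" for i by (simp add: f_def)
    then show ?thesis using False by simp
  qed
  have mono: "f i x \<le> f (Suc i) x" for i x
  proof -
    have "real i * infdist x (- U) \<le> real (Suc i) * infdist x (- U)"
      by (intro mult_right_mono) (auto simp: infdist_nonneg)
    then show ?thesis by (auto simp: f_def)
  qed
  have b: "0 \<le> f i x" "f i x \<le> 1" for i x by (auto simp: f_def infdist_nonneg)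
  then have "bcont (f i)" for i
    by (intro bcontI[where c=1, OF cont]) (simp add: abs_le_iff order_trans[OF _ b(1)])
  then show thesis
    by (rule that) (fact b mono lim)+
qed

text \<open>The mass of an open set is a supremum of integrals of continuous functions, and the same
  sequence \<open>f\<close> serves all measures. This uniformity turns
  \<open>c < measure m U\<close> into an open condition on \<open>m\<close>.\<close>

lemma measure_open_approx:
  fixes U :: "'a::metric_space set"
  assumes "open U"
  obtains f :: "nat \<Rightarrow> 'a \<Rightarrow> real"
  where "\<And>i. bcont (f i)" "\<And>i x. 0 \<le> f i x" "\<And>i x. f i x \<le> 1"
    "\<And>m. finite_measure m \<Longrightarrow> sets m = sets borel \<Longrightarrow> (\<lambda>i. \<integral>x. f i x \<partial>m) \<longlonglongrightarrow> measure m U"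
    "\<And>m c. m \<in> prob_measures \<Longrightarrow> c < measure m U \<longleftrightarrow> (\<exists>i. c < (\<integral>x. f i x \<partial>m))"
proof -
  obtain f :: "nat \<Rightarrow> 'a \<Rightarrow> real"
  where f: "\<And>i. bcont (f i)" "\<And>i x. 0 \<le> f i x" "\<And>i x. f i x \<le> 1"
    "\<And>i x. f i x \<le> f (Suc i) x" "\<And>x. (\<lambda>i. f i x) \<longlonglongrightarrow> indicator U x"
    using open_indicator_approx[OF assms] by blast
  note [measurable] = bcont_measurable[OF f(1)]
  have lim: "(\<lambda>i. \<integral>x. f i x \<partial>m) \<longlonglongrightarrow> measure m U"
    if m: "finite_measure m" "sets m = sets borel" for m
  proof -
    interpret finite_measure m by fact
    note [measurable_cong] = m(2)
    have [measurable]: "U \<in> sets m" using assms m by auto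
    have "(\<lambda>i. \<integral>x. f i x \<partial>m) \<longlonglongrightarrow> (\<integral>x. indicator U x \<partial>m)"
      by (rule integral_dominated_convergence[where w="\<lambda>_. 1"]) (use f in \<open>auto\<close>)
    moreover have "U \<inter> space m = U" using sets_eq_imp_space_eq[OF m(2)] by auto
    ultimately show ?thesis by (simp add: measure_def)
  qed
  have "c < measure m U \<longleftrightarrow> (\<exists>i. c < (\<integral>x. f i x \<partial>m))" if m: "m \<in> prob_measures" for m c
  proof -
    interpret prob_space m using prob_measures_simps[OF m] by simp
    have l: "(\<lambda>i. \<integral>x. f i x \<partial>m) \<longlonglongrightarrow> measure m U"
      using lim m finite_measure_axioms prob_measures_simps[OF m] by blast
    have "incseq (\<lambda>i. \<integral>x. f i x \<partial>m)"
      by (intro incseq_SucI integral_mono integrable_bcont m f)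
    then have "(\<integral>x. f i x \<partial>m) \<le> measure m U" for i using l by (rule incseq_le)
    moreover have "\<exists>i. c < (\<integral>x. f i x \<partial>m)" if "c < measure m U"
      using order_tendstoD(1)[OF l that] eventually_happens'[OF sequentially_bot] by blast
    ultimately show ?thesis by (meson less_le_trans)
  qed
  then show thesis using that f lim by blast
qed

lemma measure_eqI_open:
  assumes "finite_measure m" "sets m = sets borel" "finite_measure n" "sets n = sets borel"
    and "\<And>U. open U \<Longrightarrow> measure m U = measure n U"
  shows "m = n"
proof (rule measure_eqI_generator_eq[where E="Collect open" and A="\<lambda>_. UNIV" and \<Omega>=UNIV])
  interpret m: finite_measure m by fact
  interpret n: finite_measure n by fact
  show "Int_stable (Collect open)" by (auto simp: Int_stable_def)
  show "emeasure m X = emeasure n X" if "X \<in> Collect open" for X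
    using that assms by (simp add: m.emeasure_eq_measure n.emeasure_eq_measure)
  show "sets m = sigma_sets UNIV (Collect open)" "sets n = sigma_sets UNIV (Collect open)"
    using assms by (simp_all add: borel_def)
  show "emeasure m UNIV \<noteq> \<infinity>" by (simp add: m.emeasure_eq_measure)
qed auto

lemma measure_eqI_bcont:
  fixes m n :: "'a::metric_space measure"
  assumes "finite_measure m" "sets m = sets borel" "finite_measure n" "sets n = sets borel"
    and eq: "\<And>f. bcont f \<Longrightarrow> (\<integral>x. f x \<partial>m) = (\<integral>x. f x \<partial>n)"
  shows "m = n"
proof (rule measure_eqI_open)
  fix U :: "'a set" assume "open U"
  then obtain f :: "nat \<Rightarrow> 'a \<Rightarrow> real" where f: "\<And>i. bcont (f i)"
    "\<And>m. finite_measure m \<Longrightarrow> sets m = sets borel \<Longrightarrow> (\<lambda>i. \<integral>x. f i x \<partial>m) \<longlonglongrightarrow> measure m U"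
    using measure_open_approx by metis
  show "measure m U = measure n U"
    using f(2)[OF assms(1,2)] f(2)[OF assms(3,4)] eq[OF f(1)] LIMSEQ_unique by fastforce
qed (use assms in auto)

section \<open>Open sets and sequential limits in the weak topology\<close>

lemma topspace_weak_topology [simp]: "topspace weak_topology = prob_measures"
proof -
  have "prob_measures = {\<mu> \<in> prob_measures. (\<integral>x. 0 \<partial>\<mu>) \<in> (UNIV :: real set)}" by auto
  then have "prob_measures \<in> {{\<mu> \<in> prob_measures. (\<integral>x. f x \<partial>\<mu>) \<in> U} | f U.
        continuous_on UNIV f \<and> bounded (range f) \<and> open (U :: real set)}"
    by (auto intro!: exI[of _ "\<lambda>_. 0"] exI[of _ UNIV])
  then show ?thesis
    unfolding weak_topology_def topology_generated_by_topspace by (intro antisym Sup_least Sup_upper) auto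
qed

lemma openin_weak_integral:
  assumes "bcont f" "open U"
  shows "openin weak_topology {\<mu> \<in> prob_measures. (\<integral>x. f x \<partial>\<mu>) \<in> U}"
  unfolding weak_topology_def
  by (rule topology_generated_by_Basis) (use assms in \<open>auto simp: bcont_def\<close>)

lemma openin_weak_measure_gt:
  fixes U :: "'a::metric_space set"
  assumes "open U"
  shows "openin weak_topology {\<mu> \<in> prob_measures. c < measure \<mu> U}"
proof -
  obtain f :: "nat \<Rightarrow> 'a \<Rightarrow> real" where f: "\<And>i. bcont (f i)"
    "\<And>m c. m \<in> prob_measures \<Longrightarrow> c < measure m U \<longleftrightarrow> (\<exists>i. c < (\<integral>x. f i x \<partial>m))"
    using measure_open_approx[OF assms] by metis
  have "{\<mu> \<in> prob_measures. c < measure \<mu> U} = (\<Union>i. {\<mu> \<in> prob_measures. (\<integral>x. f i x \<partial>\<mu>) \<in> {c<..}})"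
    using f(2) by auto
  also have "openin weak_topology \<dots>"
    by (rule openin_Union, elim imageE, hypsubst, rule openin_weak_integral[OF f(1)]) simp
  finally show ?thesis .
qed

text \<open>The portmanteau inequality for open sets, to be applied to complements of compact
  sets.\<close>

lemma weak_lim_measure_open:
  fixes U :: "'a::metric_space set"
  assumes "weak_lim s m" "m \<in> prob_measures" "\<And>n. s n \<in> prob_measures" "open U"
    and "\<And>n. measure (s n) U \<le> c"
  shows "measure m U \<le> c"
proof (rule ccontr)
  obtain f :: "nat \<Rightarrow> 'a \<Rightarrow> real" where f: "\<And>i. bcont (f i)"
    "\<And>m c. m \<in> prob_measures \<Longrightarrow> c < measure m U \<longleftrightarrow> (\<exists>i. c < (\<integral>x. f i x \<partial>m))"
    using measure_open_approx[OF assms(4)] by metis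
  assume "\<not> ?thesis"
  then obtain i where "c < (\<integral>x. f i x \<partial>m)" using f(2)[OF assms(2)] by (auto simp: not_le)
  then have "eventually (\<lambda>n. c < (\<integral>x. f i x \<partial>s n)) sequentially"
    using assms(1) f(1) unfolding weak_lim_def by (intro order_tendstoD(1)) auto
  then obtain n where "c < (\<integral>x. f i x \<partial>s n)"
    using eventually_happens'[OF sequentially_bot] by blast
  then show False using f(2)[OF assms(3)] assms(5)[of n] by (meson not_less)
qed

text \<open>A substitute for regularity of the topology, which suffices for the Baire argument: only
  sequential limits of \<open>W'\<close> have to stay in \<open>W\<close>. The relation
  \<open>N\<close> survives intersections and enlarging \<open>W\<close>, so induction over the
  generated topology leaves the sub-basic sets, where a closed interval inside an open set of reals
  does it.\<close>

lemma weak_nbhd_shrink: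
  assumes "openin weak_topology W" "m \<in> W"
  obtains W' where "openin weak_topology W'" "m \<in> W'" "W' \<subseteq> W"
    "\<And>s l. (\<And>n. s n \<in> W') \<Longrightarrow> weak_lim s l \<Longrightarrow> l \<in> prob_measures \<Longrightarrow> l \<in> W"
proof -
  define N where "N W' W \<longleftrightarrow> openin weak_topology W' \<and> W' \<subseteq> W \<and>
    (\<forall>s l. (\<forall>n. s n \<in> W') \<longrightarrow> weak_lim s l \<longrightarrow> l \<in> prob_measures \<longrightarrow> l \<in> W)"
    for W' W :: "'a measure set"
  have N_Int: "N (A \<inter> B) (a \<inter> b)" if "N A a" "N B b" for A B a b
  proof -
    have "openin weak_topology (A \<inter> B)" using that by (auto simp: N_def)
    moreover have "l \<in> a \<inter> b"
      if "\<forall>n. s n \<in> A \<inter> B" "weak_lim s l" "l \<in> prob_measures" for s l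
    proof
      have "\<forall>n. s n \<in> A" "\<forall>n. s n \<in> B" using that(1) by auto
      then show "l \<in> a" "l \<in> b"
        using that(2,3) \<open>N A a\<close> \<open>N B b\<close> unfolding N_def by metis+
    qed
    moreover have "A \<inter> B \<subseteq> a \<inter> b" using that unfolding N_def by (intro Int_mono) simp_all
    ultimately show ?thesis unfolding N_def by simp
  qed
  have N_mono: "N A b" if "N A a" "a \<subseteq> b" for A a b
    using that unfolding N_def by (meson subset_iff)
  have "generate_topology_on {{\<mu> \<in> prob_measures. (\<integral>x. f x \<partial>\<mu>) \<in> U} | f U.
        continuous_on UNIV f \<and> bounded (range f) \<and> open (U :: real set)} W"
    using assms(1) unfolding weak_topology_def openin_topology_generated_by_iff .
  then have "\<forall>m\<in>W. \<exists>W'. m \<in> W' \<and> N W' W"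
  proof induction
    case Empty
    then show ?case by simp
  next
    case (Int a b)
    show ?case
    proof
      fix m assume "m \<in> a \<inter> b"
      then obtain A B where *: "m \<in> A" "N A a" "m \<in> B" "N B b"
        using Int.IH by (meson IntD1 IntD2)
      show "\<exists>W'. m \<in> W' \<and> N W' (a \<inter> b)"
        using * N_Int[OF *(2,4)] by (intro exI[of _ "A \<inter> B"]) simp
    qed
  next
    case (UN K)
    show ?case
    proof
      fix m assume "m \<in> \<Union>K"
      then obtain k where k: "k \<in> K" "m \<in> k" by auto
      then obtain A where "m \<in> A" "N A k" using UN.IH by meson
      then show "\<exists>W'. m \<in> W' \<and> N W' (\<Union>K)"
        using N_mono[of A k "\<Union>K"] Union_upper[OF k(1)] by (intro exI[of _ A]) simp
    qed
  next
    case (Basis S)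
    then obtain f U where S: "S = {\<mu> \<in> prob_measures. (\<integral>x. f x \<partial>\<mu>) \<in> U}" and f: "bcont f"
      and U: "open (U :: real set)" by (auto simp: bcont_def)
    show ?case
    proof
      fix m assume m: "m \<in> S"
      then obtain e where e: "e > 0" "cball (\<integral>x. f x \<partial>m) e \<subseteq> U"
        using U open_contains_cball S by blast
      define W' where "W' = {\<mu> \<in> prob_measures. (\<integral>x. f x \<partial>\<mu>) \<in> ball (\<integral>x. f x \<partial>m) e}"
      have "l \<in> S" if "\<forall>n. s n \<in> W'" "weak_lim s l" "l \<in> prob_measures" for s l
      proof -
        have "(\<lambda>n. \<integral>x. f x \<partial>s n) \<longlonglongrightarrow> (\<integral>x. f x \<partial>l)" using that(2) f by (simp add: weak_lim_def)
        moreover have "(\<integral>x. f x \<partial>s n) \<in> cball (\<integral>x. f x \<partial>m) e" for n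
          using spec[OF that(1), of n] by (simp add: W'_def)
        ultimately have "(\<integral>x. f x \<partial>l) \<in> cball (\<integral>x. f x \<partial>m) e"
          using closed_sequentially[OF closed_cball, of "\<lambda>n. \<integral>x. f x \<partial>s n"] by simp
        then show ?thesis using e that(3) unfolding S by blast
      qed
      moreover have "openin weak_topology W'"
        unfolding W'_def by (intro openin_weak_integral f) auto
      moreover have "m \<in> W'" using m e unfolding W'_def S by simp
      moreover have "W' \<subseteq> S" using e ball_subset_cball unfolding W'_def S by blast
      ultimately show "\<exists>W'. m \<in> W' \<and> N W' S" unfolding N_def by blast
    qed
  qed
  then obtain W' where "m \<in> W'" "N W' W" using assms(2) by blast
  then show thesis using that unfolding N_def by metis
qed

lemma weak_lim_eventually_openin:
  assumes "openin weak_topology W" "weak_lim s l" "l \<in> W" "\<And>n. s n \<in> prob_measures"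
  shows "eventually (\<lambda>n. s n \<in> W) sequentially"
proof -
  have "generate_topology_on {{\<mu> \<in> prob_measures. (\<integral>x. f x \<partial>\<mu>) \<in> U} | f U.
        continuous_on UNIV f \<and> bounded (range f) \<and> open (U :: real set)} W"
    using assms(1) unfolding weak_topology_def openin_topology_generated_by_iff .
  then show ?thesis using assms(3)
  proof induction
    case (Int a b)
    then show ?case by (auto intro: eventually_conj)
  next
    case (UN K)
    then obtain k where "k \<in> K" "l \<in> k" by auto
    with UN.IH[of k] show ?case by (auto elim: eventually_mono)
  next
    case (Basis S)
    then obtain f U where S: "S = {\<mu> \<in> prob_measures. (\<integral>x. f x \<partial>\<mu>) \<in> U}" and f: "bcont f"
      and U: "open (U :: real set)" by (auto simp: bcont_def)
    have "(\<lambda>n. \<integral>x. f x \<partial>s n) \<longlonglongrightarrow> (\<integral>x. f x \<partial>l)" using assms(2) f by (simp add: weak_lim_def)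
    then show ?case using U Basis assms(4) unfolding S by (auto dest: topological_tendstoD)
  qed auto
qed

lemma weak_lim_in_closure:
  assumes "weak_lim s l" "l \<in> prob_measures" "\<And>n. s n \<in> B" "B \<subseteq> prob_measures"
  shows "l \<in> weak_topology closure_of B"
  unfolding in_closure_of
proof (intro conjI allI impI)
  show "l \<in> topspace weak_topology" using assms by simp
  fix W assume "l \<in> W \<and> openin weak_topology W"
  then have "eventually (\<lambda>n. s n \<in> W) sequentially"
    using assms by (intro weak_lim_eventually_openin[of W s l]) auto
  then show "\<exists>y. y \<in> B \<and> y \<in> W"
    using assms(3) eventually_happens'[OF sequentially_bot] by blast
qed

lemma invariant_measure_iff_bcont:
  fixes T :: "'a::metric_space \<Rightarrow> 'a"
  assumes "continuous_on UNIV T" "m \<in> prob_measures"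
  shows "invariant_measure T m \<longleftrightarrow> (\<forall>f. bcont f \<longrightarrow> (\<integral>x. f (T x) \<partial>m) = (\<integral>x. f x \<partial>m))"
proof -
  have [measurable]: "T \<in> borel_measurable borel"
    using assms(1) by (rule borel_measurable_continuous_onI)
  have T: "T \<in> measurable m borel"
    by (simp add: measurable_prob_measures[OF assms(2)])
  have *: "(\<integral>x. f x \<partial>distr m borel T) = (\<integral>x. f (T x) \<partial>m)" if "bcont f" for f :: "'a \<Rightarrow> real"
    using bcont_measurable[OF that] by (intro integral_distr T)
  have "distr m borel T = m" if "\<forall>f. bcont f \<longrightarrow> (\<integral>x. f (T x) \<partial>m) = (\<integral>x. f x \<partial>m)"
  proof (rule measure_eqI_bcont)
    show "finite_measure (distr m borel T)" "finite_measure m"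
      using distr_prob_measures[OF assms(2), of T] prob_measures_simps(1) assms(2)
      by (auto intro: prob_space.finite_measure)
  qed (use prob_measures_simps[OF assms(2)] * that in auto)
  then show ?thesis using * assms(2) unfolding invariant_measure_def by metis
qed

text \<open>As \<open>T\<close> is continuous, the difference of \<open>f\<close> composed with
  \<open>T\<close> and \<open>f\<close> is again a bounded continuous function, so every failure of
  invariance is witnessed by a sub-basic open set.\<close>

lemma closedin_invariant_measures:
  fixes T :: "'a::metric_space \<Rightarrow> 'a"
  assumes "continuous_on UNIV T"
  shows "closedin weak_topology (invariant_measures T)"
proof -
  define D where "D f = {m \<in> prob_measures. (\<integral>x. f (T x) - f x \<partial>m) \<in> - {0::real}}" for f
  have bc: "bcont (\<lambda>x. f (T x) - f x)" if f: "bcont f" for f :: "'a \<Rightarrow> real"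
  proof -
    obtain c where c: "\<And>x. \<bar>f x\<bar> \<le> c" using bcont_bound[OF f] by blast
    have "\<bar>f (T x) - f x\<bar> \<le> 2 * c" for x using c[of "T x"] c[of x] by linarith
    moreover have "continuous_on UNIV (\<lambda>x. f (T x) - f x)"
      using f bcont_compose[OF f assms] by (intro continuous_intros) (auto simp: bcont_def)
    ultimately show ?thesis by (intro bcontI)
  qed
  have "m \<in> invariant_measures T \<longleftrightarrow> (\<forall>f. bcont f \<longrightarrow> m \<notin> D f)" if m: "m \<in> prob_measures" for m
  proof -
    have "(\<integral>x. f (T x) - f x \<partial>m) = (\<integral>x. f (T x) \<partial>m) - (\<integral>x. f x \<partial>m)" if "bcont f" for f
      by (intro Bochner_Integration.integral_diff integrable_bcont m bcont_compose[OF that assms] that)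
    then show ?thesis
      unfolding invariant_measures_def D_def using m invariant_measure_iff_bcont[OF assms m] by auto
  qed
  then have "prob_measures - invariant_measures T = (\<Union>f\<in>{f. bcont f}. D f)"
    by (auto simp: D_def)
  moreover have "openin weak_topology (\<Union>f\<in>{f. bcont f}. D f)"
    unfolding D_def
    by (rule openin_Union, elim imageE, hypsubst, rule openin_weak_integral[OF bc]) auto
  ultimately show ?thesis
    unfolding closedin_def by (auto simp: invariant_measures_def invariant_measure_def)
qed

section \<open>Prokhorov's theorem\<close>

text \<open>Half of the first ternary digit of a point of the Cantor set, interpolated linearly over
  the middle gap. Continuity is the point: a weak limit can only be tested against continuous
  functions.\<close>

definition ternary_digit :: "real \<Rightarrow> real" where
  "ternary_digit t = min 1 (max 0 (3 * t - 1))"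

text \<open>On the Cantor set the iterated map is the shift that drops the first digit.\<close>

definition ternary_digits :: "nat \<Rightarrow> real \<Rightarrow> real" where
  "ternary_digits i t = ternary_digit (((\<lambda>u. 3 * u - 2 * ternary_digit u) ^^ i) t)"

text \<open>Only the digits 0 and 2 occur, so a gap separates the codes that differ in a given
  leading digit; this is what lets the digits extend continuously, which fails for binary
  expansions.\<close>

definition cantor_code :: "(nat \<Rightarrow> real) \<Rightarrow> real" where
  "cantor_code b = (\<Sum>i. 2 * b i / 3 ^ Suc i)"

lemma continuous_on_ternary_digits [continuous_intros]: "continuous_on A (ternary_digits i)"
proof -
  have 1: "continuous_on UNIV ternary_digit"
    unfolding ternary_digit_def by (intro continuous_intros)
  have 2: "continuous_on UNIV ((\<lambda>u. 3 * u - 2 * ternary_digit u) ^^ i)"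
  proof (induction i)
    case (Suc i)
    have "continuous_on UNIV (\<lambda>u. 3 * u - 2 * ternary_digit u)"
      by (intro continuous_intros 1)
    from continuous_on_compose2[OF this Suc] show ?case by (simp add: comp_def)
  qed (simp add: continuous_on_id id_def)
  have "continuous_on UNIV (ternary_digits i)"
    unfolding ternary_digits_def using continuous_on_compose2[OF 1 2] by simp
  then show ?thesis using continuous_on_subset by blast
qed

lemma ternary_digits_bounds: "0 \<le> ternary_digits i t" "ternary_digits i t \<le> 1"
  by (auto simp: ternary_digits_def ternary_digit_def)

lemma
  assumes "\<And>i. b i \<in> {0, 1}"
  shows cantor_code_summable: "summable (\<lambda>i. 2 * b i / 3 ^ Suc i)"
    and cantor_code_nonneg: "0 \<le> cantor_code b"
    and cantor_code_le_1: "cantor_code b \<le> 1"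
proof -
  have b: "0 \<le> b i" "b i \<le> 1" for i using assms[of i] by auto
  have g: "(\<lambda>i. 2 / 3 * (1 / 3) ^ i) sums (1 :: real)"
    using sums_mult[OF geometric_sums[of "1/3 :: real"], of "2/3"] by simp
  have le: "2 * b i / 3 ^ Suc i \<le> 2 / 3 * (1 / 3) ^ i" for i
    using b[of i] by (simp add: field_simps power_divide)
  show s: "summable (\<lambda>i. 2 * b i / 3 ^ Suc i)"
    by (rule summable_comparison_test'[OF sums_summable[OF g], of 0]) (use le b in auto)
  show "0 \<le> cantor_code b" unfolding cantor_code_def
    using s b by (intro suminf_nonneg) auto
  show "cantor_code b \<le> 1" unfolding cantor_code_def
    using suminf_le[OF le s sums_summable[OF g]] sums_unique[OF g] by simp
qed

lemma cantor_code_Suc: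
  assumes "\<And>i. b i \<in> {0, 1}"
  shows "cantor_code b = 2 * b 0 / 3 + cantor_code (\<lambda>i. b (Suc i)) / 3"
proof -
  have s: "summable (\<lambda>i. 2 * b (Suc i) / 3 ^ Suc i)"
    by (rule cantor_code_summable) (use assms in auto)
  have "cantor_code b = 2 * b 0 / 3 + (\<Sum>i. 2 * b (Suc i) / 3 ^ Suc (Suc i))"
    unfolding cantor_code_def using suminf_split_head[OF cantor_code_summable[of b, OF assms]] by simp
  also have "(\<Sum>i. 2 * b (Suc i) / 3 ^ Suc (Suc i)) = (\<Sum>i. (2 * b (Suc i) / 3 ^ Suc i) / 3)"
    by (simp add: field_simps)
  also have "\<dots> = cantor_code (\<lambda>i. b (Suc i)) / 3"
    unfolding cantor_code_def using s by (rule suminf_divide)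
  finally show ?thesis .
qed

lemma ternary_digit_cantor_code:
  assumes "\<And>i. b i \<in> {0, 1}"
  shows "ternary_digit (cantor_code b) = b 0"
proof -
  define u where "u = cantor_code (\<lambda>i. b (Suc i))"
  have "cantor_code b = 2 * b 0 / 3 + u / 3" unfolding u_def by (rule cantor_code_Suc) (rule assms)
  moreover have "0 \<le> u" unfolding u_def by (rule cantor_code_nonneg) (rule assms)
  moreover have "u \<le> 1" unfolding u_def by (rule cantor_code_le_1) (rule assms)
  moreover have "b 0 = 0 \<or> b 0 = 1" using assms[of 0] by auto
  ultimately show ?thesis
    unfolding ternary_digit_def by (auto simp: min_def max_def)
qed

lemma ternary_digits_cantor_code:
  assumes "\<And>i. b i \<in> {0, 1}"
  shows "ternary_digits i (cantor_code b) = b i"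
  using assms
proof (induction i arbitrary: b)
  case 0
  then show ?case by (simp add: ternary_digits_def ternary_digit_cantor_code)
next
  case (Suc i)
  have "3 * cantor_code b - 2 * ternary_digit (cantor_code b) = cantor_code (\<lambda>i. b (Suc i))"
    using ternary_digit_cantor_code[of b] cantor_code_Suc[of b] Suc.prems by simp
  then have "ternary_digits (Suc i) (cantor_code b) = ternary_digits i (cantor_code (\<lambda>i. b (Suc i)))"
    unfolding ternary_digits_def funpow_Suc_right by simp
  also have "\<dots> = b (Suc i)" by (rule Suc.IH) (use Suc.prems in auto)
  finally show ?case .
qed

text \<open>The second point may lie outside \<open>K\<close>, as the decoded centres in the proof
  of Prokhorov's theorem do. Hence a Lebesgue number for a cover by sets open in the whole space,
  instead of uniform continuity on \<open>K\<close>.\<close>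

lemma compact_continuous_modulus:
  fixes f :: "'a::metric_space \<Rightarrow> real"
  assumes "compact K" "continuous_on UNIV f" "e > 0"
  obtains d where "d > 0" "\<And>x y. x \<in> K \<Longrightarrow> dist x y < d \<Longrightarrow> \<bar>f x - f y\<bar> < e"
proof -
  define G where "G z = f -` ball (f z) (e/2)" for z
  have "open (G z)" for z
    unfolding G_def using assms(2) by (intro open_vimage) auto
  moreover have "x \<in> G x" for x using assms(3) by (simp add: G_def)
  then have "K \<subseteq> \<Union>(range G)" by blast
  ultimately obtain d where d: "d > 0" "\<And>x. x \<in> K \<Longrightarrow> \<exists>A\<in>range G. ball x d \<subseteq> A"
    using Heine_Borel_lemma[OF assms(1), of "range G"] by (metis rangeE)
  show thesis
  proof (rule that[OF d(1)])
    fix x y assume xy: "x \<in> K" "dist x y < d"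
    then obtain z where z: "ball x d \<subseteq> G z" using d(2) by blast
    have "x \<in> G z" "y \<in> G z" using z xy d(1) by (auto simp: subset_iff)
    then have "dist (f z) (f x) < e/2" "dist (f z) (f y) < e/2" by (auto simp: G_def)
    then show "\<bar>f x - f y\<bar> < e" unfolding dist_real_def by linarith
  qed
qed

lemma dense_sequence_exists:
  obtains d :: "nat \<Rightarrow> 'a::{metric_space, second_countable_topology}"
  where "\<And>x e. e > 0 \<Longrightarrow> \<exists>a. dist (d a) x < e"
proof -
  obtain D :: "'a set" where D: "countable D" "\<And>X. open X \<Longrightarrow> X \<noteq> {} \<Longrightarrow> \<exists>d\<in>D. d \<in> X"
    using countable_dense_setE by blast
  have ne: "D \<noteq> {}" using D(2)[of UNIV] by auto
  show thesis
  proof (rule that[of "from_nat_into D"])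
    fix x :: 'a and e :: real assume "e > 0"
    then obtain y where "y \<in> D" "y \<in> ball x e" using D(2)[of "ball x e"] by auto
    moreover obtain a where "from_nat_into D a = y"
      using from_nat_into_surj[OF D(1) \<open>y \<in> D\<close>] by blast
    ultimately show "\<exists>a. dist (from_nat_into D a) x < e" by (auto simp: dist_commute)
  qed
qed

text \<open>A point is coded by the 0-1 sequence telling which balls \<open>ball (d a) (2\<^sup>-\<^sup>j)\<close> contain it, read as
  ternary digits of a real number. Helly's selection theorem applies to the images of the measures on the
  real line; the digits extend to continuous functions, so the limit is seen by them, and tightness and
  completeness decode almost every real number into a point again.\<close>

lemma Prokhorov:
  fixes s :: "nat \<Rightarrow> 'a::polish_space measure"
  assumes P: "\<And>n. s n \<in> prob_measures"
    and tight: "\<And>e. e > 0 \<Longrightarrow> \<exists>K. compact K \<and> (\<forall>n. 1 - e \<le> measure (s n) K)"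
  obtains r m where "strict_mono r" "m \<in> prob_measures" "weak_lim (s \<circ> r) m"
proof -
  obtain d :: "nat \<Rightarrow> 'a" where d: "\<And>x e. e > 0 \<Longrightarrow> \<exists>a. dist (d a) x < e"
    using dense_sequence_exists by blast
  define bt where "bt x i = (case prod_decode i of (a, j) \<Rightarrow> indicat_real (ball (d a) ((1/2) ^ j)) x)"
    for x i
  have bt01: "bt x i \<in> {0, 1}" for x i
    by (auto simp: bt_def indicator_def split: prod.split)
  have bt_meas [measurable]: "(\<lambda>x. bt x i) \<in> borel_measurable borel" for i
    unfolding bt_def by (cases "prod_decode i") (simp add: borel_measurable_indicator)
  define \<phi> where "\<phi> x = cantor_code (bt x)" for x
  have [measurable]: "\<phi> \<in> borel_measurable borel"
    unfolding \<phi>_def cantor_code_def by measurable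
  define D where "D a j t = ternary_digits (prod_encode (a, j)) t" for a j t
  have D_cont: "continuous_on UNIV (D a j)" for a j
    unfolding D_def using continuous_on_ternary_digits by blast
  have D_b: "0 \<le> D a j t" "D a j t \<le> 1" for a j t
    unfolding D_def by (rule ternary_digits_bounds)+
  have [measurable]: "D a j \<in> borel_measurable borel" for a j
    using D_cont by (rule borel_measurable_continuous_onI)
  have D_\<phi>: "D a j (\<phi> x) = indicator (ball (d a) ((1/2) ^ j)) x" for a j x
    unfolding D_def \<phi>_def by (subst ternary_digits_cantor_code) (use bt01 in \<open>auto simp: bt_def\<close>)

  have s_meas: "\<phi> \<in> measurable (s n) borel" for n
    by (simp add: measurable_prob_measures[OF P])
  have s_prob: "prob_space (s n)" for n using prob_measures_simps(1)[OF P] .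
  define R where "R n = distr (s n) borel \<phi>" for n
  have R: "real_distribution (R n)" for n
    unfolding R_def using prob_space.real_distribution_distr[OF s_prob s_meas] .
  have "tight R"
    unfolding tight_def
  proof (intro conjI allI impI)
    \<comment> \<open>All codes lie in \<open>[0, 1]\<close>, so tightness on the line is automatic.
      The left end is -1 because the interval is open there and 0 can be a code.\<close>
    show "\<exists>a b. a < b \<and> (\<forall>n. 1 - \<epsilon> < measure (R n) {a<..b})" if "0 < \<epsilon>" for \<epsilon> :: real
    proof (rule exI[of _ "-1"], rule exI[of _ 1], intro conjI allI)
      fix n
      have "- 1 < \<phi> x \<and> \<phi> x \<le> 1" for x
        using cantor_code_nonneg[of "bt x", OF bt01] cantor_code_le_1[of "bt x", OF bt01]
        unfolding \<phi>_def by simp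
      then have "\<phi> -` {-1<..1} \<inter> space (s n) = space (s n)" by auto
      then have "measure (R n) {-1<..1} = measure (s n) (space (s n))"
        unfolding R_def by (subst measure_distr[OF s_meas]) auto
      then show "1 - \<epsilon> < measure (R n) {-1<..1}" using that prob_space.prob_space[OF s_prob] by simp
    qed simp
  qed (rule R)
  from tight_imp_convergent_subsubsequence[OF this strict_mono_id]
  obtain r N where r: "strict_mono r" and N: "real_distribution N" and "weak_conv_m (R \<circ> r) N"
    by auto
  then have wc: "weak_conv_m (\<lambda>n. R (r n)) N" by (simp add: comp_def)
  interpret N: real_distribution N by fact
  have conv_ae: "(\<lambda>n. \<integral>x. h (\<phi> x) \<partial>s (r n)) \<longlonglongrightarrow> (\<integral>t. h t \<partial>N)"
    if h: "AE t in N. isCont h t" "\<And>t. \<bar>h t\<bar> \<le> c" and [measurable]: "h \<in> borel_measurable borel"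
    for h :: "real \<Rightarrow> real" and c
  proof -
    \<comment> \<open>A set outside \<open>sets N\<close> has \<open>emeasure\<close> 0 by default,
      so measurability of the set of discontinuities need not be discussed.\<close>
    have "emeasure N {t. \<not> isCont h t} = 0"
    proof (cases "{t. \<not> isCont h t} \<in> sets N")
      case True
      then show ?thesis using h(1) AE_iff_measurable[OF True, of "isCont h"] by simp
    qed (simp add: emeasure_notin_sets)
    then have "(\<lambda>n. \<integral>t. h t \<partial>R (r n)) \<longlonglongrightarrow> (\<integral>t. h t \<partial>N)"
      using weak_conv_imp_bdd_ae_continuous_conv[OF R N wc, of h c] h(2) by simp
    moreover have "(\<integral>t. h t \<partial>R (r n)) = (\<integral>x. h (\<phi> x) \<partial>s (r n))" for n
      unfolding R_def by (rule integral_distr[OF s_meas]) simp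
    ultimately show ?thesis by simp
  qed
  have conv: "(\<lambda>n. \<integral>x. h (\<phi> x) \<partial>s (r n)) \<longlonglongrightarrow> (\<integral>t. h t \<partial>N)"
    if "continuous_on UNIV h" "\<And>t. \<bar>h t\<bar> \<le> c" for h :: "real \<Rightarrow> real" and c
    using that by (intro conv_ae[of h c])
      (auto simp: continuous_on_eq_continuous_at intro: borel_measurable_continuous_onI)
  \<comment> \<open>The transfer principle: a property of all codes that can be written as the
    vanishing of such an \<open>h\<close> holds \<open>N\<close>-almost everywhere, although
    \<open>N\<close> may charge points that are not codes.\<close>
  have null: "AE t in N. h t = 0"
    if "continuous_on UNIV h" "\<And>t. 0 \<le> h t" "\<And>t. h t \<le> 1" "\<And>x. h (\<phi> x) = 0" for h :: "real \<Rightarrow> real"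
  proof -
    have h[measurable]: "h \<in> borel_measurable borel" using that by (intro borel_measurable_continuous_onI)
    have "(\<lambda>n. \<integral>x. h (\<phi> x) \<partial>s (r n)) \<longlonglongrightarrow> (\<integral>t. h t \<partial>N)"
      using that by (intro conv[of h 1]) auto
    then have "(\<integral>t. h t \<partial>N) = 0" using that(4) by (simp add: LIMSEQ_const_iff)
    moreover have "integrable N h"
      using that by (intro N.integrable_const_bound[where B=1]) auto
    ultimately show ?thesis using integral_nonneg_eq_0_iff_AE[of N h] that(2) by simp
  qed
  have ae01: "AE t in N. \<forall>a j. D a j t = 0 \<or> D a j t = 1"
  proof -
    have "AE t in N. D a j t * (1 - D a j t) = 0" for a j
      by (intro null continuous_intros D_cont)
         (auto simp: D_b D_\<phi> indicator_def intro!: mult_le_one mult_nonneg_nonneg)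
    then show ?thesis by (auto simp: AE_all_countable)
  qed
  have ae_meet: "AE t in N. \<forall>a j a' j'. D a j t = 1 \<longrightarrow> D a' j' t = 1 \<longrightarrow>
      ball (d a) ((1/2) ^ j) \<inter> ball (d a') ((1/2) ^ j') \<noteq> {}"
  proof -
    have "AE t in N. D a j t * D a' j' t = 0"
      if "ball (d a) ((1/2) ^ j) \<inter> ball (d a') ((1/2) ^ j') = {}" for a j a' j'
      by (intro null continuous_intros D_cont)
         (use that in \<open>auto simp: D_b D_\<phi> indicator_def intro!: mult_le_one mult_nonneg_nonneg\<close>)
    note disj = this
    have "AE t in N. D a j t = 1 \<longrightarrow> D a' j' t = 1 \<longrightarrow>
      ball (d a) ((1/2) ^ j) \<inter> ball (d a') ((1/2) ^ j') \<noteq> {}" for a j a' j'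
    proof (cases "ball (d a) ((1/2) ^ j) \<inter> ball (d a') ((1/2) ^ j') = {}")
      case True
      from disj[OF this] show ?thesis by (rule eventually_mono) auto
    qed auto
    then show ?thesis by (simp only: AE_all_countable) simp
  qed
  \<comment> \<open>Tightness enters here. Among infinitely many centres all digits of level
    \<open>j\<close> could vanish in the limit; but finitely many balls cover a compact set of
    almost full mass, and the finite product \<open>h\<close> of their complementary digits is
    continuous and 0 on the codes of that set.\<close>
  have ae_ex: "AE t in N. \<forall>j. \<exists>a. D a j t = 1"
  proof -
    have "AE t in N. \<exists>a. D a j t = 1" for j
    proof -
      define B where "B = {t \<in> space N. (\<forall>a. D a j t = 0)}"
      have [measurable]: "B \<in> sets N" unfolding B_def by measurable
      have "measure N B \<le> e" if "e > 0" for e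
      proof -
        obtain K where K: "compact K" "\<And>n. 1 - e \<le> measure (s n) K" using tight[OF \<open>e > 0\<close>] by blast
        have "K \<subseteq> (\<Union>a. ball (d a) ((1/2) ^ j))" using d[of "(1/2)^j"] by fastforce
        then obtain I where I: "finite I" "K \<subseteq> (\<Union>a\<in>I. ball (d a) ((1/2) ^ j))"
          using compactE_image[OF K(1), of UNIV "\<lambda>a. ball (d a) ((1/2) ^ j)"] by auto
        define h where "h t = (\<Prod>a\<in>I. 1 - D a j t)" for t
        have h: "0 \<le> h t" "h t \<le> 1" for t
          unfolding h_def using D_b by (auto intro!: prod_nonneg prod_le_1)
        have h_cont: "continuous_on UNIV h" unfolding h_def by (intro continuous_intros D_cont)
        then have [measurable]: "h \<in> borel_measurable borel" by (intro borel_measurable_continuous_onI)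
        have "(\<integral>x. h (\<phi> x) \<partial>s n) \<le> e" for n
        proof -
          interpret S: prob_space "s n" by (rule s_prob)
          have KS: "K \<in> sets (s n)"
            using K(1) prob_measures_simps[OF P] by (simp add: compact_imp_closed)
          have "h (\<phi> x) \<le> indicator (space (s n) - K) x" if "x \<in> space (s n)" for x
          proof (cases "x \<in> K")
            case True
            then obtain a where "a \<in> I" "x \<in> ball (d a) ((1/2) ^ j)" using I by auto
            then have "h (\<phi> x) = 0" unfolding h_def
              by (intro prod_zero[OF I(1)]) (auto simp: D_\<phi> intro!: bexI[of _ a])
            then show ?thesis by simp
          qed (use h that in auto)
          then have "(\<integral>x. h (\<phi> x) \<partial>s n) \<le> (\<integral>x. indicator (space (s n) - K) x \<partial>s n)"
            using KS by (intro integral_mono integrable_bounded_borel[OF P, of "\<lambda>x. h (\<phi> x)" 1]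
                integrable_real_indicator) (auto simp: h abs_of_nonneg S.emeasure_eq_measure)
          also have "\<dots> = 1 - measure (s n) K" using KS by (simp add: S.prob_compl)
          finally show ?thesis using K(2)[of n] by simp
        qed
        moreover have "(\<lambda>n. \<integral>x. h (\<phi> x) \<partial>s (r n)) \<longlonglongrightarrow> (\<integral>t. h t \<partial>N)"
          using h h_cont by (intro conv[of h 1]) (auto simp: abs_of_nonneg)
        ultimately have le: "(\<integral>t. h t \<partial>N) \<le> e" by (intro LIMSEQ_le_const2) auto
        have "indicator B t \<le> h t" for t
          using h by (auto simp: B_def h_def indicator_def)
        moreover have "integrable N h"
          by (rule N.integrable_const_bound[where B=1]) (simp_all add: h)
        moreover have "integrable N (indicat_real B)"
          by (rule integrable_real_indicator[OF \<open>B \<in> sets N\<close>]) (simp add: N.emeasure_eq_measure)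
        ultimately have "(\<integral>t. indicator B t \<partial>N) \<le> (\<integral>t. h t \<partial>N)"
          by (intro integral_mono) simp_all
        then show ?thesis using le by simp
      qed
      then have "measure N B \<le> 0 + e" if "e > 0" for e using that by simp
      then have "measure N B \<le> 0" by (rule field_le_epsilon)
      then have "measure N B = 0" using measure_nonneg[of N B] by linarith
      then have "AE t in N. t \<notin> B" using N.prob_eq_0[OF \<open>B \<in> sets N\<close>] by blast
      then show ?thesis using ae01
      proof eventually_elim
        case (elim t)
        then show ?case by (auto simp: B_def N.space_eq_univ)
      qed
    qed
    then show ?thesis by (simp add: AE_all_countable)
  qed
  \<comment> \<open>The least index is a measurable choice. Since almost all digits are 0 or 1, the
    threshold 1/2 is never met exactly there, which makes \<open>idx j\<close> locally constant at
    almost every point.\<close>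
  define idx where "idx j t = (LEAST a. D a j t > 1/2)" for j t
  have [measurable]: "idx j \<in> measurable borel (count_space UNIV)" for j
    unfolding idx_def by measurable
  define Y where "Y j t = d (idx j t)" for j t
  have [measurable]: "Y j \<in> borel_measurable borel" for j
    unfolding Y_def by measurable
  \<comment> \<open>Two balls that meet at levels \<open>j\<close> and \<open>Suc j\<close> have
    centres at distance below \<open>(1/2) ^ j + (1/2) ^ Suc j\<close>. The bound is summable, so
    the centres form a Cauchy sequence.\<close>
  define good where "good = {t. \<forall>j. dist (Y j t) (Y (Suc j) t) \<le> 2 * (1/2) ^ j}"
  have [measurable]: "good \<in> sets borel"
    unfolding good_def by measurable
  have idx_eq: "D (idx j t) j t > 1/2" if "\<exists>a. D a j t = 1" for j t
  proof -
    from that obtain a where "D a j t = 1" by blast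
    then have "D a j t > 1/2" by simp
    then show ?thesis unfolding idx_def by (rule LeastI)
  qed
  have ae_good: "AE t in N. t \<in> good"
    using ae01 ae_meet ae_ex
  proof eventually_elim
    case (elim t)
    have "dist (Y j t) (Y (Suc j) t) \<le> 2 * (1/2) ^ j" for j
    proof -
      have "D (idx j t) j t = 1" for j using idx_eq[of j t] elim(1,3) by force
      then have "ball (Y j t) ((1/2) ^ j) \<inter> ball (Y (Suc j) t) ((1/2) ^ Suc j) \<noteq> {}"
        using elim(2) unfolding Y_def by blast
      then obtain z where "dist (Y j t) z < (1/2) ^ j" "dist (Y (Suc j) t) z < (1/2) ^ Suc j" by auto
      moreover have "(1/2) ^ Suc j \<le> ((1/2) ^ j :: real)" by simp
      ultimately show ?thesis using dist_triangle2[of "Y j t" "Y (Suc j) t" z] by linarith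
    qed
    then show ?case by (simp add: good_def)
  qed
  \<comment> \<open>Made constant off \<open>good\<close>, the sequence converges everywhere, so its
    limit \<open>Z\<close> is Borel as a pointwise limit.\<close>
  define Y' where "Y' j t = (if t \<in> good then Y j t else d 0)" for j t
  have [measurable]: "Y' j \<in> borel_measurable borel" for j
    unfolding Y'_def by measurable
  have "convergent (\<lambda>j. Y' j t)" for t
  proof (cases "t \<in> good")
    case True
    have "Cauchy (\<lambda>j. Y j t)"
    proof (rule metric_CauchyI)
      fix e :: real assume "e > 0"
      have step: "dist (Y j t) (Y (j + k) t) \<le> 4 * (1/2) ^ j - 4 * (1/2) ^ (j + k)" for j k
      proof (induction k)
        case (Suc k)
        have "dist (Y (j + k) t) (Y (Suc (j + k)) t) \<le> 2 * (1/2) ^ (j + k)"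
          using True unfolding good_def by blast
        then show ?case
          using Suc dist_triangle[of "Y j t" "Y (j + Suc k) t" "Y (j + k) t"] by simp
      qed simp
      have b: "dist (Y j t) (Y k t) \<le> 4 * (1/2) ^ j" if "j \<le> k" for j k
      proof -
        have "0 \<le> 4 * (1/2 :: real) ^ k" by simp
        moreover have "dist (Y j t) (Y k t) \<le> 4 * (1/2) ^ j - 4 * (1/2) ^ k"
          using step[of j "k - j"] that by simp
        ultimately show ?thesis by linarith
      qed
      have "(\<lambda>j. 8 * (1/2 :: real) ^ j) \<longlonglongrightarrow> 8 * 0"
        by (intro tendsto_intros LIMSEQ_realpow_zero) auto
      then have "eventually (\<lambda>j. 8 * (1/2 :: real) ^ j < e) sequentially"
        by (rule order_tendstoD(2)) (use \<open>e > 0\<close> in simp)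
      then obtain M where M: "8 * (1/2 :: real) ^ M < e"
        using eventually_happens'[OF sequentially_bot] by blast
      show "\<exists>M. \<forall>m\<ge>M. \<forall>n\<ge>M. dist (Y m t) (Y n t) < e"
      proof (intro exI[of _ M] allI impI)
        fix m n assume "M \<le> m" "M \<le> n"
        then show "dist (Y m t) (Y n t) < e"
          using b[of M m] b[of M n] M dist_triangle3[of "Y m t" "Y n t" "Y M t"] by linarith
      qed
    qed
    then show ?thesis using True by (simp add: Y'_def Cauchy_convergent)
  qed (simp add: Y'_def convergent_const)
  then have Y'_lim: "(\<lambda>j. Y' j t) \<longlonglongrightarrow> lim (\<lambda>j. Y' j t)" for t
    by (simp add: convergent_LIMSEQ_iff)
  define Z where "Z t = lim (\<lambda>j. Y' j t)" for t
  have [measurable]: "Z \<in> borel_measurable borel"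
    by (rule borel_measurable_LIMSEQ_metric[of Y']) (use Y'_lim in \<open>auto simp: Z_def\<close>)
  have ae_lim: "AE t in N. (\<lambda>j. Y j t) \<longlonglongrightarrow> Z t"
    using ae_good
  proof eventually_elim
    case (elim t)
    then show ?case using Y'_lim[of t] by (simp add: Y'_def Z_def)
  qed
  define m where "m = distr N borel Z"
  have "N \<in> prob_measures" using N.prob_space_axioms by (simp add: prob_measures_def)
  then have m: "m \<in> prob_measures" unfolding m_def by (rule distr_prob_measures) simp
  have y_near: "dist (Y j (\<phi> x)) x < (1/2) ^ j" for j x
  proof -
    obtain a where "dist (d a) x < (1/2)^j" using d[of "(1/2)^j" x] by auto
    then have "D (idx j (\<phi> x)) j (\<phi> x) > 1/2" by (intro idx_eq exI[of _ a]) (auto simp: D_\<phi>)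
    then have "x \<in> ball (d (idx j (\<phi> x))) ((1/2) ^ j)"
      unfolding D_\<phi> by (metis indicator_simps(2) not_less zero_le_divide_1_iff zero_le_numeral)
    then show ?thesis by (simp add: Y_def)
  qed
  have "weak_lim (s \<circ> r) m"
    unfolding weak_lim_def
  proof (intro allI impI)
    fix f :: "'a \<Rightarrow> real" assume f: "bcont f"
    note [measurable] = bcont_measurable[OF f]
    obtain c where c: "c > 0" "\<And>x. \<bar>f x\<bar> \<le> c" using bcont_bound[OF f] by blast
    have f_cont: "continuous_on UNIV f" using f by (simp add: bcont_def)
    have int_m: "(\<integral>x. f x \<partial>m) = (\<integral>t. f (Z t) \<partial>N)"
      unfolding m_def by (rule integral_distr) auto
    have Yj: "(\<lambda>n. \<integral>x. f (Y j (\<phi> x)) \<partial>s (r n)) \<longlonglongrightarrow> (\<integral>t. f (Y j t) \<partial>N)" for j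
    proof (rule conv_ae[of _ c])
      show "AE t in N. isCont (\<lambda>t. f (Y j t)) t"
        using ae01 ae_ex
      proof eventually_elim
        case (elim t)
        define a where "a = idx j t"
        have "isCont (D a' j) t" for a' using D_cont by (simp add: continuous_on_eq_continuous_at)
        then have cont: "(D a' j \<longlongrightarrow> D a' j t) (nhds t)" for a'
          by (simp add: isCont_def tendsto_at_iff_tendsto_nhds)
        have "D a j t > 1/2" unfolding a_def using elim by (intro idx_eq) auto
        then have 1: "eventually (\<lambda>u. D a j u > 1/2) (nhds t)" by (rule order_tendstoD(1)[OF cont])
        have "eventually (\<lambda>u. D a' j u < 1/2) (nhds t)" if "a' < a" for a'
        proof -
          have "\<not> D a' j t > 1/2" using that unfolding a_def idx_def by (rule not_less_Least)
          moreover have "D a' j t = 0 \<or> D a' j t = 1" using elim(1) by blast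
          ultimately have "D a' j t < 1/2" by auto
          then show ?thesis by (rule order_tendstoD(2)[OF cont])
        qed
        then have 2: "eventually (\<lambda>u. \<forall>a'\<in>{..<a}. D a' j u < 1/2) (nhds t)"
          by (intro eventually_ball_finite) auto
        from 1 2 have "eventually (\<lambda>u. f (Y j u) = f (Y j t)) (nhds t)"
        proof eventually_elim
          case (elim u)
          have "idx j u = a" unfolding idx_def
          proof (rule Least_equality)
            fix y assume "1/2 < D y j u"
            then show "a \<le> y" using elim(2) by (meson lessThan_iff not_less less_asym)
          qed (use elim in simp)
          then show ?case by (simp add: Y_def a_def)
        qed
        then show ?case using isCont_cong[of "\<lambda>u. f (Y j u)" "\<lambda>_. f (Y j t)" t] by simp
      qed
    qed (use c in auto)
    have lim_j: "(\<lambda>j. \<integral>t. f (Y j t) \<partial>N) \<longlonglongrightarrow> (\<integral>t. f (Z t) \<partial>N)"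
    proof (rule integral_dominated_convergence[where w="\<lambda>_. c"])
      show "AE t in N. (\<lambda>j. f (Y j t)) \<longlonglongrightarrow> f (Z t)"
        using ae_lim
      proof eventually_elim
        case (elim t)
        then show ?case using f_cont by (auto intro: continuous_on_tendsto_compose)
      qed
    qed (use c in auto)
    have "(\<lambda>n. \<integral>x. f x \<partial>s (r n)) \<longlonglongrightarrow> (\<integral>t. f (Z t) \<partial>N)"
    proof (rule LIMSEQ_I)
      fix e :: real assume "e > 0"
      \<comment> \<open>With this constant the comparison \<open>near\<close> costs at most
        \<open>e' + 2 * c * e' \<le> e / 2\<close>; the two other comparisons cost
        \<open>e / 6\<close> each.\<close>
      define e' where "e' = e / (6 * (c + 1))"
      have e': "e' > 0" "e' \<le> e / 6" "2 * c * e' \<le> e / 3"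
        using \<open>e > 0\<close> c unfolding e'_def by (auto simp: field_simps)
      obtain K where K: "compact K" "\<And>n. 1 - e' \<le> measure (s n) K" using tight[OF e'(1)] by blast
      obtain \<delta> where \<delta>: "\<delta> > 0" "\<And>x y. x \<in> K \<Longrightarrow> dist x y < \<delta> \<Longrightarrow> \<bar>f x - f y\<bar> < e'"
        using compact_continuous_modulus[OF K(1) f_cont e'(1)] by blast
      have "eventually (\<lambda>j. (1/2 :: real) ^ j < \<delta>) sequentially"
        using order_tendstoD(2)[OF LIMSEQ_realpow_zero[of "1/2 :: real"]] \<delta>(1) by auto
      moreover have "eventually (\<lambda>j. dist (\<integral>t. f (Y j t) \<partial>N) (\<integral>t. f (Z t) \<partial>N) < e / 6) sequentially"
        by (rule tendstoD[OF lim_j]) (use \<open>e > 0\<close> in simp)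
      ultimately obtain j where j: "(1/2 :: real) ^ j < \<delta>"
          "dist (\<integral>t. f (Y j t) \<partial>N) (\<integral>t. f (Z t) \<partial>N) < e / 6"
        using eventually_happens'[OF sequentially_bot eventually_conj] by blast
      have near: "\<bar>(\<integral>x. f x \<partial>s n) - (\<integral>x. f (Y j (\<phi> x)) \<partial>s n)\<bar> \<le> e / 2" for n
      proof -
        interpret S: prob_space "s n" by (rule s_prob)
        have KS: "K \<in> sets (s n)"
          using K(1) prob_measures_simps[OF P] by (simp add: compact_imp_closed)
        have i1: "integrable (s n) f" "integrable (s n) (\<lambda>x. f (Y j (\<phi> x)))"
          by (rule integrable_bounded_borel[OF P, where c=c]; use c in simp)+
        have i2: "integrable (s n) (\<lambda>x. e' + 2 * c * indicator (space (s n) - K) x)"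
          using KS by (intro Bochner_Integration.integrable_add integrable_mult_right
              integrable_real_indicator) (auto simp: S.emeasure_eq_measure)
        have "\<bar>(\<integral>x. f x \<partial>s n) - (\<integral>x. f (Y j (\<phi> x)) \<partial>s n)\<bar> = \<bar>\<integral>x. f x - f (Y j (\<phi> x)) \<partial>s n\<bar>"
          using i1 by simp
        also have "\<dots> \<le> (\<integral>x. \<bar>f x - f (Y j (\<phi> x))\<bar> \<partial>s n)"
          by (rule integral_abs_bound)
        also have "\<dots> \<le> (\<integral>x. e' + 2 * c * indicator (space (s n) - K) x \<partial>s n)"
        proof (rule integral_mono)
          fix x assume x: "x \<in> space (s n)"
          show "\<bar>f x - f (Y j (\<phi> x))\<bar> \<le> e' + 2 * c * indicator (space (s n) - K) x"
          proof (cases "x \<in> K")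
            case True
            then have "\<bar>f x - f (Y j (\<phi> x))\<bar> < e'"
              using y_near[of j x] j(1) by (intro \<delta>(2)) (auto simp: dist_commute)
            then show ?thesis using True by simp
          next
            case False
            then show ?thesis using x e' c(2)[of x] c(2)[of "Y j (\<phi> x)"] by simp
          qed
        qed (use i1 i2 in auto)
        also have "\<dots> = e' + 2 * c * (1 - measure (s n) K)"
          using KS integrable_real_indicator[of "space (s n) - K" "s n"]
          by (simp add: S.prob_compl S.prob_space S.emeasure_eq_measure)
        also have "\<dots> \<le> e' + 2 * c * e'"
          using K(2)[of n] c(1) by simp
        finally show ?thesis using e' by linarith
      qed
      have "eventually (\<lambda>n. dist (\<integral>x. f (Y j (\<phi> x)) \<partial>s (r n)) (\<integral>t. f (Y j t) \<partial>N) < e / 6) sequentially"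
        by (rule tendstoD[OF Yj]) (use \<open>e > 0\<close> in simp)
      then obtain n0 where n0: "\<And>n. n \<ge> n0 \<Longrightarrow>
          dist (\<integral>x. f (Y j (\<phi> x)) \<partial>s (r n)) (\<integral>t. f (Y j t) \<partial>N) < e / 6"
        by (auto simp: eventually_sequentially)
      show "\<exists>no. \<forall>n\<ge>no. norm ((\<integral>x. f x \<partial>s (r n)) - (\<integral>t. f (Z t) \<partial>N)) < e"
      proof (intro exI[of _ n0] allI impI)
        fix n assume "n0 \<le> n"
        from n0[OF this] near[of "r n"] j(2) \<open>e > 0\<close>
        show "norm ((\<integral>x. f x \<partial>s (r n)) - (\<integral>t. f (Z t) \<partial>N)) < e"
          unfolding dist_real_def real_norm_def by linarith
      qed
    qed
    then show "(\<lambda>n. \<integral>x. f x \<partial>(s \<circ> r) n) \<longlonglongrightarrow> (\<integral>x. f x \<partial>m)"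
      by (simp add: int_m)
  qed
  then show thesis using that r m by blast
qed

section \<open>Baire category in the space of probability measures\<close>

lemma prob_measure_inner_compact:
  fixes m :: "'a::polish_space measure"
  assumes "m \<in> prob_measures" "S \<in> sets borel" "c < measure m S"
  obtains K where "compact K" "K \<subseteq> S" "c < measure m K"
proof -
  interpret prob_space m using prob_measures_simps[OF assms(1)] by simp
  have "emeasure m S = (SUP K\<in>{K. K \<subseteq> S \<and> compact K}. emeasure m K)"
    using prob_measures_simps[OF assms(1)] assms(2) by (intro inner_regular) auto
  moreover have "ennreal c < emeasure m S \<or> c < 0"
    using assms(3) by (auto simp: emeasure_eq_measure ennreal_less_iff)
  ultimately consider K where "K \<subseteq> S" "compact K" "ennreal c < emeasure m K" | "c < 0"
    by (auto simp: less_SUP_iff)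
  then show thesis
  proof cases
    case 1
    then show thesis
      using that[of K] by (cases "c < 0") (auto simp: emeasure_eq_measure ennreal_less_iff not_less
          intro: less_le_trans[OF _ measure_nonneg])
  next
    case 2
    then show thesis using that[of "{}"] by simp
  qed
qed

lemma prob_measure_finite_balls:
  fixes m :: "'a::polish_space measure"
  assumes "m \<in> prob_measures" "e > 0" "c < 1"
  obtains F where "finite F" "c < measure m (\<Union>x\<in>F. ball x e)"
proof -
  interpret prob_space m using prob_measures_simps[OF assms(1)] by simp
  have "c < measure m UNIV" using assms(3) prob_space prob_measures_simps[OF assms(1)] by simp
  then obtain K where K: "compact K" "c < measure m K"
    using prob_measure_inner_compact[OF assms(1), of UNIV c] by auto
  have "K \<subseteq> (\<Union>x\<in>K. ball x e)" using assms(2) by auto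
  then obtain F where F: "finite F" "K \<subseteq> (\<Union>x\<in>F. ball x e)"
    using compactE_image[OF K(1), of K "\<lambda>x. ball x e"] by (metis open_ball)
  have "measure m K \<le> measure m (\<Union>x\<in>F. ball x e)"
    using F(2) prob_measures_simps(2)[OF assms(1)]
    by (intro finite_measure_mono) (auto intro!: borel_open)
  then show thesis using that F(1) K(2) by force
qed

text \<open>With closed balls in place of open ones, the intersection over the levels is closed and
  totally bounded, hence compact by completeness.\<close>

lemma tight_of_finite_balls:
  fixes s :: "nat \<Rightarrow> 'a::polish_space measure"
  assumes P: "\<And>n. s n \<in> prob_measures"
    and F: "\<And>i. finite (F i)" "\<And>i k. 1 - (1/2) ^ i < measure (s k) (\<Union>x\<in>F i. ball x ((1/2) ^ i))"
    and "e > 0"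
  shows "\<exists>K. compact K \<and> (\<forall>k. 1 - e \<le> measure (s k) K)"
proof -
  have "(\<lambda>i. 2 * (1/2 :: real) ^ i) \<longlonglongrightarrow> 2 * 0"
    by (intro tendsto_intros LIMSEQ_realpow_zero) auto
  then have "eventually (\<lambda>i. 2 * (1/2 :: real) ^ i < e) sequentially"
    by (rule order_tendstoD(2)) (use \<open>e > 0\<close> in simp)
  then obtain n where n: "2 * (1/2 :: real) ^ n < e"
    using eventually_happens'[OF sequentially_bot] by blast
  \<comment> \<open>The levels start at \<open>n\<close>, so that the lost masses
    \<open>(1/2) ^ (i + n)\<close> sum to \<open>2 * (1/2) ^ n < e\<close>.\<close>
  define C where "C i = (\<Union>x\<in>F (i + n). cball x ((1/2) ^ (i + n)))" for i
  define K where "K = (\<Inter>i. C i)"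
  have clC: "closed (C i)" for i unfolding C_def using F(1) by auto
  have "closed K" unfolding K_def using clC by auto
  have "compact K"
    unfolding compact_eq_totally_bounded
  proof (intro conjI allI impI)
    show "Topological_Spaces.complete K" using \<open>closed K\<close> by (simp add: complete_eq_closed)
    fix \<epsilon> :: real assume "\<epsilon> > 0"
    have "(\<lambda>i. (1/2 :: real) ^ (i + n)) \<longlonglongrightarrow> 0"
      by (intro LIMSEQ_ignore_initial_segment LIMSEQ_realpow_zero) auto
    then have "eventually (\<lambda>i. (1/2 :: real) ^ (i + n) < \<epsilon>) sequentially"
      by (rule order_tendstoD(2)) (use \<open>\<epsilon> > 0\<close> in simp)
    then obtain i where i: "(1/2 :: real) ^ (i + n) < \<epsilon>"
      using eventually_happens'[OF sequentially_bot] by blast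
    have "K \<subseteq> C i" unfolding K_def by auto
    also have "\<dots> \<subseteq> (\<Union>x\<in>F (i + n). ball x \<epsilon>)" unfolding C_def
    proof (rule UN_mono[OF order_refl])
      show "cball x ((1/2) ^ (i + n)) \<subseteq> ball x \<epsilon>" for x using i by (auto simp: subset_iff)
    qed
    finally show "\<exists>k. finite k \<and> K \<subseteq> (\<Union>x\<in>k. ball x \<epsilon>)" using F(1) by blast
  qed
  moreover have "1 - e \<le> measure (s k) K" for k
  proof -
    interpret prob_space "s k" using prob_measures_simps[OF P] by simp
    note sets = prob_measures_simps(2)[OF P, of k] and space = prob_measures_simps(3)[OF P, of k]
    have CS: "C i \<in> sets (s k)" for i using clC sets by auto
    have KS: "K \<in> sets (s k)" using \<open>closed K\<close> sets by auto
    have small: "measure (s k) (space (s k) - C i) \<le> (1/2) ^ n * (1/2) ^ i" for i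
    proof -
      have "(\<Union>x\<in>F (i + n). ball x ((1/2) ^ (i + n))) \<subseteq> C i" unfolding C_def by force
      then have "measure (s k) (\<Union>x\<in>F (i + n). ball x ((1/2) ^ (i + n))) \<le> measure (s k) (C i)"
        using CS by (intro finite_measure_mono)
      then have "1 - (1/2) ^ (i + n) \<le> measure (s k) (C i)" using F(2)[of "i + n" k] by linarith
      then show ?thesis using prob_compl[OF CS, of i] by (simp add: power_add mult.commute)
    qed
    have g: "(\<lambda>i. (1/2 :: real) ^ n * (1/2) ^ i) sums ((1/2) ^ n * 2)"
      using sums_mult[OF geometric_sums[of "1/2 :: real"], of "(1/2) ^ n"] by simp
    have sm: "summable (\<lambda>i. measure (s k) (space (s k) - C i))"
      by (rule summable_comparison_test'[OF sums_summable[OF g], of 0]) (use small in auto)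
    have "space (s k) - K = (\<Union>i. space (s k) - C i)" unfolding K_def by auto
    then have "measure (s k) (space (s k) - K) \<le> (\<Sum>i. measure (s k) (space (s k) - C i))"
      using CS sm by (simp only:) (intro finite_measure_subadditive_countably; auto)
    also have "\<dots> \<le> (\<Sum>i. (1/2) ^ n * (1/2) ^ i)"
      by (rule suminf_le[OF small sm sums_summable[OF g]])
    also have "\<dots> = (1/2) ^ n * 2" using g by (simp add: sums_iff)
    finally show ?thesis using prob_compl[OF KS] n by linarith
  qed
  ultimately show ?thesis by blast
qed

text \<open>Nested open sets take the place of shrinking balls in a complete metric. Stage
  \<open>n\<close> is shrunk into \<open>G n\<close> in the sense of sequential limits and is cut
  down to measures nearly carried by one finite union of balls of radius \<open>(1/2) ^ n\<close>.
  Points chosen from the stages are therefore tight, and Prokhorov's theorem yields a limit that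
  lies in all \<open>G n\<close>.\<close>

lemma weak_topology_Baire:
  fixes B :: "'a::polish_space measure set"
  assumes closed: "closedin weak_topology B"
    and opn: "\<And>n. openin weak_topology (G n)"
    and dense: "\<And>n. B \<subseteq> weak_topology closure_of (B \<inter> G n)"
  shows "B \<subseteq> weak_topology closure_of (B \<inter> (\<Inter>n::nat. G n))"
proof
  fix m0 assume m0: "m0 \<in> B"
  have BP: "B \<subseteq> prob_measures" using closedin_subset[OF closed] by simp
  show "m0 \<in> weak_topology closure_of (B \<inter> (\<Inter>n. G n))"
    unfolding in_closure_of
  proof (intro conjI allI impI)
    show "m0 \<in> topspace weak_topology" using m0 BP by auto
    fix W0 assume W0: "m0 \<in> W0 \<and> openin weak_topology W0"
    \<comment> \<open>The second component of a stage only witnesses that the open set meets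
      \<open>B\<close>. The last clause is tightness at level \<open>n\<close>, uniform over all
      later stages.\<close>
    define Q where "Q n X Y \<longleftrightarrow> fst Y \<subseteq> fst X \<and>
        (\<forall>s l. (\<forall>k. s k \<in> fst Y) \<longrightarrow> weak_lim s l \<longrightarrow> l \<in> prob_measures \<longrightarrow> l \<in> fst X \<inter> G n) \<and>
        (\<exists>F. finite F \<and> (\<forall>\<mu>\<in>fst Y. 1 - (1/2) ^ n < measure \<mu> (\<Union>x\<in>F. ball x ((1/2) ^ n))))"
      for n :: nat and X Y :: "'a measure set \<times> 'a measure"
    define OK where "OK X \<longleftrightarrow> openin weak_topology (fst X) \<and> snd X \<in> fst X \<inter> B"
      for X :: "'a measure set \<times> 'a measure"
    have "\<exists>f. \<forall>n. (OK (f n) \<and> (n = 0 \<longrightarrow> f n = (W0, m0))) \<and> Q n (f n) (f (Suc n))"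
    proof (rule dependent_nat_choice)
      show "\<exists>x. OK x \<and> (0 = 0 \<longrightarrow> x = (W0, m0))"
        using W0 m0 by (auto simp: OK_def)
      fix X and n :: nat assume X: "OK X \<and> (n = 0 \<longrightarrow> X = (W0, m0))"
      obtain W m where Wm: "X = (W, m)" by fastforce
      have W: "openin weak_topology W" "m \<in> W" "m \<in> B" using X by (auto simp: OK_def Wm)
      have "m \<in> weak_topology closure_of (B \<inter> G n)" using dense W by blast
      then obtain m' where m': "m' \<in> B" "m' \<in> G n" "m' \<in> W"
        using W unfolding in_closure_of by blast
      have "openin weak_topology (W \<inter> G n)" using W opn by blast
      then obtain W1 where W1: "openin weak_topology W1" "m' \<in> W1" "W1 \<subseteq> W \<inter> G n"
        "\<And>s l. (\<And>k. s k \<in> W1) \<Longrightarrow> weak_lim s l \<Longrightarrow> l \<in> prob_measures \<Longrightarrow> l \<in> W \<inter> G n"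
        using weak_nbhd_shrink[of "W \<inter> G n" m'] m' by blast
      obtain F where F: "finite F" "1 - (1/2) ^ n < measure m' (\<Union>x\<in>F. ball x ((1/2) ^ n))"
        using prob_measure_finite_balls[of m' "(1/2) ^ n" "1 - (1/2) ^ n"] m'(1) BP by auto
      define W2 where "W2 = W1 \<inter> {\<mu> \<in> prob_measures. 1 - (1/2) ^ n < measure \<mu> (\<Union>x\<in>F. ball x ((1/2) ^ n))}"
      have "openin weak_topology W2" unfolding W2_def
        by (intro openin_Int W1 openin_weak_measure_gt) auto
      then have "OK (W2, m')"
        using W1 F m' BP by (auto simp: OK_def W2_def)
      moreover have "Q n X (W2, m')"
        unfolding Q_def Wm
      proof (intro conjI allI impI)
        show "fst (W2, m') \<subseteq> fst (W, m)" using W1 by (auto simp: W2_def)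
        show "l \<in> fst (W, m) \<inter> G n"
          if "\<forall>k. s k \<in> fst (W2, m')" "weak_lim s l" "l \<in> prob_measures" for s l
        proof -
          have "s k \<in> W1" for k using spec[OF that(1), of k] by (simp add: W2_def)
          from W1(4)[OF this that(2,3)] show ?thesis by simp
        qed
        show "\<exists>F. finite F \<and> (\<forall>\<mu>\<in>fst (W2, m'). 1 - (1/2) ^ n < measure \<mu> (\<Union>x\<in>F. ball x ((1/2) ^ n)))"
          using F(1) by (intro exI[of _ F]) (simp add: W2_def)
      qed
      ultimately show "\<exists>Y. (OK Y \<and> (Suc n = 0 \<longrightarrow> Y = (W0, m0))) \<and> Q n X Y" by auto
    qed
    then obtain f where f: "\<And>n. OK (f n)" "f 0 = (W0, m0)" "\<And>n. Q n (f n) (f (Suc n))" by blast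
    define W where "W n = fst (f n)" for n
    define m where "m n = snd (f n)" for n
    have mB: "m n \<in> B" and mW: "m n \<in> W n" for n
      using f(1)[of n] by (auto simp: OK_def W_def m_def)
    have mP: "m n \<in> prob_measures" for n using mB BP by auto
    have "decseq W" unfolding W_def using f(3) by (intro decseq_SucI) (auto simp: Q_def)
    then have mW': "m k \<in> W n" if "n \<le> k" for n k using mW[of k] that by (auto dest: decseqD)
    have "\<exists>F. finite F \<and> (\<forall>k. 1 - (1/2) ^ i < measure (m k) (\<Union>x\<in>F. ball x ((1/2) ^ i)))" for i
    proof -
      obtain F where F: "finite F" "\<And>\<mu>. \<mu> \<in> W (Suc i) \<Longrightarrow> 1 - (1/2) ^ i < measure \<mu> (\<Union>x\<in>F. ball x ((1/2) ^ i))"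
        using f(3)[of i] unfolding Q_def W_def by blast
      have "\<exists>F. finite F \<and> 1 - (1/2) ^ i < measure (m k) (\<Union>x\<in>F. ball x ((1/2) ^ i))" for k
        using prob_measure_finite_balls[OF mP, of "(1/2)^i" "1 - (1/2)^i" k] by auto
      then obtain F' where F': "\<And>k. finite (F' k)"
          "\<And>k. 1 - (1/2) ^ i < measure (m k) (\<Union>x\<in>F' k. ball x ((1/2) ^ i))"
        by metis
      \<comment> \<open>\<open>F\<close> serves only the measures chosen after stage
        \<open>i\<close>; the finitely many earlier ones bring finite families of their own.\<close>
      define E where "E = F \<union> (\<Union>k\<le>i. F' k)"
      have "1 - (1/2) ^ i < measure (m k) (\<Union>x\<in>E. ball x ((1/2) ^ i))" for k
      proof -
        interpret prob_space "m k" using prob_measures_simps[OF mP] by simp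
        obtain D where D: "D \<subseteq> E" "1 - (1/2) ^ i < measure (m k) (\<Union>x\<in>D. ball x ((1/2) ^ i))"
        proof (cases "k \<le> i")
          case True
          then show thesis using that[of "F' k"] F'(2)[of k] by (auto simp: E_def)
        next
          case False
          then show thesis using that[of F] F(2)[of "m k"] mW'[of "Suc i" k] by (auto simp: E_def)
        qed
        have "measure (m k) (\<Union>x\<in>D. ball x ((1/2) ^ i)) \<le> measure (m k) (\<Union>x\<in>E. ball x ((1/2) ^ i))"
          using D(1) prob_measures_simps(2)[OF mP, of k]
          by (intro finite_measure_mono) (auto intro!: borel_open)
        then show ?thesis using D(2) by linarith
      qed
      moreover have "finite E" unfolding E_def using F F' by auto
      ultimately show ?thesis by blast
    qed
    then obtain F where F: "\<And>i. finite (F i)"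
        "\<And>i k. 1 - (1/2) ^ i < measure (m k) (\<Union>x\<in>F i. ball x ((1/2) ^ i))"
      by metis
    obtain r l where r: "strict_mono r" and l: "l \<in> prob_measures" "weak_lim (m \<circ> r) l"
      by (rule Prokhorov[of m, OF mP tight_of_finite_balls[of m F, OF mP F]])
    have "l \<in> B"
      using weak_lim_in_closure[OF l(2,1), of B] mB BP closure_of_closedin[OF closed] by simp
    moreover have "l \<in> W n \<inter> G n" for n
    proof -
      \<comment> \<open>Since \<open>r j \<ge> j\<close>, dropping the first \<open>Suc n\<close>
        terms puts the whole sequence into \<open>W (Suc n)\<close>, as the second clause of
        \<open>Q\<close> requires.\<close>
      have 1: "\<forall>k. (m \<circ> r) (k + Suc n) \<in> W (Suc n)"
      proof
        show "(m \<circ> r) (k + Suc n) \<in> W (Suc n)" for k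
          using mW'[of "Suc n" "r (k + Suc n)"] seq_suble[OF r, of "k + Suc n"] by simp
      qed
      have 2: "weak_lim (\<lambda>k. (m \<circ> r) (k + Suc n)) l"
        unfolding weak_lim_def
      proof (intro allI impI)
        fix f :: "'a \<Rightarrow> real" assume "bcont f"
        then have "(\<lambda>k. \<integral>x. f x \<partial>(m \<circ> r) k) \<longlonglongrightarrow> (\<integral>x. f x \<partial>l)"
          using l(2) unfolding weak_lim_def by blast
        then show "(\<lambda>k. \<integral>x. f x \<partial>(m \<circ> r) (k + Suc n)) \<longlonglongrightarrow> (\<integral>x. f x \<partial>l)"
          by (rule LIMSEQ_ignore_initial_segment)
      qed
      from f(3)[of n] have "\<forall>s l. (\<forall>k. s k \<in> W (Suc n)) \<longrightarrow> weak_lim s l \<longrightarrow>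
          l \<in> prob_measures \<longrightarrow> l \<in> W n \<inter> G n"
        unfolding Q_def W_def by (elim conjE)
      from this[rule_format, OF 1[rule_format] 2 l(1)] show ?thesis .
    qed
    ultimately have "l \<in> B \<inter> (\<Inter>n. G n)" "l \<in> W 0" by blast+
    moreover have "W 0 = W0" using f(2) by (simp add: W_def)
    ultimately show "\<exists>y. y \<in> B \<inter> (\<Inter>n. G n) \<and> y \<in> W0" by blast
  qed
qed

section \<open>Hypercyclic vectors and invariant measures\<close>

text \<open>The smallest set that contains \<open>U\<close> and its own preimage under
  \<open>T\<close>; for nonempty open \<open>U\<close> it is the typical member of
  \<open>O_T T\<close>.\<close>

definition hits :: "('a \<Rightarrow> 'a) \<Rightarrow> 'a set \<Rightarrow> 'a set" where
  "hits T U = (\<Union>k. (T ^^ k) -` U)"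

lemma continuous_on_funpow:
  assumes "continuous_on UNIV (T :: 'a::topological_space \<Rightarrow> 'a)"
  shows "continuous_on UNIV (T ^^ k)"
proof (induction k)
  case (Suc k)
  from continuous_on_compose2[OF assms Suc] show ?case by (simp add: comp_def)
qed (simp add: id_def continuous_on_id)

lemma open_hits:
  assumes "continuous_on UNIV (T :: 'a::topological_space \<Rightarrow> 'a)" "open U"
  shows "open (hits T U)"
  unfolding hits_def using open_vimage[OF assms(2) continuous_on_funpow[OF assms(1)]] by blast

lemma hits_in_O_T:
  assumes "continuous_on UNIV (T :: 'a::topological_space \<Rightarrow> 'a)" "open U" "U \<noteq> {}"
  shows "hits T U \<in> O_T T"
proof -
  have "x \<in> hits T U" if "T x \<in> hits T U" for x
  proof -
    from that obtain k where "(T ^^ k) (T x) \<in> U" by (auto simp: hits_def)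
    then have "(T ^^ Suc k) x \<in> U" by (simp add: funpow_swap1)
    then show ?thesis unfolding hits_def by blast
  qed
  moreover have "U \<subseteq> hits T U"
    unfolding hits_def using UN_upper[of 0 UNIV "\<lambda>k. (T ^^ k) -` U"] by simp
  ultimately show ?thesis using open_hits[OF assms(1,2)] assms(3) unfolding O_T_def by auto
qed

lemma O_T_funpow:
  assumes "V \<in> O_T T" "(T ^^ k) x \<in> V"
  shows "x \<in> V"
  using assms(2)
proof (induction k arbitrary: x)
  case (Suc k)
  then have "T x \<in> V" by (simp add: funpow_swap1)
  then show ?case using assms(1) by (auto simp: O_T_def)
qed simp

lemma in_HC_iff: "x \<in> HC T \<longleftrightarrow> (\<forall>U. open U \<longrightarrow> U \<noteq> {} \<longrightarrow> x \<in> hits T U)"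
proof -
  have "x \<in> HC T \<longleftrightarrow> (\<forall>y U. open U \<longrightarrow> y \<in> U \<longrightarrow> (\<exists>k. (T ^^ k) x \<in> U))"
    unfolding HC_def mem_Collect_eq set_eq_iff closure_iff_nhds_not_empty by blast
  then show ?thesis unfolding hits_def by blast
qed

lemma HC_subset_O_T: "V \<in> O_T T \<Longrightarrow> HC T \<subseteq> V"
  using in_HC_iff[of _ T] O_T_funpow[of V T] unfolding hits_def O_T_def by blast

text \<open>A countable base writes \<open>HC T\<close> as a countable intersection of members of
  \<open>O_T T\<close>, so one density theorem for such intersections yields both (4) and
  (5).\<close>

lemma HC_eq_INT_hits:
  obtains U :: "nat \<Rightarrow> 'a::second_countable_topology set"
  where "\<And>n. open (U n)" "\<And>n. U n \<noteq> {}" "\<And>T. HC T = (\<Inter>n. hits T (U n))"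
proof -
  obtain B :: "'a set set" where B: "countable B" "topological_basis B"
    using ex_countable_basis by blast
  obtain b where "b \<in> B" "(undefined :: 'a) \<in> b"
    by (rule topological_basisE[OF B(2) open_UNIV UNIV_I])
  then have ne: "B - {{}} \<noteq> {}" by blast
  define U where "U = from_nat_into (B - {{}})"
  have U: "U n \<in> B - {{}}" for n unfolding U_def by (rule from_nat_into[OF ne])
  have rng: "range U = B - {{}}" unfolding U_def by (rule range_from_nat_into[OF ne]) (use B in simp)
  have opn: "open (U n)" for n using topological_basis_open[OF B(2)] U by blast
  have "HC T = (\<Inter>n. hits T (U n))" for T
  proof
    show "HC T \<subseteq> (\<Inter>n. hits T (U n))" using in_HC_iff[of _ T] opn U by blast
    show "(\<Inter>n. hits T (U n)) \<subseteq> HC T"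
    proof
      fix x assume x: "x \<in> (\<Inter>n. hits T (U n))"
      have "x \<in> hits T V" if V: "open V" "V \<noteq> {}" for V
      proof -
        obtain y where "y \<in> V" using V by blast
        then obtain b where b: "b \<in> B" "y \<in> b" "b \<subseteq> V"
          by (rule topological_basisE[OF B(2) V(1)])
        then have "b \<in> range U" unfolding rng by blast
        then have "x \<in> hits T b" using x by blast
        then show ?thesis using b(3) unfolding hits_def by blast
      qed
      then show "x \<in> HC T" by (simp add: in_HC_iff)
    qed
  qed
  then show thesis using that[of U] opn U by blast
qed

lemma HC_borel:
  assumes "continuous_on UNIV (T :: 'a::second_countable_topology \<Rightarrow> 'a)"
  shows "HC T \<in> sets borel"
proof -
  obtain U :: "nat \<Rightarrow> 'a set" where "\<And>n. open (U n)" "HC T = (\<Inter>n. hits T (U n))"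
    using HC_eq_INT_hits by metis
  then show ?thesis using open_hits[OF assms] by auto
qed

lemma invariant_measure_funpow:
  assumes "invariant_measure T m" "continuous_on UNIV T" "A \<in> sets borel"
  shows "measure m ((T ^^ k) -` A) = measure m A"
proof (induction k)
  case (Suc k)
  have m: "m \<in> prob_measures" "distr m borel T = m" using assms(1) by (auto simp: invariant_measure_def)
  have [measurable]: "T \<in> borel_measurable borel" "T ^^ k \<in> borel_measurable borel"
    using assms(2) continuous_on_funpow[OF assms(2)] by (auto intro: borel_measurable_continuous_onI)
  have "(T ^^ k) -` A \<in> sets borel" using measurable_sets_borel[of "T ^^ k" borel A] assms(3) by simp
  then have "measure (distr m borel T) ((T ^^ k) -` A) = measure m (T -` ((T ^^ k) -` A) \<inter> space m)"
    by (intro measure_distr) (simp_all add: measurable_prob_measures[OF m(1)])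
  moreover have "T -` ((T ^^ k) -` A) \<inter> space m = (T ^^ Suc k) -` A"
    using prob_measures_simps(3)[OF m(1)] by (auto simp: funpow_swap1)
  ultimately show ?case using Suc unfolding m(2) by metis
qed simp

lemma ergodic_full_support_HC:
  fixes T :: "'a::second_countable_topology \<Rightarrow> 'a"
  assumes "ergodic_measure T m" "full_support m" "continuous_on UNIV T"
  shows "emeasure m (HC T) = 1"
proof -
  have inv: "invariant_measure T m" and m: "m \<in> prob_measures"
    using assms(1) by (auto simp: ergodic_measure_def invariant_measure_def)
  interpret prob_space m using prob_measures_simps[OF m] by simp
  note sets = prob_measures_simps(2)[OF m]
  have one: "measure m V = 1" if V: "V \<in> O_T T" for V
  proof -
    define D where "D n = (T ^^ n) -` V" for n
    have openD: "open (D n)" for n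
      unfolding D_def using V open_vimage continuous_on_funpow[OF assms(3)] by (auto simp: O_T_def)
    have dec: "decseq D"
    proof (rule decseq_SucI)
      show "D (Suc n) \<subseteq> D n" for n using V by (auto simp: D_def O_T_def)
    qed
    define A where "A = (\<Inter>n. D n)"
    have "T -` A = (\<Inter>n. D (Suc n))" unfolding A_def D_def by (auto simp: funpow_swap1)
    also have "\<dots> = A" unfolding A_def using decseqD[OF dec] by (auto simp: subset_iff) (metis le_SucI order_refl)
    finally have "T -` A = A" .
    moreover have "A \<in> sets borel" unfolding A_def using openD by auto
    ultimately have A01: "measure m A = 0 \<or> measure m A = 1"
      using assms(1) by (auto simp: ergodic_measure_def emeasure_eq_measure)
    have "measure m (D n) = measure m V" for n unfolding D_def
      using V by (intro invariant_measure_funpow inv assms) (auto simp: O_T_def)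
    moreover have "(\<lambda>n. measure m (D n)) \<longlonglongrightarrow> measure m A"
      unfolding A_def using openD sets by (intro finite_Lim_measure_decseq dec) auto
    ultimately have "measure m A = measure m V" by (simp add: LIMSEQ_const_iff)
    moreover have "measure m V > 0"
      using assms(2) V by (auto simp: full_support_def O_T_def emeasure_eq_measure)
    ultimately show ?thesis using A01 by simp
  qed
  obtain U :: "nat \<Rightarrow> 'a set" where U: "\<And>n. open (U n)" "\<And>n. U n \<noteq> {}" "HC T = (\<Inter>n. hits T (U n))"
    using HC_eq_INT_hits by metis
  have "AE x in m. x \<in> hits T (U n)" for n
    using one[OF hits_in_O_T[OF assms(3) U(1,2)]] open_hits[OF assms(3) U(1)] sets
    by (subst AE_in_set_eq_1) auto
  then have "AE x in m. x \<in> HC T" unfolding U(3) by (simp add: AE_all_countable)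
  then have "measure m (HC T) = 1"
    using HC_borel[OF assms(3)] sets by (subst (asm) AE_in_set_eq_1) auto
  then show ?thesis by (simp add: emeasure_eq_measure)
qed

lemma weak_continuous_mapI:
  fixes F :: "'a::topological_space measure \<Rightarrow> 'b::topological_space measure"
  assumes "\<And>m. m \<in> prob_measures \<Longrightarrow> F m \<in> prob_measures"
    and "\<And>f. bcont f \<Longrightarrow> \<exists>g. bcont g \<and> (\<forall>m\<in>prob_measures. (\<integral>x. f x \<partial>F m) = (\<integral>x. g x \<partial>m))"
  shows "continuous_map weak_topology weak_topology F"
  unfolding weak_topology_def[where ?'a='b]
proof (rule continuous_on_generated_topo)
  fix S :: "'b measure set" assume "S \<in> {{\<mu> \<in> prob_measures. (\<integral>x. f x \<partial>\<mu>) \<in> U} | f U.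
        continuous_on UNIV f \<and> bounded (range f) \<and> open (U :: real set)}"
  then obtain f U where S: "S = {\<mu> \<in> prob_measures. (\<integral>x. f x \<partial>\<mu>) \<in> U}" and f: "bcont f"
      and U: "open (U :: real set)" by (auto simp: bcont_def)
  obtain g where g: "bcont g" "\<forall>m\<in>prob_measures. (\<integral>x. f x \<partial>F m) = (\<integral>x. g x \<partial>m)"
    using assms(2)[OF f] by blast
  have "F -` S \<inter> topspace weak_topology = {m \<in> prob_measures. (\<integral>x. g x \<partial>m) \<in> U}"
    using g assms(1) by (auto simp: S)
  then show "openin weak_topology (F -` S \<inter> topspace weak_topology)"
    using openin_weak_integral[OF g(1) U] by simp
next
  show "F ` topspace weak_topology \<subseteq> \<Union> {{\<mu> \<in> prob_measures. (\<integral>x. f x \<partial>\<mu>) \<in> U} | f U.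
        continuous_on UNIV f \<and> bounded (range f) \<and> open (U :: real set)}"
  proof -
    have "\<Union> {{\<mu> \<in> prob_measures. (\<integral>x. f x \<partial>\<mu>) \<in> U} | f U.
        continuous_on UNIV f \<and> bounded (range f) \<and> open (U :: real set)} = prob_measures"
      using topspace_weak_topology unfolding weak_topology_def topology_generated_by_topspace by blast
    then show ?thesis using assms(1) by auto
  qed
qed

lemma return_prob_measures: "return borel x \<in> prob_measures"
  by (simp add: prob_measures_def prob_space_return)

text \<open>If \<open>V\<close> were null, so would be \<open>hits T V\<close>, a countable union of
  preimages of equal mass; but it contains \<open>HC T\<close>.\<close>

lemma HC_full_support:
  fixes T :: "'a::second_countable_topology \<Rightarrow> 'a"
  assumes "invariant_measure T m" "continuous_on UNIV T" "emeasure m (HC T) = 1"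
  shows "full_support m"
  unfolding full_support_def
proof (intro allI impI)
  fix V :: "'a set" assume V: "open V \<and> V \<noteq> {}"
  have m: "m \<in> prob_measures" using assms(1) by (simp add: invariant_measure_def)
  interpret prob_space m using prob_measures_simps[OF m] by simp
  note sets = prob_measures_simps(2)[OF m]
  have "emeasure m V \<noteq> 0"
  proof
    assume "emeasure m V = 0"
    then have "emeasure m ((T ^^ k) -` V) = 0" for k
      using invariant_measure_funpow[OF assms(1,2), of V k] V by (simp add: emeasure_eq_measure)
    then have "emeasure m (hits T V) = 0"
      unfolding hits_def using V open_vimage[OF _ continuous_on_funpow[OF assms(2)]] sets
      by (intro emeasure_UN_eq_0) auto
    moreover have "emeasure m (HC T) \<le> emeasure m (hits T V)"
      using HC_subset_O_T[OF hits_in_O_T[OF assms(2)]] V open_hits[OF assms(2)] sets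
      by (intro emeasure_mono) auto
    ultimately show False using assms(3) by simp
  qed
  then show "0 < emeasure m V" by (simp add: zero_less_iff_neq_zero)
qed

section \<open>Existence of ergodic components\<close>

definition birkhoff_avg :: "('a \<Rightarrow> 'a) \<Rightarrow> nat \<Rightarrow> ('a \<Rightarrow> real) \<Rightarrow> 'a \<Rightarrow> real" where
  "birkhoff_avg T N f x = (\<Sum>i<N. f ((T ^^ i) x)) / real N"

lemma birkhoff_avg_bounds:
  assumes "\<And>x. 0 \<le> f x" "\<And>x. f x \<le> 1"
  shows "0 \<le> birkhoff_avg T N f x" "birkhoff_avg T N f x \<le> 1"
proof -
  show "0 \<le> birkhoff_avg T N f x" unfolding birkhoff_avg_def using assms by (simp add: sum_nonneg)
  have "(\<Sum>i<N. f ((T ^^ i) x)) \<le> (\<Sum>i<N. 1)" using assms by (intro sum_mono)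
  then show "birkhoff_avg T N f x \<le> 1" unfolding birkhoff_avg_def by (cases "N = 0") (auto simp: field_simps)
qed

lemma birkhoff_avg_measurable:
  fixes T :: "'a::topological_space \<Rightarrow> 'a"
  assumes "continuous_on UNIV T" "f \<in> borel_measurable borel"
  shows "birkhoff_avg T N f \<in> borel_measurable borel"
proof -
  have [measurable]: "T ^^ i \<in> borel_measurable borel" for i
    using continuous_on_funpow[OF assms(1)] by (rule borel_measurable_continuous_onI)
  show ?thesis unfolding birkhoff_avg_def using assms(2) by measurable
qed

lemma birkhoff_avg_shift:
  assumes "\<And>x. 0 \<le> f x" "\<And>x. f x \<le> 1"
  shows "\<bar>birkhoff_avg T N f (T x) - birkhoff_avg T N f x\<bar> \<le> 1 / real N"
proof -
  have "(\<Sum>i<N. f ((T ^^ i) (T x))) - (\<Sum>i<N. f ((T ^^ i) x)) = f ((T ^^ N) x) - f x"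
  proof (induction N)
    case (Suc N)
    then show ?case by (simp add: funpow_swap1)
  qed simp
  then have "birkhoff_avg T N f (T x) - birkhoff_avg T N f x = (f ((T ^^ N) x) - f x) / real N"
    unfolding birkhoff_avg_def by (simp add: diff_divide_distrib[symmetric])
  moreover have "\<bar>f ((T ^^ N) x) - f x\<bar> \<le> 1"
    using assms[of "(T ^^ N) x"] assms[of x] by (simp add: abs_le_iff)
  ultimately show ?thesis by (simp add: divide_right_mono)
qed

lemma birkhoff_avg_shift_funpow:
  assumes "\<And>x. 0 \<le> f x" "\<And>x. f x \<le> 1"
  shows "\<bar>birkhoff_avg T N f ((T ^^ j) x) - birkhoff_avg T N f x\<bar> \<le> real j / real N"
proof (induction j)
  case (Suc j)
  have "\<bar>birkhoff_avg T N f ((T ^^ Suc j) x) - birkhoff_avg T N f ((T ^^ j) x)\<bar> \<le> 1 / real N"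
    using birkhoff_avg_shift[where f=f and x="(T ^^ j) x" and T=T and N=N, OF assms] by simp
  then show ?case using Suc by (simp add: add_divide_distrib)
qed simp

text \<open>After exchanging the sums, averaging an average is a mean of \<open>n\<close> shifted
  copies of the long average, and a shift by \<open>j\<close> only affects \<open>j\<close> terms at
  either end.\<close>

lemma birkhoff_avg_iterate:
  assumes "\<And>x. 0 \<le> f x" "\<And>x. f x \<le> 1" "n > 0"
  shows "\<bar>birkhoff_avg T N (birkhoff_avg T n f) x - birkhoff_avg T N f x\<bar> \<le> real n / real N"
proof -
  let ?B = "birkhoff_avg T N f"
  have "birkhoff_avg T N (birkhoff_avg T n f) x = (\<Sum>i<N. \<Sum>j<n. f ((T ^^ j) ((T ^^ i) x)) / real n) / real N"
    unfolding birkhoff_avg_def by (simp add: sum_divide_distrib)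
  also have "\<dots> = (\<Sum>j<n. \<Sum>i<N. f ((T ^^ i) ((T ^^ j) x)) / real n) / real N"
    by (subst sum.swap) (simp add: funpow_add[symmetric, unfolded fun_eq_iff, simplified] add.commute)
  also have "\<dots> = (\<Sum>j<n. ?B ((T ^^ j) x)) / real n"
    unfolding birkhoff_avg_def by (simp add: sum_divide_distrib mult.commute)
  finally have "birkhoff_avg T N (birkhoff_avg T n f) x - ?B x = (\<Sum>j<n. ?B ((T ^^ j) x) - ?B x) / real n"
    using assms(3) by (simp add: sum_subtractf diff_divide_distrib)
  also have "\<bar>\<dots>\<bar> \<le> (\<Sum>j<n. real n / real N) / real n"
  proof -
    have "\<bar>\<Sum>j<n. ?B ((T ^^ j) x) - ?B x\<bar> \<le> (\<Sum>j<n. \<bar>?B ((T ^^ j) x) - ?B x\<bar>)" by (rule sum_abs)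
    also have "\<dots> \<le> (\<Sum>j<n. real n / real N)"
    proof (rule sum_mono)
      fix j assume "j \<in> {..<n}"
      then have "real j / real N \<le> real n / real N" by (intro divide_right_mono) auto
      then show "\<bar>?B ((T ^^ j) x) - ?B x\<bar> \<le> real n / real N"
        using birkhoff_avg_shift_funpow[where f=f and T=T and N=N and j=j and x=x, OF assms(1,2)] by linarith
    qed
    finally have "\<bar>\<Sum>j<n. ?B ((T ^^ j) x) - ?B x\<bar> / real n \<le> (\<Sum>j<n. real n / real N) / real n"
      by (rule divide_right_mono) simp
    then show ?thesis by simp
  qed
  finally show ?thesis using assms(3) by simp
qed

lemma invariant_integral_funpow:
  fixes h :: "'a::topological_space \<Rightarrow> real"
  assumes "invariant_measure T m" "continuous_on UNIV T" "h \<in> borel_measurable borel"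
  shows "(\<integral>x. h ((T ^^ i) x) \<partial>m) = (\<integral>x. h x \<partial>m)"
proof (induction i)
  case (Suc i)
  have m: "m \<in> prob_measures" "distr m borel T = m" using assms(1) by (auto simp: invariant_measure_def)
  have [measurable]: "T \<in> borel_measurable borel" "T ^^ i \<in> borel_measurable borel"
    using assms(2) continuous_on_funpow[OF assms(2)] by (auto intro: borel_measurable_continuous_onI)
  have "(\<integral>x. h ((T ^^ i) x) \<partial>distr m borel T) = (\<integral>x. h ((T ^^ i) (T x)) \<partial>m)"
    using assms(3) by (intro integral_distr) (simp_all add: measurable_prob_measures[OF m(1)])
  then show ?case using Suc m(2) by (simp add: funpow_swap1)
qed simp

lemma invariant_integral_birkhoff:
  fixes h :: "'a::topological_space \<Rightarrow> real"
  assumes "invariant_measure T m" "continuous_on UNIV T" "h \<in> borel_measurable borel" "\<And>x. \<bar>h x\<bar> \<le> c" "N > 0"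
  shows "(\<integral>x. birkhoff_avg T N h x \<partial>m) = (\<integral>x. h x \<partial>m)"
proof -
  have m: "m \<in> prob_measures" using assms(1) by (auto simp: invariant_measure_def)
  have [measurable]: "T ^^ i \<in> borel_measurable borel" for i
    using continuous_on_funpow[OF assms(2)] by (rule borel_measurable_continuous_onI)
  have "integrable m (\<lambda>x. h ((T ^^ i) x))" for i
    using assms(3,4) by (intro integrable_bounded_borel[OF m, where c=c]) auto
  then show ?thesis
    unfolding birkhoff_avg_def using invariant_integral_funpow[OF assms(1-3)] assms(5) by simp
qed

text \<open>The square of a mean is at most the mean of the squares; invariance then removes the
  averaging.\<close>

lemma birkhoff_avg_L2_le:
  fixes p :: "'a::topological_space \<Rightarrow> real"
  assumes "invariant_measure T m" "continuous_on UNIV T" and p: "p \<in> borel_measurable borel"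
    and b: "\<And>x. 0 \<le> p x" "\<And>x. p x \<le> 1" and "N > 0"
  shows "(\<integral>x. (birkhoff_avg T N p x)\<^sup>2 \<partial>m) \<le> (\<integral>x. (p x)\<^sup>2 \<partial>m)"
proof -
  have m: "m \<in> prob_measures" using assms(1) by (auto simp: invariant_measure_def)
  have b2: "0 \<le> (p x)\<^sup>2" "(p x)\<^sup>2 \<le> 1" for x using b[of x] by (auto simp: power_le_one)
  note p2 = borel_measurable_power[OF p, of 2]
  have "(birkhoff_avg T N p x)\<^sup>2 \<le> birkhoff_avg T N (\<lambda>x. (p x)\<^sup>2) x" for x
  proof -
    have "(\<Sum>i<N. p ((T ^^ i) x))\<^sup>2 \<le> (\<Sum>i<N. (p ((T ^^ i) x))\<^sup>2) * real N"
      using sum_squared_le_sum_of_squares[of "\<lambda>i. p ((T ^^ i) x)" "{..<N}"] by simp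
    then show ?thesis using assms(6) unfolding birkhoff_avg_def
      by (simp add: power_divide power2_eq_square field_simps)
  qed
  moreover have "integrable m (\<lambda>x. (birkhoff_avg T N p x)\<^sup>2)"
    using birkhoff_avg_bounds[where f=p and T=T, OF b] birkhoff_avg_measurable[OF assms(2) p]
    by (intro integrable_bounded_borel[OF m, where c=1] borel_measurable_power) (auto simp: power_le_one)
  moreover have "integrable m (birkhoff_avg T N (\<lambda>x. (p x)\<^sup>2))"
    using birkhoff_avg_bounds[where f="\<lambda>x. (p x)\<^sup>2" and T=T, OF b2] birkhoff_avg_measurable[OF assms(2) p2]
    by (intro integrable_bounded_borel[OF m, where c=1]) auto
  ultimately have "(\<integral>x. (birkhoff_avg T N p x)\<^sup>2 \<partial>m) \<le> (\<integral>x. birkhoff_avg T N (\<lambda>x. (p x)\<^sup>2) x \<partial>m)"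
    by (intro integral_mono)
  also have "\<dots> = (\<integral>x. (p x)\<^sup>2 \<partial>m)"
    using b2 by (intro invariant_integral_birkhoff[OF assms(1,2) p2, of 1] assms(6)) (auto simp: abs_of_nonneg)
  finally show ?thesis .
qed

text \<open>The \<open>L\<^sup>2\<close> norms of the averages converge to their infimum \<open>v\<close>, and no midpoint of two averages has
  a smaller norm, so the parallelogram identity makes the averages a Cauchy sequence.\<close>

lemma birkhoff_avg_L2_Cauchy:
  fixes f :: "'a::topological_space \<Rightarrow> real"
  assumes inv: "invariant_measure T m" and cont: "continuous_on UNIV T" and f: "f \<in> borel_measurable borel"
    and b: "\<And>x. 0 \<le> f x" "\<And>x. f x \<le> 1" and "e > 0"
  shows "\<exists>N0. \<forall>n\<ge>N0. \<forall>k\<ge>N0. (\<integral>x. (birkhoff_avg T n f x - birkhoff_avg T k f x)\<^sup>2 \<partial>m) \<le> e"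
proof -
  have m: "m \<in> prob_measures" using inv by (auto simp: invariant_measure_def)
  let ?A = "\<lambda>n. birkhoff_avg T n f"
  note A_b = birkhoff_avg_bounds[where f=f and T=T, OF b]
  note A_m [measurable] = birkhoff_avg_measurable[OF cont f]
  define q where "q n = (\<integral>x. (?A n x)\<^sup>2 \<partial>m)" for n
  have int: "integrable m h" if "h \<in> borel_measurable borel" "\<And>x. \<bar>h x\<bar> \<le> 1" for h :: "'a \<Rightarrow> real"
    using that by (rule integrable_bounded_borel[OF m])
  \<comment> \<open>Used twice: for \<open>p\<close> the midpoint of two averages it shows
    \<open>mid\<close>, and for \<open>p\<close> a single average it shows
    \<open>ev\<close>.\<close>
  have approx: "q L \<le> (\<integral>x. (p x)\<^sup>2 \<partial>m) + 2 * (C / real L)"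
    if p[measurable]: "p \<in> borel_measurable borel" and pb: "\<And>x. 0 \<le> p x" "\<And>x. p x \<le> 1"
      and near: "\<And>x. \<bar>birkhoff_avg T L p x - ?A L x\<bar> \<le> C / real L" and "L > 0" for p C L
  proof -
    note P_b = birkhoff_avg_bounds[where f=p and T=T, OF pb]
    note P_m [measurable] = birkhoff_avg_measurable[OF cont p]
    have pt: "(?A L x)\<^sup>2 \<le> (birkhoff_avg T L p x)\<^sup>2 + 2 * (C / real L)" for x
    proof -
      let ?a = "?A L x" and ?b = "birkhoff_avg T L p x"
      have "?a\<^sup>2 - ?b\<^sup>2 = (?a - ?b) * (?a + ?b)" by (simp add: power2_eq_square algebra_simps)
      also have "\<dots> \<le> \<bar>?a - ?b\<bar> * (?a + ?b)" using A_b(1)[of L x] P_b(1)[of L x] by (intro mult_right_mono) auto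
      also have "\<dots> \<le> (C / real L) * 2"
        using near[of x] A_b[of L x] P_b[of L x] by (intro mult_mono) (auto simp: abs_minus_commute)
      finally show ?thesis by (simp add: mult.commute)
    qed
    have i: "integrable m (\<lambda>x. (?A L x)\<^sup>2)" "integrable m (\<lambda>x. (birkhoff_avg T L p x)\<^sup>2)"
      using A_b P_b by (auto intro!: int simp: power_le_one)
    interpret prob_space m using prob_measures_simps[OF m] by simp
    have "q L \<le> (\<integral>x. (birkhoff_avg T L p x)\<^sup>2 + 2 * (C / real L) \<partial>m)"
      unfolding q_def using i pt by (intro integral_mono) auto
    also have "\<dots> = (\<integral>x. (birkhoff_avg T L p x)\<^sup>2 \<partial>m) + 2 * (C / real L)"
      using i by (simp add: prob_space)
    also have "\<dots> \<le> (\<integral>x. (p x)\<^sup>2 \<partial>m) + 2 * (C / real L)"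
      using birkhoff_avg_L2_le[OF inv cont p pb \<open>L > 0\<close>] by simp
    finally show ?thesis .
  qed
  \<comment> \<open>The index 0 is left out: the average of no terms is 0 by convention and would
    make the infimum 0.\<close>
  define v where "v = (INF n. q (Suc n))"
  have q0: "0 \<le> q n" for n unfolding q_def by simp
  have bdd: "bdd_below (range (\<lambda>n. q (Suc n)))" using q0 by (intro bdd_belowI[of _ 0]) auto
  have v_le: "v \<le> q n" if "n > 0" for n
    using cINF_lower[OF bdd, of "n - 1"] that unfolding v_def by simp
  have mid: "v \<le> (\<integral>x. ((?A n x + ?A k x) / 2)\<^sup>2 \<partial>m)" if "n > 0" "k > 0" for n k
  proof -
    define p where "p x = (?A n x + ?A k x) / 2" for x
    have p: "p \<in> borel_measurable borel" unfolding p_def by measurable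
    have pb: "0 \<le> p x" "p x \<le> 1" for x using A_b[of n x] A_b[of k x] by (auto simp: p_def)
    have "v - (\<integral>x. (p x)\<^sup>2 \<partial>m) \<le> 2 * (real (n + k) / real L)" if "L > 0" for L
    proof -
      have "\<bar>birkhoff_avg T L p x - ?A L x\<bar> \<le> real (n + k) / real L" for x
      proof -
        have "birkhoff_avg T L p x = (birkhoff_avg T L (?A n) x + birkhoff_avg T L (?A k) x) / 2"
          unfolding p_def birkhoff_avg_def[of T L] by (simp add: sum.distrib sum_divide_distrib[symmetric] add_divide_distrib)
        moreover have "\<bar>birkhoff_avg T L (?A n) x - ?A L x\<bar> \<le> real n / real L"
          "\<bar>birkhoff_avg T L (?A k) x - ?A L x\<bar> \<le> real k / real L"
          using birkhoff_avg_iterate[where f=f and T=T, OF b] \<open>n > 0\<close> \<open>k > 0\<close> by blast+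
        moreover have "real (n + k) / real L = real n / real L + real k / real L" "0 \<le> real n / real L" "0 \<le> real k / real L"
          by (auto simp: add_divide_distrib)
        ultimately show ?thesis by (simp add: abs_le_iff)
      qed
      from approx[OF p pb this that] show ?thesis using v_le[OF that] by linarith
    qed
    from this[OF zero_less_Suc] have "v - (\<integral>x. (p x)\<^sup>2 \<partial>m) \<le> 2 * (real (n + k) / real (Suc L))" for L .
    moreover have "(\<lambda>L. 2 * (real (n + k) / real (Suc L))) \<longlonglongrightarrow> 0"
    proof -
      have "(\<lambda>L. 2 * (real (n + k) * inverse (real (Suc L)))) \<longlonglongrightarrow> 2 * (real (n + k) * 0)"
        by (intro tendsto_intros LIMSEQ_inverse_real_of_nat)
      then show ?thesis by (simp add: divide_inverse)
    qed
    ultimately have "v - (\<integral>x. (p x)\<^sup>2 \<partial>m) \<le> 0" by (intro LIMSEQ_le_const) auto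
    then show ?thesis by (simp add: p_def)
  qed
  have para: "(\<integral>x. (?A n x - ?A k x)\<^sup>2 \<partial>m) \<le> 2 * q n + 2 * q k - 4 * v" if "n > 0" "k > 0" for n k
  proof -
    have i: "integrable m (\<lambda>x. (?A n x)\<^sup>2)" for n
      using A_b by (auto intro!: int simp: power_le_one)
    have i2: "integrable m (\<lambda>x. ((?A n x + ?A k x) / 2)\<^sup>2)"
    proof (rule int)
      show "\<bar>((?A n x + ?A k x) / 2)\<^sup>2\<bar> \<le> 1" for x
        using A_b[of n x] A_b[of k x] by (auto intro!: power_le_one)
    qed simp
    have "(?A n x - ?A k x)\<^sup>2 = 2 * (?A n x)\<^sup>2 + 2 * (?A k x)\<^sup>2 - 4 * ((?A n x + ?A k x) / 2)\<^sup>2" for x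
      by (simp add: power2_eq_square field_simps)
    then have "(\<integral>x. (?A n x - ?A k x)\<^sup>2 \<partial>m) = 2 * q n + 2 * q k - 4 * (\<integral>x. ((?A n x + ?A k x) / 2)\<^sup>2 \<partial>m)"
      unfolding q_def using i i2 by (simp only:) (simp del: power_divide)
    then show ?thesis using mid[OF that] by simp
  qed
  \<comment> \<open>In \<open>para\<close>, an excess of \<open>e / 4\<close> over \<open>v\<close>
    for both norms gives the bound \<open>e\<close>. Half of this excess pays for the choice of
    \<open>n1\<close>, the other half for the length of the average.\<close>
  have "(INF n. q (Suc n)) < v + e / 8" using \<open>e > 0\<close> unfolding v_def by simp
  then obtain n1 where n1: "q (Suc n1) < v + e / 8"
    using cINF_less_iff[OF UNIV_not_empty bdd, of "v + e / 8"] by blast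
  have ev: "q L < v + e / 4" if "L > 0" "16 * real (Suc n1) / e \<le> real L" for L
  proof -
    have "q L \<le> q (Suc n1) + 2 * (real (Suc n1) / real L)"
      unfolding q_def[of "Suc n1"]
      by (rule approx[OF A_m A_b birkhoff_avg_iterate[where f=f and T=T, OF b zero_less_Suc] that(1)])
    moreover have "2 * (real (Suc n1) / real L) \<le> e / 8"
      using that \<open>e > 0\<close> by (simp add: field_simps)
    ultimately show ?thesis using n1 by linarith
  qed
  obtain N0 :: nat where N0: "16 * real (Suc n1) / e \<le> real N0" using real_arch_simple by blast
  show ?thesis
  proof (intro exI[of _ "Suc N0"] allI impI)
    fix n k assume "Suc N0 \<le> n" "Suc N0 \<le> k"
    then have *: "n > 0" "k > 0" "16 * real (Suc n1) / e \<le> real n" "16 * real (Suc n1) / e \<le> real k"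
      using N0 by auto
    show "(\<integral>x. (?A n x - ?A k x)\<^sup>2 \<partial>m) \<le> e"
      using para[OF *(1,2)] ev[OF *(1,3)] ev[OF *(2,4)] by linarith
  qed
qed

lemma mean_ergodic:
  fixes f :: "'a::topological_space \<Rightarrow> real"
  assumes inv: "invariant_measure T m" and cont: "continuous_on UNIV T" and f: "f \<in> borel_measurable borel"
    and b: "\<And>x. 0 \<le> f x" "\<And>x. f x \<le> 1"
  obtains g where "g \<in> borel_measurable borel" "\<And>x. g (T x) = g x"
    "\<And>e. e > 0 \<Longrightarrow> \<exists>N>0. (\<integral>\<^sup>+x. ennreal \<bar>birkhoff_avg T N f x - g x\<bar> \<partial>m) \<le> ennreal e"
proof -
  have m: "m \<in> prob_measures" using inv by (auto simp: invariant_measure_def)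
  interpret prob_space m using prob_measures_simps[OF m] by simp
  let ?A = "\<lambda>n. birkhoff_avg T n f"
  note A_b = birkhoff_avg_bounds[where f=f and T=T, OF b]
  note A_m [measurable] = birkhoff_avg_measurable[OF cont f]
  have A_mm [measurable]: "?A n \<in> borel_measurable m" for n by (simp add: measurable_prob_measures[OF m])
  have d_b: "\<bar>?A n x - ?A k x\<bar> \<le> 1" for n k x
    using A_b[of n x] A_b[of k x] by (auto simp: abs_le_iff)
  have "\<exists>N. \<forall>n\<ge>N. \<forall>k\<ge>N. (\<integral>x. (?A n x - ?A k x)\<^sup>2 \<partial>m) \<le> ((1/2) ^ j)\<^sup>2" for j :: nat
    using birkhoff_avg_L2_Cauchy[OF inv cont f b, of "((1/2) ^ j)\<^sup>2"] by simp
  then obtain M where M: "\<And>j n k. n \<ge> M j \<Longrightarrow> k \<ge> M j \<Longrightarrow> (\<integral>x. (?A n x - ?A k x)\<^sup>2 \<partial>m) \<le> ((1/2) ^ j)\<^sup>2"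
    by metis
  \<comment> \<open>The sum puts \<open>N j\<close> and \<open>N (Suc j)\<close> beyond
    \<open>M j\<close>; the summand \<open>Suc j\<close> makes the shift error
    \<open>1 / real (N j)\<close> tend to 0.\<close>
  define N where "N j = (\<Sum>i\<le>j. M i) + Suc j" for j
  have N_ge: "M j \<le> N j" "M j \<le> N (Suc j)" "Suc j \<le> N j" for j
  proof -
    have "M j \<le> (\<Sum>i\<le>j. M i)" by (rule member_le_sum) auto
    then show "M j \<le> N j" "M j \<le> N (Suc j)" "Suc j \<le> N j" by (auto simp: N_def)
  qed
  have L1: "(\<integral>x. \<bar>?A (N (Suc j)) x - ?A (N j) x\<bar> \<partial>m) \<le> (1/2) ^ j" for j
  proof -
    let ?h = "\<lambda>x. \<bar>?A (N (Suc j)) x - ?A (N j) x\<bar>"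
    have i: "integrable m ?h" "integrable m (\<lambda>x. (?h x)\<^sup>2)"
      using d_b by (auto intro!: integrable_bounded_borel[OF m, where c=1] simp: abs_square_le_1)
    have "(\<integral>x. ?h x \<partial>m)\<^sup>2 \<le> (\<integral>x. (?h x)\<^sup>2 \<partial>m)"
      using variance_positive[of ?h] variance_eq[OF i] by simp
    also have "\<dots> \<le> ((1/2) ^ j)\<^sup>2" using M[OF N_ge(2,1)] by simp
    finally show ?thesis by (rule power2_le_imp_le) simp
  qed
  define g where "g x = lim (\<lambda>j. ?A (N j) x)" for x
  have g_m [measurable]: "g \<in> borel_measurable borel" unfolding g_def by measurable
  have g_mm [measurable]: "g \<in> borel_measurable m" by (simp add: measurable_prob_measures[OF m])
  have g_inv: "g (T x) = g x" for x
  proof -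
    have "(\<lambda>j. ?A (N j) (T x) - ?A (N j) x) \<longlonglongrightarrow> 0"
    proof (rule tendsto_rabs_zero_cancel, rule tendsto_sandwich[OF _ _ tendsto_const LIMSEQ_inverse_real_of_nat])
      show "\<forall>\<^sub>F j in sequentially. \<bar>?A (N j) (T x) - ?A (N j) x\<bar> \<le> inverse (real (Suc j))"
      proof (rule always_eventually, rule allI)
        fix j
        have "\<bar>?A (N j) (T x) - ?A (N j) x\<bar> \<le> 1 / real (N j)" by (rule birkhoff_avg_shift[where f=f and T=T, OF b])
        also have "\<dots> \<le> 1 / real (Suc j)" using N_ge(3)[of j] by (intro divide_left_mono) auto
        finally show "\<bar>?A (N j) (T x) - ?A (N j) x\<bar> \<le> inverse (real (Suc j))" by (simp add: inverse_eq_divide)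
      qed
    qed simp
    \<comment> \<open>The two sequences have the same limits, so \<open>lim\<close>, being a
      definite description, agrees at \<open>x\<close> and \<open>T x\<close> even where the
      averages diverge.\<close>
    then have "(\<lambda>j. ?A (N j) (T x)) \<longlonglongrightarrow> l \<longleftrightarrow> (\<lambda>j. ?A (N j) x) \<longlonglongrightarrow> l" for l
      by (rule Lim_transform_eq)
    then show ?thesis unfolding g_def lim_def by simp
  qed
  have "AE x in m. summable (\<lambda>j. \<bar>?A (N (Suc j)) x - ?A (N j) x\<bar>)"
  proof -
    have "(\<integral>\<^sup>+x. (\<Sum>j. ennreal \<bar>?A (N (Suc j)) x - ?A (N j) x\<bar>) \<partial>m)
        = (\<Sum>j. \<integral>\<^sup>+x. ennreal \<bar>?A (N (Suc j)) x - ?A (N j) x\<bar> \<partial>m)"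
      by (rule nn_integral_suminf) measurable
    also have "\<dots> \<le> (\<Sum>j. ennreal ((1/2) ^ j))"
    proof (rule suminf_le)
      fix j
      have "(\<integral>\<^sup>+x. ennreal \<bar>?A (N (Suc j)) x - ?A (N j) x\<bar> \<partial>m)
          = ennreal (\<integral>x. \<bar>?A (N (Suc j)) x - ?A (N j) x\<bar> \<partial>m)"
        using d_b by (intro nn_integral_eq_integral integrable_bounded_borel[OF m, where c=1]) auto
      then show "(\<integral>\<^sup>+x. ennreal \<bar>?A (N (Suc j)) x - ?A (N j) x\<bar> \<partial>m) \<le> ennreal ((1/2) ^ j)"
        using L1[of j] by (simp add: ennreal_leI)
    qed auto
    also have "\<dots> = ennreal (\<Sum>j. (1/2) ^ j)"
      by (rule suminf_ennreal2) (auto intro: summable_geometric)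
    also have "\<dots> < \<infinity>" by simp
    finally have "(\<integral>\<^sup>+x. (\<Sum>j. ennreal \<bar>?A (N (Suc j)) x - ?A (N j) x\<bar>) \<partial>m) \<noteq> \<infinity>" by simp
    then have "AE x in m. (\<Sum>j. ennreal \<bar>?A (N (Suc j)) x - ?A (N j) x\<bar>) \<noteq> \<infinity>"
      by (intro nn_integral_PInf_AE) measurable
    then show ?thesis
    proof eventually_elim
      case (elim x)
      then show ?case by (intro summable_suminf_not_top) auto
    qed
  qed
  then have lim: "AE x in m. (\<lambda>j. ?A (N j) x) \<longlonglongrightarrow> g x"
  proof eventually_elim
    case (elim x)
    then have "summable (\<lambda>j. ?A (N (Suc j)) x - ?A (N j) x)" by (rule summable_rabs_cancel)
    then have "convergent (\<lambda>n. \<Sum>j<n. ?A (N (Suc j)) x - ?A (N j) x)"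
      by (simp add: summable_iff_convergent)
    then have "convergent (\<lambda>n. ?A (N n) x - ?A (N 0) x)"
      by (simp add: sum_lessThan_telescope[where f="\<lambda>n. ?A (N n) x"])
    then have "convergent (\<lambda>n. ?A (N n) x)" by (simp add: convergent_diff_const_right_iff)
    then show ?case unfolding g_def by (simp add: convergent_LIMSEQ_iff)
  qed
  then have g_b: "AE x in m. 0 \<le> g x \<and> g x \<le> 1"
  proof eventually_elim
    case (elim x)
    then show ?case using A_b[of _ x] by (auto intro: LIMSEQ_le_const LIMSEQ_le_const2)
  qed
  have "(\<lambda>j. \<integral>x. \<bar>?A (N j) x - g x\<bar> \<partial>m) \<longlonglongrightarrow> (\<integral>x. 0 \<partial>m)"
  proof (rule integral_dominated_convergence[where w="\<lambda>_. 1"])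
    show "AE x in m. (\<lambda>j. \<bar>?A (N j) x - g x\<bar>) \<longlonglongrightarrow> 0"
      using lim
    proof eventually_elim
      case (elim x)
      then show ?case by (intro tendsto_rabs_zero) (simp add: LIM_zero_iff)
    qed
    show "AE x in m. norm \<bar>?A (N j) x - g x\<bar> \<le> 1" for j
      using g_b
    proof eventually_elim
      case (elim x)
      then show ?case using A_b[of "N j" x] by (auto simp: abs_le_iff)
    qed
  qed auto
  then have lim0: "(\<lambda>j. \<integral>x. \<bar>?A (N j) x - g x\<bar> \<partial>m) \<longlonglongrightarrow> 0" by simp
  have int: "integrable m (\<lambda>x. \<bar>?A (N j) x - g x\<bar>)" for j
  proof (rule integrable_const_bound[where B=1])
    show "AE x in m. norm \<bar>?A (N j) x - g x\<bar> \<le> 1"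
      using g_b
    proof eventually_elim
      case (elim x)
      then show ?case using A_b[of "N j" x] by (auto simp: abs_le_iff)
    qed
  qed measurable
  have "\<exists>N>0. (\<integral>\<^sup>+x. ennreal \<bar>?A N x - g x\<bar> \<partial>m) \<le> ennreal e" if "e > 0" for e
  proof -
    have "eventually (\<lambda>j. (\<integral>x. \<bar>?A (N j) x - g x\<bar> \<partial>m) < e) sequentially"
      by (rule order_tendstoD(2)[OF lim0 that])
    then obtain j where j: "(\<integral>x. \<bar>?A (N j) x - g x\<bar> \<partial>m) < e"
      using eventually_happens'[OF sequentially_bot] by blast
    have "(\<integral>\<^sup>+x. ennreal \<bar>?A (N j) x - g x\<bar> \<partial>m) = ennreal (\<integral>x. \<bar>?A (N j) x - g x\<bar> \<partial>m)"
      by (rule nn_integral_eq_integral[OF int]) simp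
    then show ?thesis using j N_ge(3)[of j] by (intro exI[of _ "N j"]) (auto intro!: ennreal_leI)
  qed
  then show thesis using that[OF g_m g_inv] by blast
qed

section \<open>Measure-determining functions and conditioning on invariant sets\<close>

text \<open>Finite unions of basic open sets are coded by lists of indices, so they are countably
  many; they exhaust every open set from inside, and the mass of each is a limit of integrals of a
  sequence of functions.\<close>

lemma countable_measure_determining:
  obtains F :: "nat \<Rightarrow> 'a::polish_space \<Rightarrow> real"
  where "\<And>k. bcont (F k)" "\<And>k x. 0 \<le> F k x" "\<And>k x. F k x \<le> 1"
    "\<And>m n. finite_measure m \<Longrightarrow> sets m = sets borel \<Longrightarrow> finite_measure n \<Longrightarrow> sets n = sets borel \<Longrightarrow>
      (\<And>k. (\<integral>x. F k x \<partial>m) = (\<integral>x. F k x \<partial>n)) \<Longrightarrow> m = n"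
proof -
  obtain B :: "'a set set" where B: "countable B" "topological_basis B"
    using ex_countable_basis by blast
  obtain b where "b \<in> B" "(undefined :: 'a) \<in> b"
    by (rule topological_basisE[OF B(2) open_UNIV UNIV_I])
  then have ne: "B \<noteq> {}" by blast
  define U where "U = from_nat_into B"
  have rng: "range U = B" unfolding U_def by (rule range_from_nat_into[OF ne B(1)])
  have Uo: "open (U n)" for n using topological_basis_open[OF B(2)] rng by blast
  define V where "V c = (\<Union>a\<in>set (from_nat c :: nat list). U a)" for c :: nat
  have Vo: "open (V c)" for c unfolding V_def using Uo by blast
  have "\<exists>f :: nat \<Rightarrow> 'a \<Rightarrow> real. (\<forall>i. bcont (f i)) \<and> (\<forall>i x. 0 \<le> f i x) \<and> (\<forall>i x. f i x \<le> 1) \<and>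
    (\<forall>m. finite_measure m \<longrightarrow> sets m = sets borel \<longrightarrow> (\<lambda>i. \<integral>x. f i x \<partial>m) \<longlonglongrightarrow> measure m (V c))" for c
    by (rule measure_open_approx[OF Vo[of c]]) blast
  then obtain f :: "nat \<Rightarrow> nat \<Rightarrow> 'a \<Rightarrow> real" where f: "\<And>c i. bcont (f c i)" "\<And>c i x. 0 \<le> f c i x" "\<And>c i x. f c i x \<le> 1"
    "\<And>c m. finite_measure m \<Longrightarrow> sets m = sets borel \<Longrightarrow> (\<lambda>i. \<integral>x. f c i x \<partial>m) \<longlonglongrightarrow> measure m (V c)"
    by metis
  define F where "F k = f (fst (prod_decode k)) (snd (prod_decode k))" for k
  show thesis
  proof (rule that[of F])
    show "bcont (F k)" "0 \<le> F k x" "F k x \<le> 1" for k x using f by (auto simp: F_def)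
    fix m n :: "'a measure"
    assume m: "finite_measure m" "sets m = sets borel" and n: "finite_measure n" "sets n = sets borel"
      and eq: "\<And>k. (\<integral>x. F k x \<partial>m) = (\<integral>x. F k x \<partial>n)"
    have eqV: "measure m (V c) = measure n (V c)" for c
    proof -
      have "(\<integral>x. f c i x \<partial>m) = (\<integral>x. f c i x \<partial>n)" for i
        using eq[of "prod_encode (c, i)"] by (simp add: F_def)
      then show ?thesis using f(4)[OF m, of c] f(4)[OF n, of c] LIMSEQ_unique by auto
    qed
    show "m = n"
    proof (rule measure_eqI_open[OF m n])
      fix W :: "'a set" assume W: "open W"
      define Wn where "Wn i = V (to_nat (filter (\<lambda>a. U a \<subseteq> W) [0..<i]))" for i
      have Wn: "Wn i = (\<Union>a\<in>{a. a < i \<and> U a \<subseteq> W}. U a)" for i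
        unfolding Wn_def V_def by auto
      have "(\<Union>i. Wn i) = W"
      proof
        show "(\<Union>i. Wn i) \<subseteq> W" unfolding Wn by blast
        show "W \<subseteq> (\<Union>i. Wn i)"
        proof
          fix x assume "x \<in> W"
          obtain b where b: "b \<in> B" "x \<in> b" "b \<subseteq> W"
            by (rule topological_basisE[OF B(2) W \<open>x \<in> W\<close>])
          then have "b \<in> range U" unfolding rng by blast
          then obtain a where "b = U a" by blast
          then have "x \<in> Wn (Suc a)" using b unfolding Wn by blast
          then show "x \<in> (\<Union>i. Wn i)" by blast
        qed
      qed
      moreover have "incseq Wn" unfolding Wn by (intro incseq_SucI UN_mono) auto
      moreover have "Wn i \<in> sets borel" for i unfolding Wn_def using Vo by simp
      ultimately have "(\<lambda>i. measure m (Wn i)) \<longlonglongrightarrow> measure m W" "(\<lambda>i. measure n (Wn i)) \<longlonglongrightarrow> measure n W"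
        using finite_measure.finite_Lim_measure_incseq[OF m(1), of Wn]
          finite_measure.finite_Lim_measure_incseq[OF n(1), of Wn] m(2) n(2) by auto
      then show "measure m W = measure n W" using eqV LIMSEQ_unique unfolding Wn_def by auto
    qed
  qed
qed

lemma uniform_measure_prob:
  assumes "m \<in> prob_measures" "A \<in> sets borel" "emeasure m A > 0"
  shows "uniform_measure m A \<in> prob_measures"
proof -
  interpret prob_space m using prob_measures_simps[OF assms(1)] by simp
  show ?thesis
    using prob_space_uniform_measure[of m A] assms prob_measures_simps(2)[OF assms(1)]
    by (simp add: prob_measures_def)
qed

lemma integral_uniform_measure:
  fixes f :: "'a::topological_space \<Rightarrow> real"
  assumes m: "m \<in> prob_measures" and A: "A \<in> sets borel" "emeasure m A > 0" and f: "f \<in> borel_measurable borel"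
  shows "(\<integral>x. f x \<partial>uniform_measure m A) = (\<integral>x. indicator A x * f x \<partial>m) / measure m A"
proof -
  interpret prob_space m using prob_measures_simps[OF m] by simp
  have p: "measure m A > 0" using A(2) by (simp add: emeasure_eq_measure)
  have AS [measurable]: "A \<in> sets m" using A prob_measures_simps(2)[OF m] by simp
  have "indicator A x / emeasure m A = ennreal (indicator A x / measure m A)" for x
    using p divide_ennreal[of 1 "measure m A"] by (auto simp: emeasure_eq_measure indicator_def)
  then have "uniform_measure m A = density m (\<lambda>x. ennreal (indicator A x / measure m A))"
    unfolding uniform_measure_def by simp
  moreover have "f \<in> borel_measurable m" using f by (simp add: measurable_prob_measures[OF m])
  ultimately have "(\<integral>x. f x \<partial>uniform_measure m A) = (\<integral>x. (indicator A x / measure m A) *\<^sub>R f x \<partial>m)"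
    by (simp only:) (intro integral_density; auto)
  also have "\<dots> = (\<integral>x. (indicator A x * f x) / measure m A \<partial>m)" by simp
  also have "\<dots> = (\<integral>x. indicator A x * f x \<partial>m) / measure m A" by (rule integral_divide_zero)
  finally show ?thesis .
qed

lemma uniform_measure_invariant:
  fixes T :: "'a::metric_space \<Rightarrow> 'a"
  assumes inv: "invariant_measure T m" and cont: "continuous_on UNIV T"
    and A: "A \<in> sets borel" "T -` A = A" "emeasure m A > 0"
  shows "invariant_measure T (uniform_measure m A)"
proof -
  have m: "m \<in> prob_measures" using inv by (auto simp: invariant_measure_def)
  have U: "uniform_measure m A \<in> prob_measures" by (rule uniform_measure_prob[OF m A(1,3)])
  have [measurable]: "T \<in> borel_measurable borel" using cont by (rule borel_measurable_continuous_onI)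
  show ?thesis
    unfolding invariant_measure_iff_bcont[OF cont U]
  proof (intro allI impI)
    fix f :: "'a \<Rightarrow> real" assume "bcont f"
    then have [measurable]: "f \<in> borel_measurable borel" by (rule bcont_measurable)
    have h: "(\<lambda>x. indicator A x * f x) \<in> borel_measurable borel" using A(1) by simp
    have "indicator A (T x) = indicat_real A x" for x using A(2) by (auto simp: indicator_def vimage_def set_eq_iff)
    then have "(\<integral>x. indicator A x * f (T x) \<partial>m) = (\<integral>x. indicator A x * f x \<partial>m)"
      using invariant_integral_funpow[OF inv cont h, of 1] by simp
    then show "(\<integral>x. f (T x) \<partial>uniform_measure m A) = (\<integral>x. f x \<partial>uniform_measure m A)"
      by (simp add: integral_uniform_measure[OF m A(1,3)])
  qed
qed

text \<open>Let \<open>E\<close> be the conditional expectation of \<open>u\<close> given the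
  \<sigma>-algebra of invariant sets. Its integral is at most 1, so \<open>E\<close> cannot exceed 2
  almost everywhere, and \<open>A0\<close> is where it does not. Any constant above 1 would do.
  Every later conditioning on an invariant subset of \<open>A0\<close> thus keeps control of
  \<open>u\<close>.\<close>

lemma invariant_set_small_density:
  fixes T :: "'a::topological_space \<Rightarrow> 'a" and u :: "'a \<Rightarrow> ennreal"
  assumes m: "m \<in> prob_measures" and T: "T \<in> borel_measurable borel"
    and u: "u \<in> borel_measurable borel" "(\<integral>\<^sup>+x. u x \<partial>m) \<le> 1"
  obtains A0 where "A0 \<in> sets borel" "T -` A0 = A0" "emeasure m A0 > 0"
    "\<And>A. A \<in> sets borel \<Longrightarrow> T -` A = A \<Longrightarrow> A \<subseteq> A0 \<Longrightarrow> (\<integral>\<^sup>+x. u x * indicator A x \<partial>m) \<le> 2 * emeasure m A"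
proof -
  interpret prob_space m using prob_measures_simps[OF m] by simp
  note sets = prob_measures_simps(2)[OF m] and space = prob_measures_simps(3)[OF m]
  define I where "I = {A \<in> sets borel. T -` A = A}"
  interpret I: sigma_algebra UNIV I
  proof (rule sigma_algebra.intro)
    show "algebra UNIV I" unfolding algebra_iff_Un I_def by (auto simp: vimage_Compl Compl_eq_Diff_UNIV[symmetric] vimage_Un)
    show "sigma_algebra_axioms I" unfolding sigma_algebra_axioms_def I_def by (auto simp: vimage_UN)
  qed
  define F where "F = sigma UNIV I"
  have sF: "sets F = I" unfolding F_def by (simp add: I.sigma_sets_eq)
  have spF: "space F = UNIV" unfolding F_def by simp
  interpret S: finite_measure_subalgebra m F
    by unfold_locales (auto simp: subalgebra_def spF space sF sets I_def)
  define E where "E = nn_cond_exp m F u"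
  have E_F [measurable]: "E \<in> borel_measurable F" unfolding E_def by simp
  have E_m [measurable]: "E \<in> borel_measurable m" unfolding E_def by simp
  have u_m [measurable]: "u \<in> borel_measurable m" using u by (simp add: measurable_prob_measures[OF m])
  define A0 where "A0 = {x. E x \<le> 2}"
  have "A0 \<in> sets F" using measurable_sets[OF E_F, of "{..2}"] by (simp add: A0_def vimage_def spF)
  then have A0: "A0 \<in> sets borel" "T -` A0 = A0" using sF by (auto simp: I_def)
  have ce: "(\<integral>\<^sup>+x. f x * E x \<partial>m) = (\<integral>\<^sup>+x. f x * u x \<partial>m)" if "f \<in> borel_measurable F" for f
    unfolding E_def by (rule S.nn_cond_exp_intg[OF that u_m])
  have "emeasure m A0 \<noteq> 0"
  proof
    assume "emeasure m A0 = 0"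
    then have "AE x in m. x \<notin> A0" using A0(1) sets by (intro AE_not_in) (auto simp: null_sets_def)
    then have "AE x in m. 2 \<le> E x" by (rule eventually_mono) (auto simp: A0_def)
    then have "(\<integral>\<^sup>+x. 2 \<partial>m) \<le> (\<integral>\<^sup>+x. E x \<partial>m)" by (rule nn_integral_mono_AE)
    also have "\<dots> = (\<integral>\<^sup>+x. u x \<partial>m)" using ce[of "\<lambda>_. 1"] by simp
    also have "\<dots> \<le> 1" by fact
    finally show False by (simp add: emeasure_space_1)
  qed
  moreover have "(\<integral>\<^sup>+x. u x * indicator A x \<partial>m) \<le> 2 * emeasure m A"
    if A: "A \<in> sets borel" "T -` A = A" "A \<subseteq> A0" for A
  proof -
    have AF: "A \<in> sets F" using A sF by (simp add: I_def)
    have AM: "A \<in> sets m" using A sets by simp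
    have "(\<integral>\<^sup>+x. u x * indicator A x \<partial>m) = (\<integral>\<^sup>+x. indicator A x * E x \<partial>m)"
      using ce[OF borel_measurable_indicator[OF AF]] by (simp add: mult.commute)
    also have "\<dots> \<le> (\<integral>\<^sup>+x. 2 * indicator A x \<partial>m)"
      using A(3) by (intro nn_integral_mono) (auto simp: indicator_def A0_def)
    also have "\<dots> = 2 * emeasure m A" using AM by (simp add: nn_integral_cmult_indicator)
    finally show ?thesis .
  qed
  ultimately show thesis using that[OF A0] by (simp add: zero_less_iff_neq_zero)
qed

text \<open>The invariant sets \<open>A n\<close> zoom in on a typical point of the quotient by the invariant \<open>\<sigma>\<close>-algebra:
  conditioning on them keeps tightness and the mean ergodic estimates, while the limits of the averages
  become constant. So a weak limit of the conditioned measures is an ergodic component.\<close>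

theorem ergodic_measure_exists:
  fixes T :: "'a::polish_space \<Rightarrow> 'a"
  assumes inv: "invariant_measure T m" and cont: "continuous_on UNIV T"
    and S: "S \<in> sets borel" "emeasure m S = 1"
  obtains \<mu> where "ergodic_measure T \<mu>" "emeasure \<mu> S = 1"
proof -
  have m: "m \<in> prob_measures" using inv by (auto simp: invariant_measure_def)
  interpret prob_space m using prob_measures_simps[OF m] by simp
  note sets = prob_measures_simps(2)[OF m]
  have T_m: "T \<in> borel_measurable borel" using cont by (rule borel_measurable_continuous_onI)
  have S1: "measure m S = 1" using S(2) by (simp add: emeasure_eq_measure)
  obtain F :: "nat \<Rightarrow> 'a \<Rightarrow> real" where F: "\<And>k. bcont (F k)" "\<And>k x. 0 \<le> F k x" "\<And>k x. F k x \<le> 1"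
    and F_det: "\<And>m n. finite_measure m \<Longrightarrow> sets m = sets borel \<Longrightarrow> finite_measure n \<Longrightarrow> sets n = sets borel \<Longrightarrow>
      (\<And>k. (\<integral>x. F k x \<partial>m) = (\<integral>x. F k x \<partial>n)) \<Longrightarrow> m = n"
    using countable_measure_determining by metis
  note F_m = bcont_measurable[OF F(1)]
  have "\<exists>g. g \<in> borel_measurable borel \<and> (\<forall>x. g (T x) = g x) \<and>
    (\<forall>e>0. \<exists>N>0. (\<integral>\<^sup>+x. ennreal \<bar>birkhoff_avg T N (F k) x - g x\<bar> \<partial>m) \<le> ennreal e)" for k
    by (rule mean_ergodic[OF inv cont F_m[of k] F(2,3)]) blast
  from choice[OF allI[OF this]]
  obtain g where "\<forall>k. g k \<in> borel_measurable borel \<and> (\<forall>x. g k (T x) = g k x) \<and>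
    (\<forall>e>0. \<exists>N>0. (\<integral>\<^sup>+x. ennreal \<bar>birkhoff_avg T N (F k) x - g k x\<bar> \<partial>m) \<le> ennreal e)" ..
  note g' = spec[OF this]
  have g: "g k \<in> borel_measurable borel" "g k (T x) = g k x"
    "e > 0 \<Longrightarrow> \<exists>N>0. (\<integral>\<^sup>+x. ennreal \<bar>birkhoff_avg T N (F k) x - g k x\<bar> \<partial>m) \<le> ennreal e" for k x e
    using g'[THEN conjunct1] g'[THEN conjunct2, THEN conjunct1] g'[THEN conjunct2, THEN conjunct2] by simp_all
  \<comment> \<open>Each \<open>k\<close> is \<open>idx l\<close> for infinitely many
    \<open>l\<close>, so every \<open>F k\<close> has averages that approach \<open>g k\<close>
    within any precision.\<close>
  define idx where "idx l = fst (prod_decode l)" for l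
  have "\<exists>N>0. (\<integral>\<^sup>+x. ennreal \<bar>birkhoff_avg T N (F (idx l)) x - g (idx l) x\<bar> \<partial>m) \<le> ennreal ((1/4) ^ Suc l)" for l
    by (rule g(3)) simp
  then obtain N where N: "\<And>l. N l > 0"
    "\<And>l. (\<integral>\<^sup>+x. ennreal \<bar>birkhoff_avg T (N l) (F (idx l)) x - g (idx l) x\<bar> \<partial>m) \<le> ennreal ((1/4) ^ Suc l)"
    by metis
  have "\<exists>K. compact K \<and> K \<subseteq> S \<and> 1 - (1/4) ^ Suc l < measure m K" for l
    by (rule prob_measure_inner_compact[OF m S(1), of "1 - (1/4) ^ Suc l"]) (use S1 in auto)
  then obtain K where K: "\<And>l. compact (K l)" "\<And>l. K l \<subseteq> S" "\<And>l. 1 - (1/4) ^ Suc l < measure m (K l)"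
    by metis
  define h where "h l x = \<bar>birkhoff_avg T (N l) (F (idx l)) x - g (idx l) x\<bar>" for l x
  have h_m [measurable]: "h l \<in> borel_measurable borel" for l
    unfolding h_def using birkhoff_avg_measurable[OF cont F_m] g(1) by measurable
  have K_m [measurable]: "- K l \<in> sets borel" for l
    using K(1)[of l] by (intro borel_open) (simp add: compact_imp_closed open_Compl)
  \<comment> \<open>The weight \<open>2 ^ l\<close> spends half of the precision
    \<open>(1/4) ^ Suc l\<close>: the integrals over \<open>m\<close> still sum to at most 1, and a
    bound on \<open>u\<close> after conditioning returns \<open>2 * (1/2) ^ l\<close> for the
    \<open>l\<close>-th term.\<close>
  define w where "w l x = ennreal (2 ^ l) * (indicator (- K l) x + ennreal (h l x))" for l x
  have w_m [measurable]: "w l \<in> borel_measurable borel" for l unfolding w_def by measurable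
  have w_mm: "w l \<in> borel_measurable m" for l by (simp add: measurable_prob_measures[OF m])
  define u where "u x = (\<Sum>l. w l x)" for x
  have u_m: "u \<in> borel_measurable borel" unfolding u_def by measurable
  have "(\<integral>\<^sup>+x. u x \<partial>m) = (\<Sum>l. \<integral>\<^sup>+x. w l x \<partial>m)"
    unfolding u_def by (rule nn_integral_suminf[OF w_mm])
  also have "\<dots> \<le> (\<Sum>l. ennreal ((1/2) ^ Suc l))"
  proof (rule suminf_le)
    fix l
    have KS: "- K l \<in> sets m" using K_m sets by simp
    have "(\<integral>\<^sup>+x. w l x \<partial>m) = ennreal (2 ^ l) * (emeasure m (- K l) + (\<integral>\<^sup>+x. ennreal (h l x) \<partial>m))"
      unfolding w_def using KS h_m[of l]
      by (subst nn_integral_cmult, simp add: measurable_prob_measures[OF m], subst nn_integral_add)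
         (auto simp: measurable_prob_measures[OF m])
    also have "\<dots> \<le> ennreal (2 ^ l) * (ennreal ((1/4) ^ Suc l) + ennreal ((1/4) ^ Suc l))"
    proof (intro mult_left_mono add_mono)
      have "K l \<in> sets m" using K(1)[of l] sets by (simp add: compact_imp_closed)
      then have "measure m (- K l) = 1 - measure m (K l)"
        using prob_compl[of "K l"] prob_measures_simps(3)[OF m] by (simp add: Compl_eq_Diff_UNIV)
      then show "emeasure m (- K l) \<le> ennreal ((1/4) ^ Suc l)"
        using K(3)[of l] by (simp add: emeasure_eq_measure)
      show "(\<integral>\<^sup>+x. ennreal (h l x) \<partial>m) \<le> ennreal ((1/4) ^ Suc l)" unfolding h_def by (rule N(2))
    qed auto
    also have "\<dots> = ennreal ((1/2) ^ Suc l)"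
    proof -
      have "2 ^ l * ((1/4) ^ Suc l + (1/4) ^ Suc l) = ((1/2) ^ Suc l :: real)"
        by (simp add: power_divide field_simps flip: power_mult_distrib)
      then show ?thesis by (simp flip: ennreal_plus ennreal_mult)
    qed
    finally show "(\<integral>\<^sup>+x. w l x \<partial>m) \<le> ennreal ((1/2) ^ Suc l)" .
  qed auto
  also have "\<dots> = ennreal (\<Sum>l. (1/2) ^ Suc l)"
    by (rule suminf_ennreal2) (auto intro!: summable_mult summable_geometric)
  also have "(\<Sum>l. (1/2) ^ Suc l) = (1 :: real)"
    using sums_unique[OF power_half_series] by simp
  finally have u1: "(\<integral>\<^sup>+x. u x \<partial>m) \<le> 1" by simp
  obtain A0 where A0: "A0 \<in> sets borel" "T -` A0 = A0" "emeasure m A0 > 0"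
    "\<And>A. A \<in> sets borel \<Longrightarrow> T -` A = A \<Longrightarrow> A \<subseteq> A0 \<Longrightarrow> (\<integral>\<^sup>+x. u x * indicator A x \<partial>m) \<le> 2 * emeasure m A"
    using invariant_set_small_density[OF m T_m u_m u1] by metis
  define OK where "OK A \<longleftrightarrow> A \<in> sets borel \<and> T -` A = A \<and> emeasure m A > 0 \<and> A \<subseteq> A0" for A
  \<comment> \<open>Stage \<open>n\<close> cuts the range of \<open>g (idx n)\<close> into cells of
    width \<open>\<delta> n\<close>; by the pairing each \<open>g k\<close> is cut at arbitrarily
    small widths. The cells are countably many, so one of them keeps positive mass.\<close>
  define \<delta> where "\<delta> n = inverse (real (Suc (snd (prod_decode n))))" for n
  have \<delta>: "\<delta> n > 0" for n by (simp add: \<delta>_def)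
  have "\<exists>A. \<forall>n. OK (A n) \<and> (A (Suc n) \<subseteq> A n \<and> (\<exists>c. \<forall>x\<in>A (Suc n). \<bar>g (idx n) x - c\<bar> \<le> \<delta> n))"
  proof (rule dependent_nat_choice)
    show "\<exists>A. OK A" using A0 by (auto simp: OK_def)
    fix A and n :: nat assume A: "OK A"
    define P where "P z = A \<inter> {x. \<lfloor>g (idx n) x / \<delta> n\<rfloor> = z}" for z :: int
    have P_b: "P z \<in> sets borel" for z
    proof -
      have "{x. \<lfloor>g (idx n) x / \<delta> n\<rfloor> = z} \<in> sets borel" using g(1)[of "idx n"] by measurable
      then show ?thesis using A by (auto simp: P_def OK_def)
    qed
    have P_inv: "T -` P z = P z" for z using A g(2)[of "idx n"] by (auto simp: P_def OK_def)
    have "\<exists>z. emeasure m (P z) > 0"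
    proof (rule ccontr)
      assume "\<not> ?thesis"
      then have "emeasure m (P z) = 0" for z by (simp add: zero_less_iff_neq_zero)
      then have "AE x in m. x \<notin> P z" for z using P_b sets by (intro AE_not_in) (auto simp: null_sets_def)
      then have "AE x in m. \<forall>z. x \<notin> P z" by (simp add: AE_all_countable)
      then have "AE x in m. x \<notin> A" by (rule eventually_mono) (auto simp: P_def)
      then have "emeasure m A = 0"
        using AE_iff_measurable[of A m "\<lambda>x. x \<notin> A"] A sets prob_measures_simps(3)[OF m] by (auto simp: OK_def)
      then show False using A by (simp add: OK_def)
    qed
    then obtain z where z: "emeasure m (P z) > 0" by blast
    have "\<bar>g (idx n) x - of_int z * \<delta> n\<bar> \<le> \<delta> n" if "x \<in> P z" for x
    proof -
      have "of_int z \<le> g (idx n) x / \<delta> n" "g (idx n) x / \<delta> n \<le> of_int z + 1"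
        using that by (auto simp: P_def)
      then show ?thesis using \<delta>[of n] by (simp add: field_simps abs_le_iff)
    qed
    then have "\<exists>c. \<forall>x\<in>P z. \<bar>g (idx n) x - c\<bar> \<le> \<delta> n" by blast
    moreover have "P z \<subseteq> A" by (auto simp: P_def)
    moreover have "OK (P z)" using z P_b P_inv A \<open>P z \<subseteq> A\<close> unfolding OK_def by blast
    ultimately show "\<exists>A'. OK A' \<and> A' \<subseteq> A \<and> (\<exists>c. \<forall>x\<in>A'. \<bar>g (idx n) x - c\<bar> \<le> \<delta> n)" by blast
  qed
  then obtain A where A: "\<And>n. OK (A n)" "\<And>n. A (Suc n) \<subseteq> A n"
      "\<And>n. \<exists>c. \<forall>x\<in>A (Suc n). \<bar>g (idx n) x - c\<bar> \<le> \<delta> n"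
    by metis
  have A_dec: "A k \<subseteq> A n" if "n \<le> k" for n k using decseq_SucI[of A, OF A(2)] that by (auto simp: decseq_def)
  define s where "s n = uniform_measure m (A n)" for n
  have s_P: "s n \<in> prob_measures" for n
    unfolding s_def using A(1)[of n] by (intro uniform_measure_prob m) (auto simp: OK_def)
  have s_inv: "invariant_measure T (s n)" for n
    unfolding s_def using A(1)[of n] by (intro uniform_measure_invariant inv cont) (auto simp: OK_def)
  have s_w: "(\<integral>\<^sup>+x. w l x \<partial>s n) \<le> 2" for l n
  proof -
    have An: "A n \<in> sets m" "0 < emeasure m (A n)" using A(1)[of n] sets by (auto simp: OK_def)
    have "(\<integral>\<^sup>+x. w l x \<partial>s n) = (\<integral>\<^sup>+x. w l x * indicator (A n) x \<partial>m) / emeasure m (A n)"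
      unfolding s_def by (rule nn_integral_uniform_measure[OF w_mm An(1)])
    also have "\<dots> \<le> (2 * emeasure m (A n)) / emeasure m (A n)"
    proof (rule divide_right_mono_ennreal)
      have "w l x \<le> u x" for x unfolding u_def using sum_le_suminf[of "\<lambda>l. w l x" "{l}"] by simp
      then have "(\<integral>\<^sup>+x. w l x * indicator (A n) x \<partial>m) \<le> (\<integral>\<^sup>+x. u x * indicator (A n) x \<partial>m)"
        by (intro nn_integral_mono mult_right_mono) auto
      also have "\<dots> \<le> 2 * emeasure m (A n)" using A(1)[of n] by (intro A0(4)) (auto simp: OK_def)
      finally show "(\<integral>\<^sup>+x. w l x * indicator (A n) x \<partial>m) \<le> 2 * emeasure m (A n)" .
    qed
    also have "\<dots> = 2"
      using An(2) by (intro ennreal_mult_divide_eq) (auto simp: emeasure_eq_measure)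
    finally show ?thesis .
  qed
  have s_small: "(\<integral>\<^sup>+x. v x \<partial>s n) \<le> ennreal (2 * (1/2) ^ l)"
    if v: "v \<in> borel_measurable borel" "\<And>x. ennreal (2 ^ l) * v x \<le> w l x" for v l n
  proof -
    have "ennreal (2 ^ l) * (\<integral>\<^sup>+x. v x \<partial>s n) = (\<integral>\<^sup>+x. ennreal (2 ^ l) * v x \<partial>s n)"
      using v(1) by (intro nn_integral_cmult[symmetric]) (simp add: measurable_prob_measures[OF s_P])
    also have "\<dots> \<le> (\<integral>\<^sup>+x. w l x \<partial>s n)" by (intro nn_integral_mono v)
    also have "\<dots> \<le> 2" by (rule s_w)
    finally have "ennreal ((1/2) ^ l) * (ennreal (2 ^ l) * (\<integral>\<^sup>+x. v x \<partial>s n)) \<le> ennreal ((1/2) ^ l) * 2"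
      by (rule mult_left_mono) simp
    moreover have "ennreal ((1/2) ^ l) * ennreal (2 ^ l) = 1"
      by (simp flip: ennreal_mult power_mult_distrib)
    ultimately have "(\<integral>\<^sup>+x. v x \<partial>s n) \<le> ennreal ((1/2) ^ l) * ennreal 2"
      unfolding mult.assoc[symmetric] by simp
    also have "\<dots> = ennreal ((1/2) ^ l * 2)" by (rule ennreal_mult[symmetric]) auto
    finally show ?thesis unfolding mult.commute[of 2] .
  qed
  have s_K: "measure (s n) (- K l) \<le> 2 * (1/2) ^ l" for n l
  proof -
    interpret sn: prob_space "s n" using prob_measures_simps[OF s_P] by simp
    have "(\<integral>\<^sup>+x. indicator (- K l) x \<partial>s n) \<le> ennreal (2 * (1/2) ^ l)"
      by (rule s_small) (auto simp: w_def intro!: mult_left_mono)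
    moreover have "(\<integral>\<^sup>+x. indicator (- K l) x \<partial>s n) = emeasure (s n) (- K l)"
      using K_m prob_measures_simps(2)[OF s_P] by (intro nn_integral_indicator) simp
    ultimately show ?thesis by (simp add: sn.emeasure_eq_measure)
  qed
  have s_h: "(\<integral>\<^sup>+x. ennreal (h l x) \<partial>s n) \<le> ennreal (2 * (1/2) ^ l)" for n l
    by (rule s_small) (auto simp: w_def intro!: mult_left_mono)
  have half: "\<exists>l0. \<forall>l\<ge>l0. 2 * (1/2) ^ l \<le> e" if "e > 0" for e :: real
  proof -
    have "(\<lambda>l. 2 * (1/2 :: real) ^ l) \<longlonglongrightarrow> 2 * 0" by (intro tendsto_intros LIMSEQ_realpow_zero) auto
    then have "eventually (\<lambda>l. 2 * (1/2 :: real) ^ l < e) sequentially"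
      by (rule order_tendstoD(2)) (use that in simp)
    then show ?thesis unfolding eventually_sequentially by (meson less_imp_le)
  qed
  have "\<exists>K. compact K \<and> (\<forall>n. 1 - e \<le> measure (s n) K)" if "e > 0" for e
  proof -
    obtain l where l: "2 * (1/2) ^ l \<le> e" using half[OF \<open>e > 0\<close>] by blast
    have "1 - e \<le> measure (s n) (K l)" for n
    proof -
      interpret sn: prob_space "s n" using prob_measures_simps[OF s_P] by simp
      have "K l \<in> sets (s n)" using K(1)[of l] prob_measures_simps(2)[OF s_P] by (simp add: compact_imp_closed)
      then have "measure (s n) (- K l) = 1 - measure (s n) (K l)"
        using sn.prob_compl[of "K l"] prob_measures_simps(3)[OF s_P] by (simp add: Compl_eq_Diff_UNIV)
      then show ?thesis using s_K[of n l] l by linarith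
    qed
    then show ?thesis using K(1) by blast
  qed
  then obtain r \<mu> where r: "strict_mono r" and \<mu>P: "\<mu> \<in> prob_measures" and lim: "weak_lim (s \<circ> r) \<mu>"
    by (rule Prokhorov[OF s_P])
  interpret \<mu>: prob_space \<mu> using prob_measures_simps[OF \<mu>P] by simp
  note \<mu>sets = prob_measures_simps(2)[OF \<mu>P]
  have \<mu>inv: "invariant_measure T \<mu>"
  proof -
    have "\<mu> \<in> weak_topology closure_of (invariant_measures T)"
      using s_inv by (intro weak_lim_in_closure[OF lim \<mu>P]) (auto simp: invariant_measures_def invariant_measure_def)
    then show ?thesis
      using closure_of_closedin[OF closedin_invariant_measures[OF cont]] by (simp add: invariant_measures_def)
  qed
  have \<mu>S: "emeasure \<mu> S = 1"
  proof -
    have "1 \<le> measure \<mu> S + e" if "e > 0" for e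
    proof -
      obtain l where l: "2 * (1/2) ^ l \<le> e" using half[OF \<open>e > 0\<close>] by blast
      have "open (- K l)" using K(1)[of l] by (simp add: compact_imp_closed open_Compl)
      then have "measure \<mu> (- K l) \<le> 2 * (1/2) ^ l"
        by (intro weak_lim_measure_open[OF lim \<mu>P]) (auto simp: s_P s_K)
      moreover have "K l \<in> sets \<mu>" using K(1)[of l] \<mu>sets by (simp add: compact_imp_closed)
      then have "measure \<mu> (- K l) = 1 - measure \<mu> (K l)"
        using \<mu>.prob_compl[of "K l"] prob_measures_simps(3)[OF \<mu>P] by (simp add: Compl_eq_Diff_UNIV)
      moreover have "measure \<mu> (K l) \<le> measure \<mu> S"
        using K(2)[of l] S(1) \<mu>sets by (intro \<mu>.finite_measure_mono) auto
      ultimately show ?thesis using l by linarith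
    qed
    then have "1 \<le> measure \<mu> S" by (rule field_le_epsilon)
    then show ?thesis using \<mu>.prob_le_1[of S] by (simp add: \<mu>.emeasure_eq_measure)
  qed
  \<comment> \<open>Stated for the averages and not for \<open>g k\<close>: they are bounded and
    continuous, so the estimate passes to the weak limit, whereas \<open>g k\<close> is merely
    Borel.\<close>
  have near_const: "\<exists>M>0. \<exists>c. (\<integral>x. \<bar>birkhoff_avg T M (F k) x - c\<bar> \<partial>\<mu>) \<le> e" if "e > 0" for k e
  proof -
    obtain i where i: "\<And>l. l \<ge> i \<Longrightarrow> 2 * (1/2) ^ l \<le> e / 2" using half[of "e / 2"] \<open>e > 0\<close> by auto
    define l where "l = prod_encode (k, i)"
    have l: "idx l = k" "2 * (1/2) ^ l \<le> e / 2"
      using i[of l] le_prod_encode_2[of i k] by (auto simp: l_def idx_def)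
    obtain i' where i': "inverse (real (Suc i')) < e / 2" using reals_Archimedean[of "e / 2"] \<open>e > 0\<close> by auto
    define n0 where "n0 = prod_encode (k, i')"
    have n0: "idx n0 = k" "\<delta> n0 \<le> e / 2" using i' by (auto simp: n0_def idx_def \<delta>_def)
    obtain c where c: "\<And>x. x \<in> A (Suc n0) \<Longrightarrow> \<bar>g k x - c\<bar> \<le> e / 2"
      using A(3)[of n0] n0 by (meson order_trans)
    let ?B = "birkhoff_avg T (N l) (F k)"
    have B_b: "0 \<le> ?B x" "?B x \<le> 1" for x using birkhoff_avg_bounds[of "F k", OF F(2,3)] by auto
    have bc: "bcont (\<lambda>x. \<bar>?B x - c\<bar>)"
    proof (rule bcontI)
      have "continuous_on UNIV (\<lambda>x. F k ((T ^^ j) x))" for j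
        using bcont_compose[OF F(1) continuous_on_funpow[OF cont]] by (simp add: bcont_def)
      then show "continuous_on UNIV (\<lambda>x. \<bar>?B x - c\<bar>)"
        unfolding birkhoff_avg_def using N(1)[of l] by (intro continuous_intros) auto
      show "\<bar>\<bar>?B x - c\<bar>\<bar> \<le> 1 + \<bar>c\<bar>" for x using B_b[of x] by linarith
    qed
    have le: "(\<integral>x. \<bar>?B x - c\<bar> \<partial>s n) \<le> e" if n: "n \<ge> Suc n0" for n
    proof -
      interpret sn: prob_space "s n" using prob_measures_simps[OF s_P] by simp
      have An: "A n \<in> sets m" "0 < emeasure m (A n)" using A(1)[of n] sets by (auto simp: OK_def)
      have "AE x in s n. x \<in> A n" unfolding s_def using An by (intro AE_uniform_measureI) auto
      then have ae: "AE x in s n. ennreal \<bar>?B x - c\<bar> \<le> ennreal (h l x) + ennreal (e / 2)"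
      proof eventually_elim
        case (elim x)
        then have "\<bar>g k x - c\<bar> \<le> e / 2" using A_dec[OF n] by (intro c) auto
        then have "\<bar>?B x - c\<bar> \<le> h l x + e / 2" unfolding h_def l(1) by linarith
        then have "ennreal \<bar>?B x - c\<bar> \<le> ennreal (h l x + e / 2)" by (rule ennreal_leI)
        also have "\<dots> = ennreal (h l x) + ennreal (e / 2)" using \<open>e > 0\<close> by (intro ennreal_plus) (auto simp: h_def)
        finally show ?case .
      qed
      have "ennreal (\<integral>x. \<bar>?B x - c\<bar> \<partial>s n) = (\<integral>\<^sup>+x. ennreal \<bar>?B x - c\<bar> \<partial>s n)"
        by (rule nn_integral_eq_integral[symmetric, OF integrable_bcont[OF s_P bc]]) simp
      also have "\<dots> \<le> (\<integral>\<^sup>+x. ennreal (h l x) + ennreal (e / 2) \<partial>s n)"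
        by (rule nn_integral_mono_AE[OF ae])
      also have "\<dots> = (\<integral>\<^sup>+x. ennreal (h l x) \<partial>s n) + ennreal (e / 2)"
        by (subst nn_integral_add) (auto simp: measurable_prob_measures[OF s_P] sn.emeasure_space_1)
      also have "\<dots> \<le> ennreal (e / 2) + ennreal (e / 2)"
        by (intro add_mono order_refl order_trans[OF s_h ennreal_leI[OF l(2)]])
      also have "\<dots> = ennreal e" using \<open>e > 0\<close> by (simp flip: ennreal_plus)
      finally show ?thesis using \<open>e > 0\<close> by (simp add: ennreal_le_iff)
    qed
    have "(\<lambda>n. \<integral>x. \<bar>?B x - c\<bar> \<partial>(s \<circ> r) n) \<longlonglongrightarrow> (\<integral>x. \<bar>?B x - c\<bar> \<partial>\<mu>)"
      using lim bc unfolding weak_lim_def by blast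
    then have "(\<integral>x. \<bar>?B x - c\<bar> \<partial>\<mu>) \<le> e"
    proof (rule LIMSEQ_le_const2)
      show "\<exists>M. \<forall>n\<ge>M. (\<integral>x. \<bar>?B x - c\<bar> \<partial>(s \<circ> r) n) \<le> e"
      proof (intro exI[of _ "Suc n0"] allI impI)
        fix n assume "Suc n0 \<le> n"
        then show "(\<integral>x. \<bar>?B x - c\<bar> \<partial>(s \<circ> r) n) \<le> e"
          using le[of "r n"] seq_suble[OF r, of n] by simp
      qed
    qed
    then show ?thesis using N(1) by blast
  qed
  have "emeasure \<mu> E = 0 \<or> emeasure \<mu> E = 1" if E: "E \<in> sets borel" "T -` E = E" for E
  proof (cases "emeasure \<mu> E = 0")
    case False
    then have Epos: "emeasure \<mu> E > 0" by (simp add: zero_less_iff_neq_zero)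
    then have p: "measure \<mu> E > 0" by (simp add: \<mu>.emeasure_eq_measure)
    \<comment> \<open>When an average of \<open>F k\<close> is close in mean to a constant
      \<open>c\<close>, the integral of \<open>F k\<close> over an invariant set is close to
      \<open>c\<close> times its mass. Comparing \<open>E\<close> with the whole space eliminates
      \<open>c\<close>.\<close>
    have indep: "(\<integral>x. indicator E x * F k x \<partial>\<mu>) = measure \<mu> E * (\<integral>x. F k x \<partial>\<mu>)" for k
    proof -
      have approx: "\<bar>(\<integral>x. indicator D x * F k x \<partial>\<mu>) - c * measure \<mu> D\<bar> \<le> e"
        if D: "D \<in> sets borel" "T -` D = D" and M: "M > 0" "(\<integral>x. \<bar>birkhoff_avg T M (F k) x - c\<bar> \<partial>\<mu>) \<le> e" for D M c e
      proof -
        note B_m [measurable] = birkhoff_avg_measurable[OF cont F_m[of k], of M]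
        have B_b: "0 \<le> birkhoff_avg T M (F k) x" "birkhoff_avg T M (F k) x \<le> 1" for x
          using birkhoff_avg_bounds[of "F k", OF F(2,3)] by auto
        have D\<mu>: "D \<in> sets \<mu>" using D \<mu>sets by simp
        have Dj: "indicat_real D ((T ^^ j) x) = indicat_real D x" for j x
        proof (induction j)
          case (Suc j)
          have "T y \<in> D \<longleftrightarrow> y \<in> D" for y using D(2) by blast
          then show ?case using Suc by (simp add: indicator_def)
        qed simp
        have "birkhoff_avg T M (\<lambda>x. indicator D x * F k x) x = indicator D x * birkhoff_avg T M (F k) x" for x
          unfolding birkhoff_avg_def Dj by (simp add: sum_distrib_left)
        moreover have "(\<integral>x. birkhoff_avg T M (\<lambda>x. indicator D x * F k x) x \<partial>\<mu>) = (\<integral>x. indicator D x * F k x \<partial>\<mu>)"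
          using D(1) F_m[of k] F(2,3)
          by (intro invariant_integral_birkhoff[OF \<mu>inv cont, where c=1] M(1)) (auto simp: indicator_def)
        ultimately have "(\<integral>x. indicator D x * F k x \<partial>\<mu>) = (\<integral>x. indicator D x * birkhoff_avg T M (F k) x \<partial>\<mu>)"
          by simp
        moreover have i1: "integrable \<mu> (\<lambda>x. indicator D x * birkhoff_avg T M (F k) x)"
          using D(1) B_b by (intro integrable_bounded_borel[OF \<mu>P, where c=1]) (auto simp: indicator_def)
        moreover have i2: "integrable \<mu> (\<lambda>x. indicator D x * c)"
          using D(1) by (intro integrable_bounded_borel[OF \<mu>P, where c="\<bar>c\<bar>"]) (auto simp: indicator_def)
        moreover have "(\<integral>x. indicator D x * c \<partial>\<mu>) = c * measure \<mu> D"
          using D\<mu> prob_measures_simps(3)[OF \<mu>P] by simp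
        ultimately have "(\<integral>x. indicator D x * F k x \<partial>\<mu>) - c * measure \<mu> D
            = (\<integral>x. indicator D x * birkhoff_avg T M (F k) x - indicator D x * c \<partial>\<mu>)"
          using Bochner_Integration.integral_diff[OF i1 i2] by linarith
        also have "\<bar>\<dots>\<bar> \<le> (\<integral>x. \<bar>indicator D x * birkhoff_avg T M (F k) x - indicator D x * c\<bar> \<partial>\<mu>)"
          by (rule integral_abs_bound)
        also have "\<dots> \<le> (\<integral>x. \<bar>birkhoff_avg T M (F k) x - c\<bar> \<partial>\<mu>)"
        proof (rule integral_mono)
          show "integrable \<mu> (\<lambda>x. \<bar>indicator D x * birkhoff_avg T M (F k) x - indicator D x * c\<bar>)"
            using i1 i2 by (intro integrable_abs Bochner_Integration.integrable_diff)
          show "integrable \<mu> (\<lambda>x. \<bar>birkhoff_avg T M (F k) x - c\<bar>)"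
          proof (rule integrable_bounded_borel[OF \<mu>P, where c="1 + \<bar>c\<bar>"])
            show "\<bar>\<bar>birkhoff_avg T M (F k) x - c\<bar>\<bar> \<le> 1 + \<bar>c\<bar>" for x using B_b[of x] by linarith
          qed simp
          show "\<bar>indicator D x * birkhoff_avg T M (F k) x - indicator D x * c\<bar> \<le> \<bar>birkhoff_avg T M (F k) x - c\<bar>" for x
            by (simp add: indicator_def)
        qed
        finally show ?thesis using M(2) by linarith
      qed
      have "\<bar>(\<integral>x. indicator E x * F k x \<partial>\<mu>) - measure \<mu> E * (\<integral>x. F k x \<partial>\<mu>)\<bar> \<le> 0 + e" if "e > 0" for e
      proof -
        obtain M c where M: "M > 0" "(\<integral>x. \<bar>birkhoff_avg T M (F k) x - c\<bar> \<partial>\<mu>) \<le> e / 2"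
          using near_const[of "e / 2" k] \<open>e > 0\<close> by auto
        have 1: "\<bar>(\<integral>x. indicator E x * F k x \<partial>\<mu>) - c * measure \<mu> E\<bar> \<le> e / 2"
          by (rule approx[OF E M])
        have "\<bar>(\<integral>x. indicator UNIV x * F k x \<partial>\<mu>) - c * measure \<mu> UNIV\<bar> \<le> e / 2"
          by (rule approx[OF _ _ M]) auto
        then have 2: "\<bar>(\<integral>x. F k x \<partial>\<mu>) - c\<bar> \<le> e / 2"
          using \<mu>.prob_space prob_measures_simps(3)[OF \<mu>P] by simp
        have "\<bar>measure \<mu> E * (\<integral>x. F k x \<partial>\<mu>) - c * measure \<mu> E\<bar> = measure \<mu> E * \<bar>(\<integral>x. F k x \<partial>\<mu>) - c\<bar>"
          unfolding mult.commute[of c] right_diff_distrib[symmetric] abs_mult by simp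
        also have "\<dots> \<le> 1 * (e / 2)" using 2 \<mu>.prob_le_1[of E] by (intro mult_mono) auto
        finally show ?thesis using 1 by linarith
      qed
      then have "\<bar>(\<integral>x. indicator E x * F k x \<partial>\<mu>) - measure \<mu> E * (\<integral>x. F k x \<partial>\<mu>)\<bar> \<le> 0"
        by (rule field_le_epsilon)
      then show ?thesis by simp
    qed
    have UP: "uniform_measure \<mu> E \<in> prob_measures" by (rule uniform_measure_prob[OF \<mu>P E(1) Epos])
    \<comment> \<open>By \<open>indep\<close> no test function detects the conditioning on
      \<open>E\<close>, so it changes nothing and \<open>E\<close> has mass 1.\<close>
    have "uniform_measure \<mu> E = \<mu>"
    proof (rule F_det)
      show "finite_measure (uniform_measure \<mu> E)" "sets (uniform_measure \<mu> E) = sets borel"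
        using UP by (auto simp: prob_measures_def intro: prob_space.finite_measure)
      show "finite_measure \<mu>" "sets \<mu> = sets borel" using \<mu>.finite_measure_axioms \<mu>sets by auto
      show "(\<integral>x. F k x \<partial>uniform_measure \<mu> E) = (\<integral>x. F k x \<partial>\<mu>)" for k
        using integral_uniform_measure[OF \<mu>P E(1) Epos F_m] indep p by simp
    qed
    then have "emeasure \<mu> E = 1"
      using emeasure_uniform_measure_1[of \<mu> E] Epos \<mu>.emeasure_finite[of E] by auto
    then show ?thesis by simp
  qed simp
  then have "ergodic_measure T \<mu>" using \<mu>inv by (simp add: ergodic_measure_def)
  then show thesis using that \<mu>S by blast
qed

section \<open>Operators on Polish topological vector spaces\<close>

lemma closure_of_meets:
  assumes "x \<in> X closure_of S" "openin X W" "x \<in> W"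
  obtains y where "y \<in> S" "y \<in> W"
  using assms unfolding in_closure_of by blast

lemma measure_inter_nonempty:
  assumes "m \<in> prob_measures" "A \<in> sets borel" "B \<in> sets borel" "1 < measure m A + measure m B"
  shows "A \<inter> B \<noteq> {}"
proof
  interpret prob_space m using prob_measures_simps[OF assms(1)] by simp
  assume "A \<inter> B = {}"
  then have "measure m (A \<union> B) = measure m A + measure m B"
    using assms prob_measures_simps(2)[OF assms(1)] by (intro finite_measure_Union) auto
  then show False using assms(4) prob_le_1[of "A \<union> B"] by simp
qed

text \<open>\<open>polish_space\<close> and \<open>real_vector\<close> are unrelated classes, so the
  continuity of the vector operations is an assumption here.\<close>

locale polish_operator =
  fixes T :: "'a::{polish_space, real_vector} \<Rightarrow> 'a"
  assumes add_cont: "continuous_on UNIV (\<lambda>(x::'a, y). x + y)"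
    and scale_cont: "continuous_on UNIV (\<lambda>(r::real, x::'a). r *\<^sub>R x)"
    and lin: "linear T"
    and cont: "continuous_on UNIV T"
begin

lemma continuous_on_add':
  fixes f g :: "'b::topological_space \<Rightarrow> 'a"
  assumes "continuous_on A f" "continuous_on A g"
  shows "continuous_on A (\<lambda>x. f x + g x)"
  using continuous_on_compose2[OF add_cont continuous_on_Pair[OF assms]] by simp

lemma continuous_on_scaleR':
  fixes f :: "'b::topological_space \<Rightarrow> real" and g :: "'b \<Rightarrow> 'a"
  assumes "continuous_on A f" "continuous_on A g"
  shows "continuous_on A (\<lambda>x. f x *\<^sub>R g x)"
  using continuous_on_compose2[OF scale_cont continuous_on_Pair[OF assms]] by simp

lemma continuous_on_diff':
  fixes f g :: "'b::topological_space \<Rightarrow> 'a"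
  assumes "continuous_on A f" "continuous_on A g"
  shows "continuous_on A (\<lambda>x. f x - g x)"
  using continuous_on_add'[OF assms(1) continuous_on_scaleR'[OF continuous_on_const[of _ "-1"] assms(2)]]
  by simp

lemma continuous_on_plus: "continuous_on A ((+) (x::'a))"
  using continuous_on_add'[OF continuous_on_const continuous_on_id, of A x] by simp

lemmas tvs_continuous_intros = continuous_on_add' continuous_on_scaleR' continuous_on_diff'
  continuous_on_const continuous_on_id continuous_on_fst continuous_on_snd

lemma open_translate: "open V \<Longrightarrow> open {x::'a. x - z \<in> V}"
  using open_vimage[of V "\<lambda>x. x - z"] continuous_on_diff'[OF continuous_on_id continuous_on_const]
  by (simp add: vimage_def)

lemma funpow_linear: "linear (T ^^ k)"
proof (induction k)
  case (Suc k)
  then show ?case using linear_compose[OF Suc lin] by (simp add: comp_def)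
qed (simp add: linear_id[unfolded id_def] id_def)

text \<open>Three summands, because the image under \<open>T ^^ k\<close> of a perturbed translate
  carries three errors: of the base point, of the perturbation, and of the point that is
  translated.\<close>

lemma nbhd_sum3:
  fixes u :: 'a
  assumes "open W" "u \<in> W"
  obtains V where "open V" "0 \<in> V" "\<And>a b c. a \<in> V \<Longrightarrow> b \<in> V \<Longrightarrow> c \<in> V \<Longrightarrow> u + a + b + c \<in> W"
proof -
  define S where "S = (\<lambda>p::'a \<times> 'a \<times> 'a. u + fst p + fst (snd p) + snd (snd p)) -` W"
  have "open S" unfolding S_def
    by (intro open_vimage assms tvs_continuous_intros)
  moreover have "(0, 0, 0) \<in> S" using assms by (simp add: S_def)
  ultimately obtain A B where AB: "open A" "open B" "(0, 0, 0) \<in> A \<times> B" "A \<times> B \<subseteq> S"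
    by (rule open_prod_elim)
  have "(0, 0) \<in> B" using AB by auto
  with AB(2) obtain C D where CD: "open C" "open D" "(0, 0) \<in> C \<times> D" "C \<times> D \<subseteq> B"
    by (rule open_prod_elim)
  show thesis
  proof (rule that[of "A \<inter> C \<inter> D"])
    show "u + a + b + c \<in> W" if "a \<in> A \<inter> C \<inter> D" "b \<in> A \<inter> C \<inter> D" "c \<in> A \<inter> C \<inter> D" for a b c
    proof -
      have "(a, b, c) \<in> S" using that AB(4) CD(4) by blast
      then show ?thesis by (simp add: S_def)
    qed
  qed (use AB CD in auto)
qed

text \<open>Plays the role of the distance to the complement, which says nothing about sums when the
  metric is not translation invariant. Continuity of addition at \<open>(z, 0)\<close> puts every
  \<open>z\<close> of \<open>W\<close> into some \<open>W' n\<close>.\<close>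

lemma open_exhaustion:
  fixes W :: "'a set"
  assumes "open W"
  obtains W' D where "\<And>n::nat. open (W' n)" "incseq W'" "(\<Union>n. W' n) = W"
    "\<And>n. open (D n)" "\<And>n. 0 \<in> D n" "\<And>n z d. z \<in> W' n \<Longrightarrow> d \<in> D n \<Longrightarrow> z + d \<in> W"
proof -
  define D where "D n = ball (0::'a) (inverse (real (Suc n)))" for n
  define W' where "W' n = \<Union>{G. open G \<and> (\<forall>z\<in>G. \<forall>d\<in>D n. z + d \<in> W)}" for n
  have D0: "0 \<in> D n" for n by (simp add: D_def)
  have Dmono: "D (Suc n) \<subseteq> D n" for n unfolding D_def by (intro subset_ball) (simp add: field_simps)
  have W'D: "z + d \<in> W" if "z \<in> W' n" "d \<in> D n" for z d n using that by (auto simp: W'_def)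
  have "W \<subseteq> (\<Union>n. W' n)"
  proof
    fix z assume "z \<in> W"
    define S where "S = (\<lambda>p::'a \<times> 'a. fst p + snd p) -` W"
    have "open S" unfolding S_def
      by (intro open_vimage assms tvs_continuous_intros)
    moreover have "(z, 0) \<in> S" using \<open>z \<in> W\<close> by (simp add: S_def)
    ultimately obtain A B where AB: "open A" "open B" "(z, 0) \<in> A \<times> B" "A \<times> B \<subseteq> S"
      by (rule open_prod_elim)
    have "0 \<in> B" using AB(3) by simp
    with AB(2) obtain e where e: "e > 0" "ball 0 e \<subseteq> B" by (meson openE)
    obtain n where "inverse (real (Suc n)) < e" using reals_Archimedean[OF e(1)] by blast
    then have "D n \<subseteq> B" using e(2) subset_ball[of "inverse (real (Suc n))" e 0] by (auto simp: D_def)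
    then have "(z, d) \<in> S" if "z \<in> A" "d \<in> D n" for z d using AB(4) that by blast
    then have "\<forall>z\<in>A. \<forall>d\<in>D n. z + d \<in> W" by (simp add: S_def)
    then have "z \<in> W' n" using AB(1,3) by (auto simp: W'_def)
    then show "z \<in> (\<Union>n. W' n)" by blast
  qed
  moreover have "W' n \<subseteq> W" for n using W'D[OF _ D0, of _ n] by auto
  ultimately have "(\<Union>n. W' n) = W" by blast
  moreover have "incseq W'"
  proof (rule incseq_SucI)
    show "W' n \<subseteq> W' (Suc n)" for n
      unfolding W'_def using Dmono[of n] by (intro Union_mono) blast
  qed
  moreover have "open (W' n)" for n unfolding W'_def by (intro open_Union) blast
  moreover have "open (D n)" for n by (simp add: D_def)
  ultimately show thesis using that[of W' D] D0 W'D by blast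
qed

text \<open>For a probability measure, one of these translates has positive mass and finitely many
  of them carry almost everything.\<close>

lemma translates_cover:
  fixes V :: "'a set"
  assumes "open V" "0 \<in> V"
  obtains z :: "nat \<Rightarrow> 'a" where "\<And>x. \<exists>a. x - z a \<in> V"
proof -
  obtain D :: "'a set" where D: "countable D" "\<And>X. open X \<Longrightarrow> X \<noteq> {} \<Longrightarrow> \<exists>d\<in>D. d \<in> X"
    using countable_dense_setE by blast
  have ne: "D \<noteq> {}" using D(2)[of UNIV] by auto
  show thesis
  proof (rule that)
    fix x
    have "open ((\<lambda>y. x - y) -` V)"
      by (intro open_vimage assms tvs_continuous_intros)
    moreover have "x \<in> (\<lambda>y. x - y) -` V" using assms by simp
    ultimately obtain y where "y \<in> D" "x - y \<in> V" using D(2)[of "(\<lambda>y. x - y) -` V"] by blast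
    then show "\<exists>a. x - from_nat_into D a \<in> V"
      using from_nat_into_surj[OF D(1)] by metis
  qed
qed

lemma borel_vimage_funpow: "A \<in> sets borel \<Longrightarrow> (T ^^ k) -` A \<in> sets borel"
  using measurable_sets_borel[OF borel_measurable_continuous_onI[OF continuous_on_funpow[OF cont]]] by blast

lemma distr_translate:
  fixes m :: "'a measure"
  assumes "m \<in> prob_measures"
  shows "distr m borel (\<lambda>y. x + y) \<in> prob_measures"
    and "W \<in> sets borel \<Longrightarrow> measure (distr m borel (\<lambda>y. x + y)) W = measure m {y. x + y \<in> W}"
    and "bcont f \<Longrightarrow> (\<integral>y. f y \<partial>distr m borel (\<lambda>y. x + y)) = (\<integral>y. f (x + y) \<partial>m)"
proof -
  have [measurable]: "(\<lambda>y. x + y) \<in> borel_measurable borel"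
    by (rule borel_measurable_continuous_onI[OF continuous_on_plus])
  show "distr m borel (\<lambda>y. x + y) \<in> prob_measures" by (intro distr_prob_measures assms) simp
  have m: "(\<lambda>y. x + y) \<in> measurable m borel" by (simp add: measurable_prob_measures[OF assms])
  show "measure (distr m borel (\<lambda>y. x + y)) W = measure m {y. x + y \<in> W}" if "W \<in> sets borel"
    using measure_distr[OF m that] prob_measures_simps(3)[OF assms] by (simp add: vimage_def)
  show "(\<integral>y. f y \<partial>distr m borel (\<lambda>y. x + y)) = (\<integral>y. f (x + y) \<partial>m)" if "bcont f"
    using bcont_measurable[OF that] by (intro integral_distr m)
qed

lemma bcont_translate_integral:
  fixes m :: "'a measure"
  assumes m: "m \<in> prob_measures" and f: "bcont f"
  shows "bcont (\<lambda>x. \<integral>y. f (x + y) \<partial>m)"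
proof -
  interpret prob_space m using prob_measures_simps[OF m] by simp
  obtain c where c: "c > 0" "\<And>x. \<bar>f x\<bar> \<le> c" using bcont_bound[OF f] by blast
  have f_cont: "continuous_on UNIV f" using f by (simp add: bcont_def)
  have bc: "bcont (\<lambda>y. f (x + y))" for x
    by (rule bcont_compose[OF f continuous_on_plus])
  have meas: "(\<lambda>y. f (x + y)) \<in> borel_measurable m" for x
    using bcont_measurable[OF bc] by (simp add: measurable_prob_measures[OF m])
  show ?thesis
  proof (rule bcontI)
    show "continuous_on UNIV (\<lambda>x. \<integral>y. f (x + y) \<partial>m)"
      unfolding continuous_on_sequentially
    proof (intro ballI allI impI)
      fix X :: "nat \<Rightarrow> 'a" and x assume "(\<forall>n. X n \<in> UNIV) \<and> X \<longlonglongrightarrow> x"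
      then have X: "X \<longlonglongrightarrow> x" by simp
      show "((\<lambda>x. \<integral>y. f (x + y) \<partial>m) \<circ> X) \<longlonglongrightarrow> (\<integral>y. f (x + y) \<partial>m)"
        unfolding comp_def
      proof (rule integral_dominated_convergence[where w="\<lambda>_. c"])
        show "AE y in m. (\<lambda>n. f (X n + y)) \<longlonglongrightarrow> f (x + y)"
        proof (rule AE_I2)
          fix y
          have "continuous_on UNIV (\<lambda>x. f (x + y))"
            using bcont_compose[OF f, of "\<lambda>x. x + y"] continuous_on_add'[OF continuous_on_id continuous_on_const]
            by (simp add: bcont_def)
          from continuous_on_tendsto_compose[OF this X] show "(\<lambda>n. f (X n + y)) \<longlonglongrightarrow> f (x + y)" by simp
        qed
      qed (use c meas in auto)
    qed
    show "\<bar>\<integral>y. f (x + y) \<partial>m\<bar> \<le> c" for x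
    proof -
      have "\<bar>\<integral>y. f (x + y) \<partial>m\<bar> \<le> (\<integral>y. \<bar>f (x + y)\<bar> \<partial>m)" by (rule integral_abs_bound)
      also have "\<dots> \<le> (\<integral>y. c \<partial>m)"
        using c integrable_bcont[OF m bc] by (intro integral_mono integrable_abs) auto
      finally show ?thesis by (simp add: prob_space)
    qed
  qed
qed

text \<open>The mass of \<open>W - x\<close> is a supremum of integrals that depend continuously on
  \<open>x\<close>, hence lower semicontinuous in \<open>x\<close>.\<close>

lemma open_translate_measure_gt:
  fixes m :: "'a measure"
  assumes m: "m \<in> prob_measures" and W: "open W"
  shows "open {x. c < measure m {y. x + y \<in> W}}"
proof -
  obtain f :: "nat \<Rightarrow> 'a \<Rightarrow> real" where f: "\<And>i. bcont (f i)"
    "\<And>(m :: 'a measure) c. m \<in> prob_measures \<Longrightarrow> c < measure m W \<longleftrightarrow> (\<exists>i. c < (\<integral>x. f i x \<partial>m))"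
    using measure_open_approx[OF W] by metis
  have "{x. c < measure m {y. x + y \<in> W}} = (\<Union>i. (\<lambda>x. \<integral>y. f i (x + y) \<partial>m) -` {c<..})"
  proof -
    have "c < measure m {y. x + y \<in> W} \<longleftrightarrow> (\<exists>i. c < (\<integral>y. f i (x + y) \<partial>m))" for x
      using f(2)[OF distr_translate(1)[OF m, of x], of c] distr_translate(2)[OF m, of W x]
        distr_translate(3)[OF m f(1), of x] W by simp
    then show ?thesis by auto
  qed
  moreover have "open ((\<lambda>x. \<integral>y. f i (x + y) \<partial>m) -` {c<..})" for i
    using bcont_translate_integral[OF m f(1)] by (intro open_vimage) (auto simp: bcont_def)
  ultimately show ?thesis by auto
qed

text \<open>If \<open>T x + T y\<close> is in \<open>W\<close>, so is \<open>x + y\<close> by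
  linearity. Invariance allows \<open>T y\<close> for \<open>y\<close>, so passing from
  \<open>x\<close> to \<open>T x\<close> cannot increase the mass.\<close>

lemma translate_measure_in_O_T:
  assumes m: "invariant_measure T m" and W: "W \<in> O_T T" and x: "c < measure m {y. x + y \<in> W}"
  shows "{x. c < measure m {y. x + y \<in> W}} \<in> O_T T"
proof -
  have mP: "m \<in> prob_measures" using m by (simp add: invariant_measure_def)
  have Wo: "open W" using W by (simp add: O_T_def)
  interpret prob_space m using prob_measures_simps[OF mP] by simp
  have openW: "open {y. x + y \<in> W}" for x
    using open_vimage[OF Wo continuous_on_plus] by (simp add: vimage_def)
  have "measure m {y. T x + y \<in> W} \<le> measure m {y. x + y \<in> W}" for x
  proof -
    have "measure m {y. T x + y \<in> W} = measure m ((T ^^ 1) -` {y. T x + y \<in> W})"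
      using invariant_measure_funpow[OF m cont, of "{y. T x + y \<in> W}" 1] openW by simp
    also have "\<dots> \<le> measure m {y. x + y \<in> W}"
    proof (rule finite_measure_mono)
      show "(T ^^ 1) -` {y. T x + y \<in> W} \<subseteq> {y. x + y \<in> W}"
        using W linear_add[OF lin, symmetric] by (auto simp: O_T_def)
    qed (use openW prob_measures_simps(2)[OF mP] in auto)
    finally show ?thesis .
  qed
  then have "T -` {x. c < measure m {y. x + y \<in> W}} \<subseteq> {x. c < measure m {y. x + y \<in> W}}"
    by (auto intro: less_le_trans)
  then show ?thesis using open_translate_measure_gt[OF mP Wo, of c] x by (auto simp: O_T_def)
qed

section \<open>Transitivity derived from condition (3)\<close>

text \<open>Condition (3) of the theorem.\<close>

definition null_accessible :: "'a measure set \<Rightarrow> bool" where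
  "null_accessible \<M> \<longleftrightarrow> (\<forall>\<Omega>\<in>O_T T. return borel 0 \<in> weak_topology closure_of (mclosure_on \<M> \<Omega>))"

lemma mclosure_invariant:
  assumes "adequate T \<M>"
  shows "mclosure \<M> \<subseteq> invariant_measures T"
  unfolding mclosure_def
  using assms closedin_invariant_measures[OF cont] by (intro closure_of_minimal) (auto simp: adequate_def)

lemma mclosure_prob: "mclosure \<M> \<subseteq> prob_measures"
  unfolding mclosure_def using closure_of_subset_topspace[of weak_topology \<M>] by simp

lemma null_accessible_measure:
  assumes "null_accessible \<M>" "\<Omega> \<in> O_T T" "open D" "0 \<in> D" "c < 1"
  obtains m where "m \<in> mclosure \<M>" "m \<in> prob_measures" "measure m \<Omega> = 1" "c < measure m D"
proof -
  have "return borel 0 \<in> weak_topology closure_of (mclosure_on \<M> \<Omega>)"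
    using assms by (auto simp: null_accessible_def)
  moreover have "return borel 0 \<in> {\<mu> \<in> prob_measures. c < measure \<mu> D}"
    using assms return_prob_measures[of "0::'a"] by (simp add: measure_return)
  ultimately obtain m where m: "m \<in> mclosure_on \<M> \<Omega>" "m \<in> {\<mu> \<in> prob_measures. c < measure \<mu> D}"
    by (rule closure_of_meets[OF _ openin_weak_measure_gt[OF assms(3), of c]])
  then show thesis by (intro that[of m]) (auto simp: mclosure_on_def measure_def)
qed

text \<open>A measure carried by \<open>hits T W\<close> that charges the neighbourhood
  \<open>D\<close> of 0 forces the two sets to meet.\<close>

lemma null_accessible_hits:
  assumes "null_accessible \<M>" "open W" "W \<noteq> {}" "open D" "0 \<in> D"
  obtains d k where "d \<in> D" "(T ^^ k) d \<in> W"
proof -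
  obtain m where m: "m \<in> prob_measures" "measure m (hits T W) = 1" "0 < measure m D"
    using null_accessible_measure[OF assms(1) hits_in_O_T[OF cont assms(2,3)] assms(4,5), of 0] by auto
  have "hits T W \<inter> D \<noteq> {}"
    using m open_hits[OF cont assms(2)] assms(4) by (intro measure_inter_nonempty[OF m(1)]) auto
  then show thesis using that by (auto simp: hits_def)
qed

text \<open>Only nonemptiness is at stake. A measure carried by \<open>\<Omega>1\<close> charges a
  small translate \<open>S a\<close> around \<open>z a\<close>. Take a small \<open>d\<close> with
  \<open>(T ^^ k) d\<close> near \<open>u - z a\<close>; then some \<open>x\<close> well inside
  \<open>\<Omega>1\<close> has its \<open>k\<close>-th iterate near \<open>z a\<close>. The vector
  \<open>x + d\<close> is still in \<open>\<Omega>1\<close>, and its \<open>k\<close>-th iterate is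
  near \<open>u\<close>, inside \<open>\<Omega>2\<close>.\<close>

lemma O_T_Int:
  assumes ad: "adequate T \<M>" and na: "null_accessible \<M>" and O1: "\<Omega>1 \<in> O_T T" and O2: "\<Omega>2 \<in> O_T T"
  shows "\<Omega>1 \<inter> \<Omega>2 \<in> O_T T"
proof -
  have o: "open \<Omega>1" "open \<Omega>2" using O1 O2 by (auto simp: O_T_def)
  obtain m where mM: "m \<in> mclosure \<M>" and m: "m \<in> prob_measures" "measure m \<Omega>1 = 1"
    by (rule null_accessible_measure[OF na O1 open_UNIV UNIV_I, of 0]) auto
  interpret prob_space m using prob_measures_simps[OF m(1)] by simp
  note sets = prob_measures_simps(2)[OF m(1)]
  have inv: "invariant_measure T m" using mM mclosure_invariant[OF ad] by (auto simp: invariant_measures_def)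
  obtain u where "u \<in> \<Omega>2" using O2 by (auto simp: O_T_def)
  then obtain V where V: "open V" "0 \<in> V"
      "\<And>a b c. a \<in> V \<Longrightarrow> b \<in> V \<Longrightarrow> c \<in> V \<Longrightarrow> u + a + b + c \<in> \<Omega>2"
    using nbhd_sum3[OF o(2)] by metis
  obtain z :: "nat \<Rightarrow> 'a" where z: "\<And>x. \<exists>a. x - z a \<in> V" using translates_cover[OF V(1,2)] by metis
  define S where "S a = {x. x - z a \<in> V}" for a
  have openS: "open (S a)" for a unfolding S_def by (rule open_translate[OF V(1)])
  have "(\<Union>a. S a) = UNIV" using z by (auto simp: S_def)
  obtain a where a: "measure m (S a) > 0"
  proof (rule ccontr)
    assume "\<not> thesis"
    then have "measure m (S a) = 0" for a using that[of a] measure_nonneg[of m "S a"] by linarith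
    then have "emeasure m (S a) = 0" for a by (simp add: emeasure_eq_measure)
    then have "emeasure m (\<Union>a. S a) = 0" using openS sets by (intro emeasure_UN_eq_0) auto
    then show False
      using \<open>(\<Union>a. S a) = UNIV\<close> emeasure_space_1 prob_measures_simps(3)[OF m(1)] by simp
  qed
  obtain W D where W: "\<And>n::nat. open (W n)" "incseq W" "(\<Union>n. W n) = \<Omega>1"
    "\<And>n. open (D n)" "\<And>n. 0 \<in> D n" "\<And>n z d. z \<in> W n \<Longrightarrow> d \<in> D n \<Longrightarrow> z + d \<in> \<Omega>1"
    using open_exhaustion[OF o(1)] by (metis (no_types, lifting))
  have "(\<lambda>n. measure m (W n)) \<longlonglongrightarrow> measure m (\<Union>n. W n)"
    using W sets by (intro finite_Lim_measure_incseq) auto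
  then have "(\<lambda>n. measure m (W n)) \<longlonglongrightarrow> 1" using W(3) m(2) by simp
  \<comment> \<open>\<open>W n\<close> shall miss less mass than \<open>S a\<close> has, so that it
    meets the preimages of \<open>S a\<close> at all times, also at the \<open>k\<close> that is
    found only later.\<close>
  then have "eventually (\<lambda>n. 1 - measure m (S a) < measure m (W n)) sequentially"
    by (rule order_tendstoD(1)) (use a in simp)
  then obtain n where n: "1 - measure m (S a) < measure m (W n)"
    using eventually_happens'[OF sequentially_bot] by blast
  have "(u - z a) \<in> {w. w - (u - z a) \<in> V}" using V(2) by simp
  then have "{w. w - (u - z a) \<in> V} \<noteq> {}" by blast
  from null_accessible_hits[OF na open_translate[OF V(1)] this W(4,5)]
  obtain d k where dk: "d \<in> D n" "(T ^^ k) d - (u - z a) \<in> V" by auto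
  have "measure m ((T ^^ k) -` S a) = measure m (S a)"
    by (rule invariant_measure_funpow[OF inv cont]) (use openS in auto)
  then have "W n \<inter> (T ^^ k) -` S a \<noteq> {}"
    using n W(1) openS by (intro measure_inter_nonempty[OF m(1)] borel_vimage_funpow) auto
  then obtain x where x: "x \<in> W n" "(T ^^ k) x - z a \<in> V" by (auto simp: S_def)
  have 1: "x + d \<in> \<Omega>1" using W(6) x dk by blast
  have "(T ^^ k) (x + d) = u + ((T ^^ k) x - z a) + ((T ^^ k) d - (u - z a)) + 0"
    using linear_add[OF funpow_linear] by simp
  then have "(T ^^ k) (x + d) \<in> \<Omega>2" using V(3)[OF x(2) dk(2) V(2)] by simp
  then have "x + d \<in> \<Omega>2" by (rule O_T_funpow[OF O2])
  then show ?thesis using 1 o O1 O2 by (auto simp: O_T_def)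
qed

text \<open>A vector \<open>w\<close> common to all \<open>hits T (W i)\<close> reaches the targets
  at different times \<open>j i\<close>. As iterates commute, one small \<open>d\<close> with
  \<open>(T ^^ k) d\<close> near \<open>w\<close> provides the vectors \<open>(T ^^ j i) d\<close>,
  which share the time \<open>k\<close>.\<close>

lemma simultaneous_hits:
  assumes ad: "adequate T \<M>" and na: "null_accessible \<M>" and D: "open D" "0 \<in> D"
    and I: "finite I" and W: "\<And>i. i \<in> I \<Longrightarrow> open (W i)" "\<And>i. i \<in> I \<Longrightarrow> W i \<noteq> {}"
  obtains k d where "\<And>i. i \<in> I \<Longrightarrow> d i \<in> D" "\<And>i. i \<in> I \<Longrightarrow> (T ^^ k) (d i) \<in> W i"
proof -
  have "(\<Inter>i\<in>I. hits T (W i)) \<in> O_T T"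
    using I W
  proof (induction I)
    case empty
    then show ?case by (simp add: O_T_def)
  next
    case (insert i I)
    have "hits T (W i) \<inter> (\<Inter>i\<in>I. hits T (W i)) \<in> O_T T"
      by (intro O_T_Int[OF ad na] hits_in_O_T[OF cont] insert.IH insert.prems) auto
    then show ?case by simp
  qed
  then obtain w where "\<And>i. i \<in> I \<Longrightarrow> w \<in> hits T (W i)" by (auto simp: O_T_def)
  then have "\<forall>i\<in>I. \<exists>j. (T ^^ j) w \<in> W i" by (auto simp: hits_def)
  then obtain j where j: "\<And>i. i \<in> I \<Longrightarrow> (T ^^ j i) w \<in> W i" by metis
  define N where "N = (\<Inter>i\<in>I. (T ^^ j i) -` W i)"
  define E where "E = (\<Inter>i\<in>I. (T ^^ j i) -` D)"
  have "open N" unfolding N_def using I W by (intro open_INT ballI open_vimage continuous_on_funpow cont) auto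
  moreover have "N \<noteq> {}" using j by (auto simp: N_def)
  moreover have "open E" unfolding E_def using I D by (intro open_INT ballI open_vimage continuous_on_funpow cont) auto
  moreover have "0 \<in> E" using D linear_0[OF funpow_linear] by (auto simp: E_def)
  ultimately obtain d k where d: "d \<in> E" "(T ^^ k) d \<in> N" by (rule null_accessible_hits[OF na])
  have "(T ^^ k) ((T ^^ j i) d) \<in> W i" if "i \<in> I" for i
  proof -
    have "(T ^^ j i) ((T ^^ k) d) \<in> W i" using d(2) that by (auto simp: N_def)
    then show ?thesis by (metis add.commute comp_apply funpow_add)
  qed
  then show thesis using that[of "\<lambda>i. (T ^^ j i) d" k] d(1) by (auto simp: E_def)
qed

text \<open>The supremum \<open>\<alpha>\<close> of the masses that \<open>\<mu>\<close> gives to translates of \<open>W\<close> is 1: otherwise a nearly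
  optimal translate \<open>x\<^sub>0\<close> with \<open>T\<^sup>k x\<^sub>0\<close> near 0 can be perturbed by a small vector whose image
  under \<open>T\<^sup>k\<close> sends a fixed proportion of the remaining mass into \<open>W\<close>. That proportion depends only
  on how many small translates are needed to carry most of \<open>\<mu>\<close>, not on \<open>x\<^sub>0\<close>.\<close>

lemma translate_measure_near_1:
  assumes ad: "adequate T \<M>" and na: "null_accessible \<M>" and \<mu>: "invariant_measure T \<mu>"
    and W: "W \<in> O_T T" and c: "c < 1"
  shows "\<exists>x. c < measure \<mu> {y. x + y \<in> W}"
proof (rule ccontr)
  assume no: "\<not> ?thesis"
  have \<mu>P: "\<mu> \<in> prob_measures" using \<mu> by (simp add: invariant_measure_def)
  interpret prob_space \<mu> using prob_measures_simps[OF \<mu>P] by simp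
  note sets = prob_measures_simps(2)[OF \<mu>P] and space = prob_measures_simps(3)[OF \<mu>P]
  have Wo: "open W" using W by (simp add: O_T_def)
  define \<phi> where "\<phi> A x = measure \<mu> {y. x + y \<in> A}" for A and x :: 'a
  have meas: "{y. x + y \<in> A} \<in> sets borel" if "open A" for A and x :: 'a
    using open_vimage[OF that continuous_on_plus] by (auto simp: vimage_def)
  define \<alpha> where "\<alpha> = (SUP x. \<phi> W x)"
  have bdd: "bdd_above (range (\<phi> W))" by (intro bdd_aboveI[of _ 1]) (auto simp: \<phi>_def)
  have le_\<alpha>: "\<phi> W x \<le> \<alpha>" for x unfolding \<alpha>_def by (rule cSUP_upper[OF UNIV_I bdd])
  have "\<alpha> \<le> c" unfolding \<alpha>_def using no by (intro cSUP_least) (auto simp: \<phi>_def not_less)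
  then have \<alpha>: "\<alpha> < 1" using c by simp
  obtain u where "u \<in> W" using W by (auto simp: O_T_def)
  then obtain V where V: "open V" "0 \<in> V"
      "\<And>a b c. a \<in> V \<Longrightarrow> b \<in> V \<Longrightarrow> c \<in> V \<Longrightarrow> u + a + b + c \<in> W"
    using nbhd_sum3[OF Wo] by metis
  obtain z :: "nat \<Rightarrow> 'a" where z: "\<And>x. \<exists>a. x - z a \<in> V" using translates_cover[OF V(1,2)] by metis
  define S where "S a = {x. x - z a \<in> V}" for a
  have openS: "open (S a)" for a unfolding S_def by (rule open_translate[OF V(1)])
  have "(\<Union>n. \<Union>a<n. S a) = UNIV" using z by (auto simp: S_def)
  moreover have "(\<lambda>n. measure \<mu> (\<Union>a<n. S a)) \<longlonglongrightarrow> measure \<mu> (\<Union>n. \<Union>a<n. S a)"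
    using openS sets
    by (intro finite_Lim_measure_incseq incseq_SucI UN_mono) (auto intro!: borel_open)
  ultimately have "(\<lambda>n. measure \<mu> (\<Union>a<n. S a)) \<longlonglongrightarrow> 1" using prob_space space by simp
  then have "eventually (\<lambda>n. 1 - (1 - \<alpha>) / 2 < measure \<mu> (\<Union>a<n. S a)) sequentially"
    by (rule order_tendstoD(1)) (use \<alpha> in simp)
  then obtain N where N: "1 - (1 - \<alpha>) / 2 < measure \<mu> (\<Union>a<N. S a)"
    using eventually_happens'[OF sequentially_bot] by blast
  have "N > 0"
  proof (rule ccontr)
    assume "\<not> N > 0"
    then have "1 - (1 - \<alpha>) / 2 < 0" using N by simp
    moreover have "0 \<le> \<alpha>" using le_\<alpha>[of 0] by (auto simp: \<phi>_def intro: order_trans[OF measure_nonneg])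
    ultimately show False by simp
  qed
  \<comment> \<open>The \<open>N\<close> translates carry more than
    \<open>1 - (1 - \<alpha>) / 2\<close>, so a set of mass at most \<alpha> leaves more than
    \<open>(1 - \<alpha>) / 2\<close> of it outside, and one translate contributes at least
    \<open>\<eta>\<close>.\<close>
  define \<eta> where "\<eta> = (1 - \<alpha>) / (2 * real N)"
  have \<eta>: "\<eta> > 0" using \<alpha> \<open>N > 0\<close> by (simp add: \<eta>_def)
  obtain x1 where "\<alpha> - \<eta> < \<phi> W x1"
    using less_cSUP_iff[OF UNIV_not_empty bdd, of "\<alpha> - \<eta>"] \<eta> unfolding \<alpha>_def by auto
  then have \<Omega>: "{x. \<alpha> - \<eta> < \<phi> W x} \<in> O_T T"
    unfolding \<phi>_def by (rule translate_measure_in_O_T[OF \<mu> W])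
  obtain W' D where W': "\<And>n::nat. open (W' n)" "incseq W'" "(\<Union>n. W' n) = W"
    "\<And>n. open (D n)" "\<And>n. 0 \<in> D n" "\<And>n z d. z \<in> W' n \<Longrightarrow> d \<in> D n \<Longrightarrow> z + d \<in> W"
    using open_exhaustion[OF Wo] by (metis (no_types, lifting))
  obtain \<theta> where \<theta>M: "\<theta> \<in> mclosure \<M>" and \<theta>: "\<theta> \<in> prob_measures"
      "measure \<theta> {x. \<alpha> - \<eta> < \<phi> W x} = 1" "1/2 < measure \<theta> V"
    by (rule null_accessible_measure[OF na \<Omega> V(1,2), of "1/2"]) auto
  interpret \<theta>: prob_space \<theta> using prob_measures_simps[OF \<theta>(1)] by simp
  have \<theta>inv: "invariant_measure T \<theta>"
    using \<theta>M mclosure_invariant[OF ad] by (auto simp: invariant_measures_def)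
  \<comment> \<open>The base point has to be nearly optimal already for some \<open>W' n\<close>, so
    that its perturbation by an element of \<open>D n\<close> loses nothing. The masses of these
    sets increase to 1.\<close>
  define \<Omega>' where "\<Omega>' n = {x. \<alpha> - \<eta> < \<phi> (W' n) x}" for n
  have open\<Omega>': "open (\<Omega>' n)" for n
    unfolding \<Omega>'_def \<phi>_def by (rule open_translate_measure_gt[OF \<mu>P W'(1)])
  have lim\<phi>: "(\<lambda>n. \<phi> (W' n) x) \<longlonglongrightarrow> \<phi> W x" and mono\<phi>: "incseq (\<lambda>n. \<phi> (W' n) x)" for x
  proof -
    have "(\<lambda>n. measure \<mu> {y. x + y \<in> W' n}) \<longlonglongrightarrow> measure \<mu> (\<Union>n. {y. x + y \<in> W' n})"
      using meas[OF W'(1)] incseqD[OF W'(2)] sets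
      by (intro finite_Lim_measure_incseq) (auto intro!: incseq_SucI dest: incseq_SucD[OF W'(2), THEN subsetD])
    moreover have "(\<Union>n. {y. x + y \<in> W' n}) = {y. x + y \<in> W}" using W'(3) by blast
    ultimately show "(\<lambda>n. \<phi> (W' n) x) \<longlonglongrightarrow> \<phi> W x" by (simp add: \<phi>_def)
    show "incseq (\<lambda>n. \<phi> (W' n) x)"
      unfolding \<phi>_def using meas[OF W'(1)] sets
      by (intro incseq_SucI finite_measure_mono) (auto dest: incseq_SucD[OF W'(2), THEN subsetD])
  qed
  have \<phi>_le: "\<phi> (W' n) x \<le> \<phi> W x" for n x by (rule incseq_le[OF mono\<phi> lim\<phi>])
  have "(\<Union>n. \<Omega>' n) = {x. \<alpha> - \<eta> < \<phi> W x}"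
  proof -
    have "(\<exists>n. \<alpha> - \<eta> < \<phi> (W' n) x) \<longleftrightarrow> \<alpha> - \<eta> < \<phi> W x" for x
    proof
      assume "\<exists>n. \<alpha> - \<eta> < \<phi> (W' n) x"
      then show "\<alpha> - \<eta> < \<phi> W x" using \<phi>_le[of _ x] less_le_trans by blast
    next
      assume "\<alpha> - \<eta> < \<phi> W x"
      from order_tendstoD(1)[OF lim\<phi> this] show "\<exists>n. \<alpha> - \<eta> < \<phi> (W' n) x"
        using eventually_happens'[OF sequentially_bot] by blast
    qed
    then show ?thesis by (auto simp: \<Omega>'_def)
  qed
  moreover have "(\<lambda>n. measure \<theta> (\<Omega>' n)) \<longlonglongrightarrow> measure \<theta> (\<Union>n. \<Omega>' n)"
  proof (rule \<theta>.finite_Lim_measure_incseq)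
    show "range \<Omega>' \<subseteq> sets \<theta>" using open\<Omega>' prob_measures_simps(2)[OF \<theta>(1)] by auto
    show "incseq \<Omega>'"
    proof (rule incseq_SucI)
      show "\<Omega>' n \<subseteq> \<Omega>' (Suc n)" for n
        unfolding \<Omega>'_def using incseq_SucD[OF mono\<phi>, of n] by (auto intro: less_le_trans)
    qed
  qed
  ultimately have "(\<lambda>n. measure \<theta> (\<Omega>' n)) \<longlonglongrightarrow> 1" using \<theta>(2) by simp
  then have "eventually (\<lambda>n. 1/2 < measure \<theta> (\<Omega>' n)) sequentially"
    by (rule order_tendstoD(1)) simp
  then obtain n where n: "1/2 < measure \<theta> (\<Omega>' n)"
    using eventually_happens'[OF sequentially_bot] by blast
  \<comment> \<open>The perturbations for all \<open>N\<close> translates are prepared with one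
    common \<open>k\<close>, because the translate that will gain mass is known only once
    \<open>x0\<close> is.\<close>
  obtain k d where d: "\<And>a. a \<in> {..<N} \<Longrightarrow> d a \<in> D n"
      "\<And>a. a \<in> {..<N} \<Longrightarrow> (T ^^ k) (d a) \<in> {w. w - (u - z a) \<in> V}"
  proof (rule simultaneous_hits[OF ad na W'(4,5), of "{..<N}" "\<lambda>a. {w. w - (u - z a) \<in> V}" n])
    show "{w. w - (u - z a) \<in> V} \<noteq> {}" for a
    proof -
      have "(u - z a) \<in> {w. w - (u - z a) \<in> V}" using V(2) by simp
      then show ?thesis by blast
    qed
  qed (auto intro: open_translate[OF V(1)])
  \<comment> \<open>Both this preimage and \<open>\<Omega>' n\<close> have mass above 1/2, so they
    share a point.\<close>
  have "measure \<theta> ((T ^^ k) -` V) = measure \<theta> V"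
    by (rule invariant_measure_funpow[OF \<theta>inv cont]) (use V in auto)
  then have "\<Omega>' n \<inter> (T ^^ k) -` V \<noteq> {}"
    using n open\<Omega>' V(1) \<theta>(3) by (intro measure_inter_nonempty[OF \<theta>(1)] borel_vimage_funpow) auto
  then obtain x0 where x0: "\<alpha> - \<eta> < \<phi> (W' n) x0" "(T ^^ k) x0 \<in> V" by (auto simp: \<Omega>'_def)
  define A where "A = {y. x0 + y \<in> W' n}"
  define S' where "S' a = (T ^^ k) -` S a" for a
  have AS [measurable]: "A \<in> sets \<mu>" using meas[OF W'(1)] sets by (simp add: A_def)
  have S'S [measurable]: "S' a \<in> sets \<mu>" for a
    unfolding S'_def using borel_vimage_funpow openS sets by auto
  have \<mu>A: "\<alpha> - \<eta> < measure \<mu> A" using x0(1) by (simp add: \<phi>_def A_def)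
  have "measure \<mu> A \<le> \<alpha>"
    using \<phi>_le[of n x0] le_\<alpha>[of x0] by (simp add: \<phi>_def A_def)
  have "measure \<mu> (\<Union>a<N. S' a) = measure \<mu> ((T ^^ k) -` (\<Union>a<N. S a))"
    unfolding S'_def by (simp add: vimage_UN)
  also have "\<dots> = measure \<mu> (\<Union>a<N. S a)"
    by (rule invariant_measure_funpow[OF \<mu> cont]) (use openS in \<open>auto intro!: borel_open\<close>)
  finally have "1 - (1 - \<alpha>) / 2 < measure \<mu> (\<Union>a<N. S' a)" using N by simp
  also have "\<dots> \<le> measure \<mu> (A \<union> (\<Union>a<N. S' a - A))"
    by (rule finite_measure_mono) (auto intro!: sets.finite_UN sets.Un sets.Diff AS S'S)
  also have "\<dots> \<le> measure \<mu> A + measure \<mu> (\<Union>a<N. S' a - A)"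
    by (rule measure_Un_le) (auto intro!: sets.finite_UN sets.Diff AS S'S)
  also have "measure \<mu> (\<Union>a<N. S' a - A) \<le> (\<Sum>a<N. measure \<mu> (S' a - A))"
    by (rule measure_UNION_le) (auto intro!: sets.Diff AS S'S)
  finally have sum: "(1 - \<alpha>) / 2 < (\<Sum>a<N. measure \<mu> (S' a - A))"
    using \<open>measure \<mu> A \<le> \<alpha>\<close> by (simp add: field_simps)
  have "\<exists>a<N. \<eta> \<le> measure \<mu> (S' a - A)"
  proof (rule ccontr)
    assume "\<not> ?thesis"
    then have "(\<Sum>a<N. measure \<mu> (S' a - A)) \<le> (\<Sum>a<N. \<eta>)" by (intro sum_mono) (auto simp: not_le)
    also have "\<dots> = (1 - \<alpha>) / 2" using \<open>N > 0\<close> by (simp add: \<eta>_def)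
    finally show False using sum by simp
  qed
  then obtain a where a: "a < N" "\<eta> \<le> measure \<mu> (S' a - A)" by blast
  have "A \<union> (S' a - A) \<subseteq> {y. (x0 + d a) + y \<in> W}"
  proof (intro Un_least subsetI)
    fix y assume "y \<in> A"
    then have "(x0 + y) + d a \<in> W" using W'(6) d(1)[of a] a(1) by (auto simp: A_def)
    then show "y \<in> {y. (x0 + d a) + y \<in> W}" by (simp add: ac_simps)
  next
    fix y assume "y \<in> S' a - A"
    then have y: "(T ^^ k) y - z a \<in> V" by (simp add: S'_def S_def)
    have "(T ^^ k) (x0 + d a + y) = u + (T ^^ k) x0 + ((T ^^ k) (d a) - (u - z a)) + ((T ^^ k) y - z a)"
      by (simp add: linear_add[OF funpow_linear])
    moreover have "(T ^^ k) (d a) - (u - z a) \<in> V" using d(2)[of a] a(1) by simp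
    ultimately have "(T ^^ k) (x0 + d a + y) \<in> W" using V(3)[OF x0(2) _ y] by metis
    then show "y \<in> {y. (x0 + d a) + y \<in> W}" using O_T_funpow[OF W] by blast
  qed
  then have "measure \<mu> (A \<union> (S' a - A)) \<le> \<phi> W (x0 + d a)"
    unfolding \<phi>_def using meas[OF Wo] sets by (intro finite_measure_mono) auto
  moreover have "measure \<mu> (A \<union> (S' a - A)) = measure \<mu> A + measure \<mu> (S' a - A)"
    by (rule finite_measure_Union) (auto intro!: sets.Diff AS S'S)
  ultimately show False using le_\<alpha>[of "x0 + d a"] \<mu>A a(2) by linarith
qed

section \<open>Convolution and density in the closure\<close>

lemma measurable_add_pair:
  "(\<lambda>(x::'a, y). x + y) \<in> measurable (borel \<Otimes>\<^sub>M borel) borel"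
  using borel_measurable_continuous_onI[OF add_cont] by (simp add: borel_prod)

text \<open>The third claim is Tonelli's theorem: the mass of \<open>W\<close> is the
  \<open>\<nu>\<close>-integral of the masses of its translates, bounded below by the part over
  \<open>\<Omega>\<close>.\<close>

lemma
  fixes \<mu> \<nu> :: "'a measure"
  assumes \<nu>: "\<nu> \<in> prob_measures" and \<mu>: "\<mu> \<in> prob_measures"
  shows convolution_prob: "convolution \<nu> \<mu> \<in> prob_measures"
    and convolution_integral: "bcont f \<Longrightarrow> (\<integral>z. f z \<partial>convolution \<nu> \<mu>) = (\<integral>x. (\<integral>y. f (x + y) \<partial>\<mu>) \<partial>\<nu>)"
    and convolution_measure: "open W \<Longrightarrow> c \<ge> 0 \<Longrightarrow> \<Omega> \<in> sets borel \<Longrightarrow>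
      (\<And>x. x \<in> \<Omega> \<Longrightarrow> c \<le> measure \<mu> {y. x + y \<in> W}) \<Longrightarrow> c * measure \<nu> \<Omega> \<le> measure (convolution \<nu> \<mu>) W"
proof -
  interpret N: prob_space \<nu> using prob_measures_simps[OF \<nu>] by simp
  interpret M: prob_space \<mu> using prob_measures_simps[OF \<mu>] by simp
  interpret P: pair_prob_space \<nu> \<mu> ..
  note s = prob_measures_simps(2)[OF \<nu>] prob_measures_simps(2)[OF \<mu>]
  have "sets (\<nu> \<Otimes>\<^sub>M \<mu>) = sets (borel \<Otimes>\<^sub>M borel)" by (intro sets_pair_measure_cong s)
  then have add: "(\<lambda>(x::'a, y). x + y) \<in> measurable (\<nu> \<Otimes>\<^sub>M \<mu>) borel"
    using measurable_add_pair by (subst measurable_cong_sets[OF _ refl])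
  show conv: "convolution \<nu> \<mu> \<in> prob_measures"
    unfolding convolution_def prob_measures_def using P.prob_space_distr[OF add] by simp
  show "(\<integral>z. f z \<partial>convolution \<nu> \<mu>) = (\<integral>x. (\<integral>y. f (x + y) \<partial>\<mu>) \<partial>\<nu>)" if f: "bcont f" for f
  proof -
    note fm = bcont_measurable[OF f]
    obtain c where c: "c > 0" "\<And>x. \<bar>f x\<bar> \<le> c" using bcont_bound[OF f] by blast
    have "(\<integral>z. f z \<partial>convolution \<nu> \<mu>) = (\<integral>p. f (case p of (x, y) \<Rightarrow> x + y) \<partial>(\<nu> \<Otimes>\<^sub>M \<mu>))"
      unfolding convolution_def by (rule integral_distr[OF add fm])
    also have "\<dots> = (\<integral>x. (\<integral>y. f (x + y) \<partial>\<mu>) \<partial>\<nu>)"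
    proof (subst P.integral_fst'[symmetric])
      show "integrable (\<nu> \<Otimes>\<^sub>M \<mu>) (\<lambda>p. f (case p of (x, y) \<Rightarrow> x + y))"
        using c measurable_compose[OF add fm] by (intro P.integrable_const_bound[where B=c]) auto
    qed simp
    finally show ?thesis .
  qed
  show "c * measure \<nu> \<Omega> \<le> measure (convolution \<nu> \<mu>) W"
    if W: "open W" and c: "c \<ge> 0" and \<Omega>: "\<Omega> \<in> sets borel" and le: "\<And>x. x \<in> \<Omega> \<Longrightarrow> c \<le> measure \<mu> {y. x + y \<in> W}"
    for W c \<Omega>
  proof -
    interpret C: prob_space "convolution \<nu> \<mu>" using prob_measures_simps[OF conv] by simp
    have Wb: "W \<in> sets borel" using W by simp
    have sp: "space (\<nu> \<Otimes>\<^sub>M \<mu>) = UNIV"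
      using prob_measures_simps(3)[OF \<nu>] prob_measures_simps(3)[OF \<mu>] by (simp add: space_pair_measure)
    have meas: "(\<lambda>(x::'a, y). x + y) -` W \<in> sets (\<nu> \<Otimes>\<^sub>M \<mu>)"
      using measurable_sets[OF add Wb] sp by simp
    have "ennreal (c * measure \<nu> \<Omega>) = (\<integral>\<^sup>+x. ennreal c * indicator \<Omega> x \<partial>\<nu>)"
      using \<Omega> c s by (simp add: nn_integral_cmult_indicator N.emeasure_eq_measure ennreal_mult)
    also have "\<dots> \<le> (\<integral>\<^sup>+x. emeasure \<mu> (Pair x -` ((\<lambda>(x, y). x + y) -` W)) \<partial>\<nu>)"
    proof (rule nn_integral_mono)
      fix x
      have "Pair x -` ((\<lambda>(x, y). x + y) -` W) = {y. x + y \<in> W}" by auto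
      then show "ennreal c * indicator \<Omega> x \<le> emeasure \<mu> (Pair x -` ((\<lambda>(x, y). x + y) -` W))"
        using le[of x] by (auto simp: M.emeasure_eq_measure indicator_def)
    qed
    also have "\<dots> = emeasure (\<nu> \<Otimes>\<^sub>M \<mu>) ((\<lambda>(x, y). x + y) -` W)"
      by (rule M.emeasure_pair_measure_alt[symmetric, OF meas])
    also have "\<dots> = emeasure (convolution \<nu> \<mu>) W"
      unfolding convolution_def using emeasure_distr[OF add Wb] sp by simp
    finally show ?thesis by (simp add: C.emeasure_eq_measure)
  qed
qed

text \<open>Continuity in one factor is enough: \<mu> stays fixed while \<nu> tends to the Dirac
  measure at 0, the unit of convolution.\<close>

lemma continuous_map_convolution:
  fixes \<mu> :: "'a measure"
  assumes "\<mu> \<in> prob_measures"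
  shows "continuous_map weak_topology weak_topology (\<lambda>\<nu>. convolution \<nu> \<mu>)"
proof (rule weak_continuous_mapI)
  show "convolution \<nu> \<mu> \<in> prob_measures" if "\<nu> \<in> prob_measures" for \<nu> :: "'a measure"
    by (rule convolution_prob[OF that assms])
  show "\<exists>g. bcont g \<and> (\<forall>m\<in>prob_measures. (\<integral>x. f x \<partial>convolution m \<mu>) = (\<integral>x. g x \<partial>m))"
    if "bcont f" for f :: "'a \<Rightarrow> real"
    using bcont_translate_integral[OF assms that] convolution_integral[OF _ assms that]
    by (intro exI[of _ "\<lambda>x. \<integral>y. f (x + y) \<partial>\<mu>"]) auto
qed

lemma convolution_return_0:
  assumes "\<mu> \<in> prob_measures"
  shows "convolution (return borel 0) \<mu> = (\<mu> :: 'a measure)"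
proof (rule measure_eqI_bcont)
  have P: "convolution (return borel 0) \<mu> \<in> prob_measures"
    by (rule convolution_prob[OF return_prob_measures assms])
  show "finite_measure (convolution (return borel 0) \<mu>)" "finite_measure \<mu>"
    "sets (convolution (return borel 0) \<mu>) = sets borel" "sets \<mu> = sets borel"
    using P assms by (auto simp: prob_measures_def intro: prob_space.finite_measure)
  fix f :: "'a \<Rightarrow> real" assume f: "bcont f"
  show "(\<integral>x. f x \<partial>convolution (return borel 0) \<mu>) = (\<integral>x. f x \<partial>\<mu>)"
    using convolution_integral[OF return_prob_measures assms f]
      bcont_measurable[OF bcont_translate_integral[OF assms f]] by (simp add: integral_return)
qed

text \<open>Condition (3) supplies \<open>m\<close> in the closure, but convolution is available
  within \<open>\<M>\<close> only. Approximating \<open>m\<close> by \<open>\<nu>\<close> in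
  \<open>\<M>\<close> preserves the open conditions of being in \<open>Y\<close> and of giving
  \<open>\<Omega>\<close> almost full mass.\<close>

lemma mclosure_dense_near_1:
  assumes ad: "adequate T \<M>" and na: "null_accessible \<M>" and W: "W \<in> O_T T" and e: "e > 0"
  shows "mclosure \<M> \<subseteq> weak_topology closure_of (mclosure \<M> \<inter> {m \<in> prob_measures. 1 - e < measure m W})"
proof -
  have MP: "\<M> \<subseteq> prob_measures"
    using ad by (auto simp: adequate_def invariant_measures_def invariant_measure_def)
  then have MM: "\<M> \<subseteq> mclosure \<M>" unfolding mclosure_def by (intro closure_of_subset) simp
  have Wo: "open W" using W by (simp add: O_T_def)
  have "\<M> \<subseteq> weak_topology closure_of (mclosure \<M> \<inter> {m \<in> prob_measures. 1 - e < measure m W})"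
  proof
    fix \<mu> assume \<mu>M: "\<mu> \<in> \<M>"
    then have \<mu>: "invariant_measure T \<mu>" and \<mu>P: "\<mu> \<in> prob_measures"
      using ad MP by (auto simp: adequate_def invariant_measures_def)
    show "\<mu> \<in> weak_topology closure_of (mclosure \<M> \<inter> {m \<in> prob_measures. 1 - e < measure m W})"
      unfolding in_closure_of
    proof (intro conjI allI impI)
      show "\<mu> \<in> topspace weak_topology" using \<mu>P by simp
      fix X assume X: "\<mu> \<in> X \<and> openin weak_topology X"
      \<comment> \<open>One loss \<open>e'\<close> comes from \<mu> and one from \<nu>, and
        \<open>(1 - e') * (1 - e') \<ge> 1 - e\<close>. The bound 1/2 keeps the factor
        \<open>1 - e'\<close> positive.\<close>
      define e' where "e' = min (e / 2) (1/2)"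
      have e': "0 < e'" "e' \<le> 1/2" "2 * e' \<le> e" using e by (auto simp: e'_def)
      define \<Omega> where "\<Omega> = {x. 1 - e' < measure \<mu> {y. x + y \<in> W}}"
      obtain x where "1 - e' < measure \<mu> {y. x + y \<in> W}"
        using translate_measure_near_1[OF ad na \<mu> W, of "1 - e'"] e' by auto
      then have \<Omega>: "\<Omega> \<in> O_T T" unfolding \<Omega>_def by (rule translate_measure_in_O_T[OF \<mu> W])
      then have \<Omega>o: "open \<Omega>" by (simp add: O_T_def)
      define Y where "Y = {\<nu> \<in> topspace weak_topology. convolution \<nu> \<mu> \<in> X}"
      have Yo: "openin weak_topology Y" unfolding Y_def
        using continuous_map_convolution[OF \<mu>P] X by (intro openin_continuous_map_preimage) auto
      have Y0: "return borel 0 \<in> Y"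
        using X return_prob_measures convolution_return_0[OF \<mu>P] by (auto simp: Y_def)
      have "return borel 0 \<in> weak_topology closure_of (mclosure_on \<M> \<Omega>)"
        using na \<Omega> by (auto simp: null_accessible_def)
      then obtain m where m: "m \<in> mclosure_on \<M> \<Omega>" "m \<in> Y"
        by (rule closure_of_meets[OF _ Yo Y0])
      then have m1: "m \<in> mclosure \<M>" "measure m \<Omega> = 1" by (auto simp: mclosure_on_def measure_def)
      have mY: "m \<in> Y \<inter> {\<nu> \<in> prob_measures. 1 - e' < measure \<nu> \<Omega>}"
        using m m1 e' by (auto simp: Y_def)
      have Yo': "openin weak_topology (Y \<inter> {\<nu> \<in> prob_measures. 1 - e' < measure \<nu> \<Omega>})"
        by (intro openin_Int Yo openin_weak_measure_gt \<Omega>o)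
      obtain \<nu> where \<nu>: "\<nu> \<in> \<M>" "\<nu> \<in> Y \<inter> {\<nu> \<in> prob_measures. 1 - e' < measure \<nu> \<Omega>}"
        by (rule closure_of_meets[OF m1(1)[unfolded mclosure_def] Yo' mY])
      have \<nu>P: "\<nu> \<in> prob_measures" using \<nu> by simp
      have "convolution \<nu> \<mu> \<in> \<M>" using ad \<nu>(1) \<mu>M by (auto simp: adequate_def)
      moreover have "convolution \<nu> \<mu> \<in> X" using \<nu> by (auto simp: Y_def)
      moreover have "1 - e < measure (convolution \<nu> \<mu>) W"
      proof -
        have "(1 - e') * measure \<nu> \<Omega> \<le> measure (convolution \<nu> \<mu>) W"
          using e' \<Omega>o by (intro convolution_measure[OF \<nu>P \<mu>P Wo]) (auto simp: \<Omega>_def)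
        moreover have "(1 - e') * (1 - e') < (1 - e') * measure \<nu> \<Omega>"
          using \<nu> e' by (intro mult_strict_left_mono) auto
        moreover have "1 - e \<le> (1 - e') * (1 - e')"
        proof -
          have "(1 - e') * (1 - e') = 1 - 2 * e' + e' * e'" by (simp add: algebra_simps)
          moreover have "0 \<le> e' * e'" by simp
          ultimately show ?thesis using e' by linarith
        qed
        ultimately show ?thesis by linarith
      qed
      ultimately show "\<exists>y. y \<in> mclosure \<M> \<inter> {m \<in> prob_measures. 1 - e < measure m W} \<and> y \<in> X"
        using MM MP by (intro exI[of _ "convolution \<nu> \<mu>"]) auto
    qed
  qed
  then show ?thesis
    unfolding mclosure_def[of \<M>] by (intro closure_of_minimal) (auto simp: mclosure_def)
qed

text \<open>Mass 1 on the intersection means mass 1 on each \<open>W n\<close>, that is, countably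
  many open conditions, each of which is dense by \<open>mclosure_dense_near_1\<close>.\<close>

lemma dense_gdelta_INT:
  fixes W :: "nat \<Rightarrow> 'a set"
  assumes ad: "adequate T \<M>" and na: "null_accessible \<M>" and W: "\<And>n. W n \<in> O_T T"
  shows "dense_gdelta_in (mclosure_on \<M> (\<Inter>n. W n)) (mclosure \<M>)"
proof -
  define G where "G k = {m \<in> prob_measures. 1 - inverse (real (Suc (fst (prod_decode k)))) < measure m (W (snd (prod_decode k)))}"
    for k
  have Wo: "open (W n)" for n using W[of n] by (simp add: O_T_def)
  have Go: "openin weak_topology (G k)" for k
    unfolding G_def by (rule openin_weak_measure_gt[OF Wo])
  have cl: "closedin weak_topology (mclosure \<M>)" unfolding mclosure_def by simp
  have "m \<in> (\<Inter>k. G k) \<longleftrightarrow> emeasure m (\<Inter>n. W n) = 1" if mP: "m \<in> prob_measures" for m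
  proof -
    interpret prob_space m using prob_measures_simps[OF mP] by simp
    note sets = prob_measures_simps(2)[OF mP]
    have Ws: "W n \<in> sets m" for n using Wo sets by simp
    have "m \<in> (\<Inter>k. G k) \<longleftrightarrow> (\<forall>n i. 1 - inverse (real (Suc i)) < measure m (W n))"
    proof
      assume *: "m \<in> (\<Inter>k. G k)"
      show "\<forall>n i. 1 - inverse (real (Suc i)) < measure m (W n)"
      proof (intro allI)
        fix n i
        have "m \<in> G (prod_encode (i, n))" using * by blast
        then show "1 - inverse (real (Suc i)) < measure m (W n)" by (simp add: G_def)
      qed
    qed (use mP in \<open>simp add: G_def\<close>)
    also have "\<dots> \<longleftrightarrow> (\<forall>n. measure m (W n) = 1)"
    proof -
      have "measure m (W n) = 1" if "\<forall>i. 1 - inverse (real (Suc i)) < measure m (W n)" for n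
      proof (rule ccontr)
        assume "measure m (W n) \<noteq> 1"
        then have "0 < 1 - measure m (W n)" using prob_le_1[of "W n"] by linarith
        then obtain i where "inverse (real (Suc i)) < 1 - measure m (W n)" using reals_Archimedean by blast
        then show False using that[rule_format, of i] by linarith
      qed
      then show ?thesis by auto
    qed
    also have "\<dots> \<longleftrightarrow> (\<forall>n. AE x in m. x \<in> W n)" using AE_in_set_eq_1[OF Ws] by simp
    also have "\<dots> \<longleftrightarrow> (AE x in m. x \<in> (\<Inter>n. W n))" by (simp add: AE_all_countable)
    also have "\<dots> \<longleftrightarrow> emeasure m (\<Inter>n. W n) = 1"
      using Ws by (subst AE_in_set_eq_1) (auto simp: emeasure_eq_measure)
    finally show ?thesis .
  qed
  then have eq: "mclosure_on \<M> (\<Inter>n. W n) = mclosure \<M> \<inter> (\<Inter>k. G k)"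
    using mclosure_prob[of \<M>] by (auto simp: mclosure_on_def)
  have "mclosure \<M> \<subseteq> weak_topology closure_of (mclosure \<M> \<inter> (\<Inter>k. G k))"
  proof (rule weak_topology_Baire[OF cl Go])
    show "mclosure \<M> \<subseteq> weak_topology closure_of (mclosure \<M> \<inter> G k)" for k
      unfolding G_def by (rule mclosure_dense_near_1[OF ad na W]) simp
  qed
  then have "subtopology weak_topology (mclosure \<M>) closure_of (mclosure_on \<M> (\<Inter>n. W n)) = mclosure \<M>"
    unfolding eq closure_of_subtopology by (auto simp: Int_absorb1 Int_assoc[symmetric])
  moreover have "gdelta_in (subtopology weak_topology (mclosure \<M>)) (\<Inter>(range (\<lambda>k. mclosure \<M> \<inter> G k)))"
    by (rule gdelta_in_Inter) (auto intro!: open_imp_gdelta_in openin_subtopology_Int2 Go)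
  moreover have "\<Inter>(range (\<lambda>k. mclosure \<M> \<inter> G k)) = mclosure_on \<M> (\<Inter>n. W n)"
    unfolding eq by auto
  ultimately show ?thesis unfolding dense_gdelta_in_def by (auto simp: mclosure_on_def)
qed

section \<open>Rescaling and the Dirac measure at 0\<close>

lemma
  fixes m :: "'a measure"
  assumes m: "m \<in> prob_measures"
  shows rescale_prob: "rescale_measure r m \<in> prob_measures"
    and rescale_integral: "bcont f \<Longrightarrow> (\<integral>x. f x \<partial>rescale_measure r m) = (\<integral>x. f (inverse r *\<^sub>R x) \<partial>m)"
    and rescale_emeasure: "A \<in> sets borel \<Longrightarrow> emeasure (rescale_measure r m) A = emeasure m {x. inverse r *\<^sub>R x \<in> A}"
proof -
  have "continuous_on UNIV (\<lambda>x::'a. inverse r *\<^sub>R x)" by (intro tvs_continuous_intros)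
  then have [measurable]: "(\<lambda>x::'a. inverse r *\<^sub>R x) \<in> borel_measurable borel"
    by (rule borel_measurable_continuous_onI)
  have ms: "(\<lambda>x. inverse r *\<^sub>R x) \<in> measurable m borel" by (simp add: measurable_prob_measures[OF m])
  show "rescale_measure r m \<in> prob_measures"
    unfolding rescale_measure_def by (intro distr_prob_measures m) simp
  show "(\<integral>x. f x \<partial>rescale_measure r m) = (\<integral>x. f (inverse r *\<^sub>R x) \<partial>m)" if "bcont f"
    unfolding rescale_measure_def by (rule integral_distr[OF ms bcont_measurable[OF that]])
  show "emeasure (rescale_measure r m) A = emeasure m {x. inverse r *\<^sub>R x \<in> A}" if "A \<in> sets borel"
    unfolding rescale_measure_def using emeasure_distr[OF ms that] prob_measures_simps(3)[OF m]
    by (simp add: vimage_def)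
qed

lemma continuous_map_rescale: "continuous_map weak_topology weak_topology (rescale_measure r :: 'a measure \<Rightarrow> _)"
proof (rule weak_continuous_mapI)
  show "\<exists>g. bcont g \<and> (\<forall>m\<in>prob_measures. (\<integral>x. f x \<partial>rescale_measure r m) = (\<integral>x. g x \<partial>m))"
    if f: "bcont f" for f :: "'a \<Rightarrow> real"
  proof (intro exI conjI ballI)
    show "bcont (\<lambda>x. f (inverse r *\<^sub>R x))" by (intro bcont_compose[OF f] tvs_continuous_intros)
  qed (rule rescale_integral[OF _ f])
qed (rule rescale_prob)

lemma weak_lim_rescale:
  fixes m :: "'a measure"
  assumes m: "m \<in> prob_measures"
  shows "weak_lim (\<lambda>n. rescale_measure (real (Suc n)) m) (return borel 0)"
  unfolding weak_lim_def
proof (intro allI impI)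
  interpret prob_space m using prob_measures_simps[OF m] by simp
  fix f :: "'a \<Rightarrow> real" assume f: "bcont f"
  obtain c where c: "c > 0" "\<And>x. \<bar>f x\<bar> \<le> c" using bcont_bound[OF f] by blast
  have bc: "bcont (\<lambda>x. f (r *\<^sub>R x))" for r by (intro bcont_compose[OF f] tvs_continuous_intros)
  have meas: "(\<lambda>x. f (r *\<^sub>R x)) \<in> borel_measurable m" for r
    using bcont_measurable[OF bc] by (simp add: measurable_prob_measures[OF m])
  have "(\<lambda>n. \<integral>x. f (inverse (real (Suc n)) *\<^sub>R x) \<partial>m) \<longlonglongrightarrow> (\<integral>x. f (0 *\<^sub>R x) \<partial>m)"
  proof (rule integral_dominated_convergence[where w="\<lambda>_. c"])
    show "AE x in m. (\<lambda>n. f (inverse (real (Suc n)) *\<^sub>R x)) \<longlonglongrightarrow> f (0 *\<^sub>R x)"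
    proof (rule AE_I2)
      fix x
      have "continuous_on UNIV (\<lambda>r::real. f (r *\<^sub>R x))"
        using bcont_compose[OF f, of "\<lambda>r. r *\<^sub>R x"]
          continuous_on_scaleR'[OF continuous_on_id continuous_on_const] by (simp add: bcont_def)
      from continuous_on_tendsto_compose[OF this LIMSEQ_inverse_real_of_nat]
      show "(\<lambda>n. f (inverse (real (Suc n)) *\<^sub>R x)) \<longlonglongrightarrow> f (0 *\<^sub>R x)" by simp
    qed
  qed (use c meas in auto)
  then show "(\<lambda>n. \<integral>x. f x \<partial>rescale_measure (real (Suc n)) m) \<longlonglongrightarrow> (\<integral>x. f x \<partial>return borel 0)"
    using bcont_measurable[OF f] by (simp add: rescale_integral[OF m f] integral_return prob_space)
qed

text \<open>Adequacy speaks of \<open>\<M>\<close> itself; continuity of rescaling carries the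
  property over to the closure.\<close>

lemma rescale_mclosure:
  assumes "adequate T \<M>" "m \<in> mclosure \<M>" "r > 0"
  shows "rescale_measure r m \<in> mclosure \<M>"
proof -
  have "rescale_measure r ` (weak_topology closure_of \<M>) \<subseteq> weak_topology closure_of (rescale_measure r ` \<M>)"
    by (rule continuous_map_image_closure_subset[OF continuous_map_rescale])
  also have "\<dots> \<subseteq> weak_topology closure_of \<M>"
    using assms by (intro closure_of_mono) (auto simp: adequate_def)
  finally show ?thesis using assms(2) by (auto simp: mclosure_def)
qed

text \<open>This makes density informative: it gives (3) from (4), and it shows that the dense set
  of (5) is nonempty, whence (2).\<close>

lemma return_0_in_mclosure:
  assumes "adequate T \<M>"
  shows "return borel 0 \<in> mclosure \<M>"
proof -
  obtain \<mu> where \<mu>: "\<mu> \<in> \<M>" using assms by (auto simp: adequate_def)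
  have MP: "\<M> \<subseteq> prob_measures"
    using assms by (auto simp: adequate_def invariant_measures_def invariant_measure_def)
  show ?thesis unfolding mclosure_def
    using \<mu> MP assms
    by (intro weak_lim_in_closure[OF weak_lim_rescale[of \<mu>] return_prob_measures]) (auto simp: adequate_def)
qed

lemma HC_scaleR:
  assumes "x \<in> HC T" "c \<noteq> 0"
  shows "c *\<^sub>R x \<in> HC T"
  unfolding in_HC_iff
proof (intro allI impI)
  fix U :: "'a set" assume U: "open U" "U \<noteq> {}"
  have "open ((\<lambda>y. c *\<^sub>R y) -` U)" by (intro open_vimage U tvs_continuous_intros)
  moreover obtain u where "u \<in> U" using U by blast
  then have "inverse c *\<^sub>R u \<in> (\<lambda>y. c *\<^sub>R y) -` U" using assms(2) by simp
  then have "(\<lambda>y. c *\<^sub>R y) -` U \<noteq> {}" by blast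
  ultimately have "x \<in> hits T ((\<lambda>y. c *\<^sub>R y) -` U)" using assms(1) by (simp add: in_HC_iff)
  then show "c *\<^sub>R x \<in> hits T U" by (auto simp: hits_def linear_scale[OF funpow_linear])
qed

lemma null_accessible_if_HC:
  assumes ad: "adequate T \<M>" and m: "m \<in> mclosure \<M>" "emeasure m (HC T) = 1"
  shows "null_accessible \<M>"
  unfolding null_accessible_def
proof
  fix \<Omega> assume \<Omega>: "\<Omega> \<in> O_T T"
  have mP: "m \<in> prob_measures" using m(1) mclosure_prob by blast
  interpret prob_space m using prob_measures_simps[OF mP] by simp
  have "rescale_measure (real (Suc n)) m \<in> mclosure_on \<M> \<Omega>" for n
  proof -
    define r where "r = real (Suc n)"
    have r: "r > 0" by (simp add: r_def)
    have \<Omega>b: "\<Omega> \<in> sets borel" using \<Omega> by (simp add: O_T_def)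
    have "HC T \<subseteq> {x. inverse r *\<^sub>R x \<in> \<Omega>}"
      using HC_subset_O_T[OF \<Omega>] HC_scaleR[of _ "inverse r"] r by auto
    moreover have "{x. inverse r *\<^sub>R x \<in> \<Omega>} \<in> sets m"
    proof -
      have "open ((\<lambda>x. inverse r *\<^sub>R x) -` \<Omega>)"
        using \<Omega> by (intro open_vimage tvs_continuous_intros) (simp add: O_T_def)
      then show ?thesis using prob_measures_simps(2)[OF mP] by (simp add: vimage_def)
    qed
    ultimately have "emeasure m (HC T) \<le> emeasure m {x. inverse r *\<^sub>R x \<in> \<Omega>}" by (rule emeasure_mono)
    then have "emeasure m {x. inverse r *\<^sub>R x \<in> \<Omega>} = 1"
      using m(2) emeasure_le_1[of "{x. inverse r *\<^sub>R x \<in> \<Omega>}"] by (intro antisym) auto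
    then show ?thesis
      unfolding r_def[symmetric] mclosure_on_def
      using rescale_emeasure[OF mP \<Omega>b] rescale_mclosure[OF ad m(1) r] by simp
  qed
  then show "return borel 0 \<in> weak_topology closure_of (mclosure_on \<M> \<Omega>)"
    using mclosure_prob[of \<M>]
    by (intro weak_lim_in_closure[OF weak_lim_rescale[OF mP] return_prob_measures]) (auto simp: mclosure_on_def)
qed

lemma null_accessible_if_dense:
  assumes "adequate T \<M>" "\<And>V. V \<in> O_T T \<Longrightarrow> dense_gdelta_in (mclosure_on \<M> V) (mclosure \<M>)"
  shows "null_accessible \<M>"
  unfolding null_accessible_def
proof
  fix V assume "V \<in> O_T T"
  then have "subtopology weak_topology (mclosure \<M>) closure_of (mclosure_on \<M> V) = mclosure \<M>"
    using assms(2) by (simp add: dense_gdelta_in_def)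
  then have "return borel 0 \<in> subtopology weak_topology (mclosure \<M>) closure_of (mclosure_on \<M> V)"
    using return_0_in_mclosure[OF assms(1)] by simp
  then show "return borel 0 \<in> weak_topology closure_of (mclosure_on \<M> V)"
    unfolding closure_of_subtopology by (auto simp: mclosure_on_def Int_absorb1)
qed

end

section \<open>The cycle of implications\<close>

theorem theorem5:
  fixes T :: "'a::{polish_space, real_vector} \<Rightarrow> 'a"
    and \<M> :: "'a measure set"
  assumes add_cont: "continuous_on UNIV (\<lambda>(x::'a, y). x + y)"
    and scale_cont: "continuous_on UNIV (\<lambda>(r::real, x::'a). r *\<^sub>R x)"
    and lin: "linear T"
    and cont: "continuous_on UNIV T"
    and adeq: "adequate T \<M>"
  defines "C1 \<equiv> (\<exists>m. ergodic_measure T m \<and> full_support m \<and> m \<in> mclosure \<M>)"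
    and "C2 \<equiv> (\<exists>m\<in>mclosure \<M>. invariant_measure T m \<and> emeasure m (HC T) = 1)"
    and "C3 \<equiv> (\<forall>\<Omega>\<in>O_T T. return borel 0 \<in> weak_topology closure_of (mclosure_on \<M> \<Omega>))"
    and "C4 \<equiv> (\<forall>V\<in>O_T T. dense_gdelta_in (mclosure_on \<M> V) (mclosure \<M>))"
    and "C5 \<equiv> dense_gdelta_in (mclosure_on \<M> (HC T)) (mclosure \<M>)"
  shows "(C2 \<longleftrightarrow> C3) \<and> (C3 \<longleftrightarrow> C4) \<and> (C4 \<longleftrightarrow> C5) \<and> (C1 \<longrightarrow> C2) \<and>
         (C2 \<longrightarrow> (\<exists>m. ergodic_measure T m \<and> full_support m))"
proof -
  interpret polish_operator T by (rule polish_operator.intro) fact+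
  have C3: "C3 \<longleftrightarrow> null_accessible \<M>" unfolding C3_def null_accessible_def ..
  have C23: "C3" if C2
  proof -
    from \<open>C2\<close> obtain m where "m \<in> mclosure \<M>" "emeasure m (HC T) = 1" unfolding C2_def by blast
    then show ?thesis unfolding C3 by (rule null_accessible_if_HC[OF adeq])
  qed
  have C34: "C4" if C3
    unfolding C4_def
  proof
    fix V assume "V \<in> O_T T"
    then show "dense_gdelta_in (mclosure_on \<M> V) (mclosure \<M>)"
      using dense_gdelta_INT[OF adeq, of "\<lambda>_. V"] that[unfolded C3] by simp
  qed
  have C43: "C3" if C4
    unfolding C3 using that unfolding C4_def by (intro null_accessible_if_dense[OF adeq]) blast
  have C35: "C5" if C3
  proof -
    obtain U :: "nat \<Rightarrow> 'a set" where U: "\<And>n. open (U n)" "\<And>n. U n \<noteq> {}" "HC T = (\<Inter>n. hits T (U n))"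
      using HC_eq_INT_hits by metis
    then show ?thesis
      unfolding C5_def U(3) using that[unfolded C3] by (intro dense_gdelta_INT[OF adeq] hits_in_O_T[OF cont])
  qed
  have C52: "C2" if C5
  proof -
    have "mclosure_on \<M> (HC T) \<noteq> {}"
      using that return_0_in_mclosure[OF adeq] unfolding C5_def dense_gdelta_in_def by auto
    then obtain m where "m \<in> mclosure \<M>" "emeasure m (HC T) = 1" by (auto simp: mclosure_on_def)
    then show ?thesis
      unfolding C2_def using mclosure_invariant[OF adeq] by (auto simp: invariant_measures_def)
  qed
  have C12: "C2" if C1
  proof -
    from that obtain m where "ergodic_measure T m" "full_support m" "m \<in> mclosure \<M>"
      unfolding C1_def by blast
    then show ?thesis
      unfolding C2_def using ergodic_full_support_HC[OF _ _ cont, of m] by (auto simp: ergodic_measure_def)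
  qed
  have "\<exists>m. ergodic_measure T m \<and> full_support m" if C2
  proof -
    from that obtain m where m: "invariant_measure T m" "emeasure m (HC T) = 1"
      unfolding C2_def by blast
    obtain \<mu> where \<mu>: "ergodic_measure T \<mu>" "emeasure \<mu> (HC T) = 1"
      by (rule ergodic_measure_exists[OF m(1) cont HC_borel[OF cont] m(2)])
    then have "full_support \<mu>"
      using HC_full_support[OF _ cont] by (auto simp: ergodic_measure_def)
    then show ?thesis using \<mu>(1) by blast
  qed
  then show ?thesis using C23 C34 C43 C35 C52 C12 by blast
qed

end
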